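(* Let $q=2k$ be an even integer $\ge 4$. Then $[q-2,q)\cap\mathbb{Z}=\{O,E\}$, where $O=2k-1$ and $E=2k-2$ are the unique odd (respectively even) integers in the interval $[q-2,q)$, and the following hold. (1) $\mathrm{Prime}(q)$ has the homotopy type of a bouquet of spheres where there is one $j$-sphere in the bouquet for every way of writing an element of $\{O,E\}$ as a sum of $j+1$ distinct odd primes. (2) The dimension of the reduced $j$th homology, $\dim \bar H_j(\mathrm{Prime}(q),\mathbb{Q})$, is equal to the number of ways of writing an element of $\{O,E\}$ as a sum of $j+1$ distinct odd primes. (3) For $q\ge 6$, $\mathrm{Prime}(q)$ is not connected if and only if $O=q-1$ is a prime number. (4) For $q\ge 6$, $\mathrm{Prime}(q)$ has a non simply-connected component if and only if $E=q-2$ is a sum of two distinct odd primes. (5) Thus the Twin Prime Conjecture is equivalent to the statement that $\mathrm{Prime}(q)$ and $\mathrm{Prime}(q+2)$ are both disconnected complexes for infinitely many values of (the even integer) $q$. (6) The Goldbach Conjecture is equivalent to the statement that $\mathrm{Prime}(q)$ has a non simply-connected component for all (even) $q\ge 6$ with $q$ not equal to twice an odd prime. (The Goldbach Conjecture trivially holds for $q=2p$, $p$ an odd prime, anyway.)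
   Context: For an integer $q\ge 3$, $\mathrm{Prime}(q)$ is the simplicial complex whose faces are the nonempty finite sets of distinct primes whose sum is less than $q$ (so its vertices are the primes less than $q$, and a set of $j+1$ primes is a $j$-dimensional face). A bouquet of spheres is a wedge of a (possibly empty) collection of spheres, not necessarily of the same dimension, with $0$-spheres allowed; the empty bouquet is a point. $\bar H_j$ denotes reduced homology. "Ways of writing" an integer as a sum of $j+1$ distinct odd primes are unordered, i.e. are sets of $j+1$ distinct odd primes with the given sum. The Twin Prime Conjecture asserts that there are infinitely many primes $p$ with $p+2$ prime. The Goldbach Conjecture asserts that every even integer $\ge 4$ is a sum of two primes.
   Formalization: In (6), Prime(q) is replaced by Prime(q+2): as printed the condition fails at q=8, since Prime(8) is the path 3-2-5 plus the point 7. The parenthetical remark that Goldbach holds trivially for q=2p is not stated separately. *)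

theory Defs
  imports
    "HOL-Analysis.Analysis"
    "HOL-Computational_Algebra.Primes"
    "HOL-Library.Poly_Mapping"
    "Jordan_Normal_Form.VS_Connect"
begin

section \<open>Prime complexes\<close>

text \<open>
  A simplicial complex is represented by its set of nonempty finite faces.
\<close>

definition prime_complex :: "nat \<Rightarrow> nat set set" where
  "prime_complex q = {S. finite S \<and> S \<noteq> {} \<and> (\<forall>p\<in>S. prime p) \<and> \<Sum>S < q}"

definition odd_prime_sums :: "nat \<Rightarrow> nat \<Rightarrow> nat set set" where
  "odd_prime_sums r n = {S. finite S \<and> card S = r \<and> (\<forall>p\<in>S. prime p \<and> odd p) \<and> \<Sum>S = n}"

section \<open>Geometric realization\<close>

text \<open>
  Points are given by barycentric coordinates.  The set is a subspace of \<^typ>\<open>'v \<Rightarrow> real\<close>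
  with the product topology; for a finite complex (such as every prime complex) this is the
  usual topology of the realization.
\<close>

definition geom_realization :: "'v set set \<Rightarrow> ('v \<Rightarrow> real) set" where
  "geom_realization K =
     {x. (\<forall>v. 0 \<le> x v) \<and> {v. x v \<noteq> 0} \<in> K \<and> (\<Sum>v | x v \<noteq> 0. x v) = 1}"

definition has_non_simply_connected_component :: "'v set set \<Rightarrow> bool" where
  "has_non_simply_connected_component K \<longleftrightarrow>
     (\<exists>C \<in> components (geom_realization K). \<not> simply_connected C)"

section \<open>Bouquets of spheres\<close>

text \<open>
  The wedge is the quotient of the disjoint union of a point and of the spaces \<^term>\<open>X i\<close>
  that identifies all base points \<^term>\<open>b i\<close> with that point.  The class of the base points is
  represented by \<^const>\<open>None\<close>, any other point \<^term>\<open>x\<close> of \<^term>\<open>X i\<close> by \<^term>\<open>Some (i, x)\<close>.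
  The empty wedge is a point.
\<close>

definition wedge_incl :: "('i \<Rightarrow> 'a) \<Rightarrow> 'i \<Rightarrow> 'a \<Rightarrow> ('i \<times> 'a) option" where
  "wedge_incl b i x = (if x = b i then None else Some (i, x))"

definition wedge :: "('i \<Rightarrow> 'a topology) \<Rightarrow> ('i \<Rightarrow> 'a) \<Rightarrow> 'i set \<Rightarrow> ('i \<times> 'a) option topology" where
  "wedge X b I = topology (\<lambda>U.
     U \<subseteq> insert None (\<Union>i\<in>I. wedge_incl b i ` topspace (X i)) \<and>
     (\<forall>i\<in>I. openin (X i) {x \<in> topspace (X i). wedge_incl b i x \<in> U}))"

lemma openin_wedge:
  "openin (wedge X b I) U \<longleftrightarrow>
     U \<subseteq> insert None (\<Union>i\<in>I. wedge_incl b i ` topspace (X i)) \<and>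
     (\<forall>i\<in>I. openin (X i) {x \<in> topspace (X i). wedge_incl b i x \<in> U})"
proof -
  define T where "T = insert None (\<Union>i\<in>I. wedge_incl b i ` topspace (X i))"
  define P where "P = (\<lambda>i U. {x \<in> topspace (X i). wedge_incl b i x \<in> U})"
  have inter: "P i (A \<inter> B) = P i A \<inter> P i B" for i A B
    unfolding P_def by auto
  have union: "P i (\<Union>\<K>) = \<Union>(P i ` \<K>)" for i \<K>
    unfolding P_def by auto
  have "istopology (\<lambda>U. U \<subseteq> T \<and> (\<forall>i\<in>I. openin (X i) (P i U)))"
    unfolding istopology_def
  proof (rule conjI; intro allI impI)
    fix A B
    assume "A \<subseteq> T \<and> (\<forall>i\<in>I. openin (X i) (P i A))" "B \<subseteq> T \<and> (\<forall>i\<in>I. openin (X i) (P i B))"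
    then show "A \<inter> B \<subseteq> T \<and> (\<forall>i\<in>I. openin (X i) (P i (A \<inter> B)))"
      by (auto simp: inter)
  next
    fix \<K>
    assume "\<forall>A\<in>\<K>. A \<subseteq> T \<and> (\<forall>i\<in>I. openin (X i) (P i A))"
    then show "\<Union>\<K> \<subseteq> T \<and> (\<forall>i\<in>I. openin (X i) (P i (\<Union>\<K>)))"
      unfolding union by (intro conjI ballI openin_Union) auto
  qed
  then show ?thesis
    unfolding wedge_def T_def P_def by (simp add: topology_inverse')
qed

lemma topspace_wedge:
  "topspace (wedge X b I) = insert None (\<Union>i\<in>I. wedge_incl b i ` topspace (X i))"
    (is "_ = ?T")
proof (rule antisym)
  show "topspace (wedge X b I) \<subseteq> ?T"
    using openin_topspace[of "wedge X b I"] unfolding openin_wedge by (rule conjunct1)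
  have "{x \<in> topspace (X i). wedge_incl b i x \<in> ?T} = topspace (X i)" if "i \<in> I" for i
    using that by auto
  then have "openin (wedge X b I) ?T"
    unfolding openin_wedge by simp
  then show "?T \<subseteq> topspace (wedge X b I)"
    by (rule openin_subset)
qed

definition bouquet_of_spheres :: "('i \<Rightarrow> nat) \<Rightarrow> 'i set \<Rightarrow> ('i \<times> (nat \<Rightarrow> real)) option topology" where
  "bouquet_of_spheres d I =
     wedge (\<lambda>i. nsphere (d i)) (\<lambda>_ m. if m = 0 then 1 else 0) I"

section \<open>Reduced rational simplicial homology\<close>

text \<open>
  Faces are oriented by the order of the vertices: in \<open>{v\<^sub>0 < \<dots> < v\<^sub>j}\<close> the vertex \<open>v\<^sub>i\<close> has
  exactly \<open>i\<close> smaller vertices, so it is removed with the sign \<open>(-1)\<^sup>i\<close>.  The empty face is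
  adjoined in dimension \<open>-1\<close>; on vertices the boundary is thus the augmentation.  To include
  this dimension, chains are indexed by the number of vertices of the faces.
\<close>

definition chains :: "'v set set \<Rightarrow> nat \<Rightarrow> ('v set \<Rightarrow>\<^sub>0 rat) set" where
  "chains K r = {c. Poly_Mapping.keys c \<subseteq> {S \<in> insert {} K. card S = r}}"

definition boundary :: "('v::linorder set \<Rightarrow>\<^sub>0 rat) \<Rightarrow> ('v set \<Rightarrow>\<^sub>0 rat)" where
  "boundary c = (\<Sum>S\<in>Poly_Mapping.keys c. \<Sum>v\<in>S.
     Poly_Mapping.single (S - {v}) ((-1) ^ card {u\<in>S. u < v} * Poly_Mapping.lookup c S))"

definition cycles :: "'v::linorder set set \<Rightarrow> nat \<Rightarrow> ('v set \<Rightarrow>\<^sub>0 rat) set" where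
  "cycles K r = {c \<in> chains K r. boundary c = 0}"

definition boundaries :: "'v::linorder set set \<Rightarrow> nat \<Rightarrow> ('v set \<Rightarrow>\<^sub>0 rat) set" where
  "boundaries K r = boundary ` chains K (Suc r)"

text \<open>
  The quotient vector space \<open>Z / B\<close>; its elements are the cosets \<open>z + B\<close>.  In the scalar
  multiplication \<open>B\<close> is added again because of the scalar zero.  The fields
  \<^const>\<open>monoid.mult\<close> and \<^const>\<open>monoid.one\<close> of the record are irrelevant.
\<close>

definition quotient_space ::
    "('b \<Rightarrow>\<^sub>0 rat) set \<Rightarrow> ('b \<Rightarrow>\<^sub>0 rat) set \<Rightarrow> (rat, ('b \<Rightarrow>\<^sub>0 rat) set) module" where
  "quotient_space Z B = \<lparr>
     carrier = (\<lambda>z. (+) z ` B) ` Z,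
     mult = undefined, one = undefined,
     zero = B,
     add = (\<lambda>X Y. {x + y | x y. x \<in> X \<and> y \<in> Y}),
     smult = (\<lambda>a X. {Poly_Mapping.map (\<lambda>t. a * t) x + y | x y. x \<in> X \<and> y \<in> B})\<rparr>"

definition reduced_homology ::
    "'v::linorder set set \<Rightarrow> nat \<Rightarrow> (rat, ('v set \<Rightarrow>\<^sub>0 rat) set) module" where
  "reduced_homology K j = quotient_space (cycles K (j + 1)) (boundaries K (j + 1))"

section \<open>Conjectures\<close>

definition twin_prime_conjecture :: bool where
  "twin_prime_conjecture \<longleftrightarrow> infinite {p::nat. prime p \<and> prime (p + 2)}"

text \<open>
  An edge of odd primes with sum \<open>q\<close> gives a circle in the complex for \<open>q + 2\<close>, not in the one
  for \<open>q\<close>.  The criterion for the Goldbach conjecture therefore has to use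
  \<open>prime_complex (q + 2)\<close>: for instance \<open>prime_complex 8\<close> is the path \<open>3 - 2 - 5\<close> together with
  the isolated point \<open>7\<close>, so its components are simply connected, although \<open>8\<close> is not twice
  an odd prime.
\<close>

definition goldbach_conjecture :: bool where
  "goldbach_conjecture \<longleftrightarrow>
     (\<forall>n::nat. even n \<and> n \<ge> 4 \<longrightarrow> (\<exists>p r. prime p \<and> prime r \<and> n = p + r))"

end

theory Submission
  imports Defs "HOL-Complex_Analysis.Complex_Analysis"
begin

text \<open>
  The prime 2 is a cone point: a face of odd primes spans a face together with 2 unless its sum is
  one of the two integers in \<open>[q - 2, q)\<close>.  These exceptional faces are maximal, and their
  boundaries lie in the cone.  Contracting the cone therefore turns every exceptional face with
  \<open>j + 1\<close> vertices into a \<open>j\<close>-sphere.  Explicitly, the union of such a face \<open>S\<close> and the cone over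
  its boundary is the boundary of the simplex on \<open>S \<union> {2}\<close>, and a radial flow pushes the whole
  complex onto the wedge of these spheres.  The homology is computed directly with the cone
  operator, and simple connectedness in the absence of circles follows by the argument of van
  Kampen, attaching the faces one at a time.
\<close>

section \<open>Wedges\<close>

text \<open>The number 2 enters in two ways. It is the only even prime, so a face without it
  consists of odd primes; and it is the least prime, so a face whose sum is at least
  \<open>q - 2\<close> leaves no room for any further vertex. The sphere belonging to an exceptional
  face already lies inside the complex, so both directions of the homotopy equivalence are explicit
  maps: the inclusions of the spheres, and for each cell the collapse of everything outside its
  interior. The delicate point is to deform the complex continuously across the boundary of a cell,
  where the outward motion in the cell has to match the straight motion towards the apex; this
  dictates the weights of the flow. Dimension and parity do the rest. A cell with one vertex is an
  isolated point and has odd sum, a cell with two vertices gives a circle and has even sum, and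
  cells with three or more vertices influence neither connectedness nor simple connectedness. The
  latter is proved on the complex itself and not deduced from the bouquet.\<close>

definition to_wedge :: "('i \<Rightarrow> 'a) \<Rightarrow> 'i set \<Rightarrow> ('i \<Rightarrow> 'a) \<Rightarrow> ('i \<times> 'a) option" where
  "to_wedge b I p = (if \<exists>i\<in>I. p i \<noteq> b i
     then Some (SOME i. i \<in> I \<and> p i \<noteq> b i, p (SOME i. i \<in> I \<and> p i \<noteq> b i)) else None)"

lemma to_wedge_base: "(\<And>i. i \<in> I \<Longrightarrow> p i = b i) \<Longrightarrow> to_wedge b I p = None"
  by (auto simp: to_wedge_def)

lemma to_wedge_eq:
  assumes "i \<in> I" "p i \<noteq> b i" "\<And>k. k \<in> I \<Longrightarrow> p k \<noteq> b k \<Longrightarrow> k = i"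
  shows "to_wedge b I p = Some (i, p i)"
proof -
  have "(SOME i. i \<in> I \<and> p i \<noteq> b i) = i"
    by (rule some_equality) (use assms(1,2) in blast, use assms(3) in blast)
  with assms(1,2) show ?thesis unfolding to_wedge_def by auto
qed

lemma to_wedge_incl:
  assumes "i \<in> I" "\<And>k. k \<in> I \<Longrightarrow> k \<noteq> i \<Longrightarrow> p k = b k"
  shows "to_wedge b I p = wedge_incl b i (p i)"
proof (cases "p i = b i")
  case True
  with assms(2) have "p k = b k" if "k \<in> I" for k using that by metis
  with True show ?thesis by (simp add: to_wedge_base wedge_incl_def)
next
  case False
  have "to_wedge b I p = Some (i, p i)"
    by (rule to_wedge_eq) (use assms False in blast)+
  with False show ?thesis by (simp add: wedge_incl_def)
qed

text \<open>The family \<open>p i y\<close> holds the coordinates of a point of the wedge, at most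
  one of them off its base point. If an open set \<open>U\<close> contains \<open>None\<close>, its
  preimage is the intersection over \<open>i\<close> of the preimages of the traces of
  \<open>U\<close> on the factors, which is open because \<open>I\<close> is finite; otherwise it is
  the union of these preimages.\<close>

lemma continuous_map_to_wedge:
  assumes "finite I" and b: "\<And>i. i \<in> I \<Longrightarrow> b i \<in> topspace (X i)"
    and cont: "\<And>i. i \<in> I \<Longrightarrow> continuous_map Y (X i) (p i)"
    and sep: "\<And>y i k. \<lbrakk>y \<in> topspace Y; i \<in> I; k \<in> I; p i y \<noteq> b i; p k y \<noteq> b k\<rbrakk> \<Longrightarrow> i = k"
  shows "continuous_map Y (wedge X b I) (\<lambda>y. to_wedge b I (\<lambda>i. p i y))"
proof -
  let ?f = "\<lambda>y. to_wedge b I (\<lambda>i. p i y)"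
  have val: "(\<forall>i\<in>I. p i y = b i) \<and> ?f y = None \<or>
      (\<exists>i\<in>I. p i y \<noteq> b i \<and> ?f y = Some (i, p i y) \<and> (\<forall>k\<in>I. k \<noteq> i \<longrightarrow> p k y = b k))"
    if y: "y \<in> topspace Y" for y
  proof (cases "\<forall>i\<in>I. p i y = b i")
    case True
    then show ?thesis by (simp add: to_wedge_base)
  next
    case False
    then obtain i where i: "i \<in> I" "p i y \<noteq> b i" by blast
    moreover have "k = i" if "k \<in> I" "p k y \<noteq> b k" for k using sep[OF y] i that by blast
    ultimately show ?thesis using to_wedge_eq[of i I "\<lambda>i. p i y" b] by blast
  qed
  have inX: "p i y \<in> topspace (X i)" if "i \<in> I" "y \<in> topspace Y" for i y
    using cont[OF that(1)] that(2) by (auto simp: continuous_map_def)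
  have "openin Y {y \<in> topspace Y. ?f y \<in> U}" if U: "openin (wedge X b I) U" for U
  proof -
    have UX: "openin (X i) {x \<in> topspace (X i). wedge_incl b i x \<in> U}" (is "openin _ (?U i)") if "i \<in> I" for i
      using U that unfolding openin_wedge by blast
    have pre: "openin Y {y \<in> topspace Y. p i y \<in> ?U i}" if "i \<in> I" for i
      using openin_continuous_map_preimage[OF cont[OF that] UX[OF that]] by simp
    have mem: "?f y \<in> U \<longleftrightarrow> (if None \<in> U then (\<forall>i\<in>I. p i y \<in> ?U i) else (\<exists>i\<in>I. p i y \<in> ?U i))"
      if y: "y \<in> topspace Y" for y
      using val[OF y]
    proof
      assume *: "(\<forall>i\<in>I. p i y = b i) \<and> ?f y = None"
      then show ?thesis using b by (auto simp: wedge_incl_def)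
    next
      assume "\<exists>i\<in>I. p i y \<noteq> b i \<and> ?f y = Some (i, p i y) \<and> (\<forall>k\<in>I. k \<noteq> i \<longrightarrow> p k y = b k)"
      then obtain i where i: "i \<in> I" "p i y \<noteq> b i" "?f y = Some (i, p i y)"
        "\<And>k. k \<in> I \<Longrightarrow> k \<noteq> i \<Longrightarrow> p k y = b k" by blast
      have ii: "p i y \<in> ?U i \<longleftrightarrow> ?f y \<in> U"
        using i inX[OF i(1) y] by (simp add: wedge_incl_def)
      have kk: "p k y \<in> ?U k \<longleftrightarrow> None \<in> U" if "k \<in> I" "k \<noteq> i" for k
        using i(4)[OF that] b[OF that(1)] by (simp add: wedge_incl_def)
      show ?thesis
      proof (cases "None \<in> U")
        case True
        then have "(\<forall>k\<in>I. p k y \<in> ?U k) \<longleftrightarrow> p i y \<in> ?U i" using i(1) kk by blast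
        with True ii show ?thesis by (simp only: if_True)
      next
        case False
        then have "(\<exists>k\<in>I. p k y \<in> ?U k) \<longleftrightarrow> p i y \<in> ?U i" using i(1) kk by blast
        with False ii show ?thesis by (simp only: if_False)
      qed
    qed
    show ?thesis
    proof (cases "None \<in> U")
      case True
      then have "{y \<in> topspace Y. ?f y \<in> U} = topspace Y \<inter> \<Inter>((\<lambda>i. {y \<in> topspace Y. p i y \<in> ?U i}) ` I)"
        using mem by auto
      also have "openin Y \<dots>"
      proof (cases "I = {}")
        case False
        then show ?thesis using \<open>finite I\<close> pre by (intro openin_Int openin_Inter) auto
      qed simp
      finally show ?thesis .
    next
      case False
      then have "{y \<in> topspace Y. ?f y \<in> U} = \<Union>((\<lambda>i. {y \<in> topspace Y. p i y \<in> ?U i}) ` I)"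
        using mem by auto
      then show ?thesis using pre by auto
    qed
  qed
  moreover have "?f y \<in> topspace (wedge X b I)" if "y \<in> topspace Y" for y
    using val[OF that] inX[OF _ that] unfolding topspace_wedge
    by (force simp: wedge_incl_def image_iff)
  ultimately show ?thesis by (auto simp: continuous_map_def)
qed

definition from_wedge :: "'b \<Rightarrow> ('i \<Rightarrow> 'a \<Rightarrow> 'b) \<Rightarrow> ('i \<times> 'a) option \<Rightarrow> 'b" where
  "from_wedge y g w = (case w of None \<Rightarrow> y | Some (i, x) \<Rightarrow> g i x)"

lemma from_wedge_simps [simp]:
  "from_wedge y g None = y" "from_wedge y g (Some (i, x)) = g i x"
  by (simp_all add: from_wedge_def)

lemma from_wedge_incl: "g i (b i) = y \<Longrightarrow> from_wedge y g (wedge_incl b i x) = g i x"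
  by (simp add: wedge_incl_def)

lemma continuous_map_from_wedge:
  assumes y: "y \<in> topspace Y"
    and cont: "\<And>i. i \<in> I \<Longrightarrow> continuous_map (X i) Y (g i)"
    and base: "\<And>i. i \<in> I \<Longrightarrow> g i (b i) = y"
  shows "continuous_map (wedge X b I) Y (from_wedge y g)"
proof -
  have "openin (wedge X b I) {w \<in> topspace (wedge X b I). from_wedge y g w \<in> U}" if U: "openin Y U" for U
    unfolding openin_wedge
  proof (intro conjI ballI)
    fix i assume i: "i \<in> I"
    have "{x \<in> topspace (X i). wedge_incl b i x \<in> {w \<in> topspace (wedge X b I). from_wedge y g w \<in> U}}
        = {x \<in> topspace (X i). g i x \<in> U}"
      using i from_wedge_incl[of g i b y, OF base[OF i]] unfolding topspace_wedge by auto
    then show "openin (X i) {x \<in> topspace (X i). wedge_incl b i x \<in> {w \<in> topspace (wedge X b I). from_wedge y g w \<in> U}}"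
      using openin_continuous_map_preimage[OF cont[OF i] U] by simp
  qed (auto simp: topspace_wedge)
  moreover have "from_wedge y g w \<in> topspace Y" if "w \<in> topspace (wedge X b I)" for w
    using that y cont base unfolding topspace_wedge
    by (auto simp: from_wedge_incl continuous_map_def Pi_iff)
  ultimately show ?thesis by (auto simp: continuous_map_def)
qed

text \<open>The homotopies of the factors are assembled into one of the wedge by means of the
  retractions of the wedge onto its factors, which avoids products of quotient maps.\<close>

lemma homotopy_equivalent_wedge:
  assumes "finite I" and b: "\<And>i. i \<in> I \<Longrightarrow> b i \<in> topspace (X i)" and y0: "y0 \<in> topspace Y"
    and p: "\<And>i. i \<in> I \<Longrightarrow> continuous_map Y (X i) (p i)"
    and g: "\<And>i. i \<in> I \<Longrightarrow> continuous_map (X i) Y (g i)"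
    and base: "\<And>i. i \<in> I \<Longrightarrow> g i (b i) = y0"
    and sep: "\<And>y i k. \<lbrakk>y \<in> topspace Y; i \<in> I; k \<in> I; p i y \<noteq> b i; p k y \<noteq> b k\<rbrakk> \<Longrightarrow> i = k"
    and cross: "\<And>i k x. \<lbrakk>i \<in> I; k \<in> I; i \<noteq> k; x \<in> topspace (X i)\<rbrakk> \<Longrightarrow> p k (g i x) = b k"
    and h: "\<And>i. i \<in> I \<Longrightarrow> homotopic_with (\<lambda>f. f (b i) = b i) (X i) (X i) (p i \<circ> g i) id"
    and H: "homotopic_with (\<lambda>_. True) Y Y r id"
    and r: "\<And>i y. \<lbrakk>i \<in> I; y \<in> topspace Y; p i y \<noteq> b i\<rbrakk> \<Longrightarrow> r y = g i (p i y)"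
    and r0: "\<And>y. y \<in> topspace Y \<Longrightarrow> (\<And>i. i \<in> I \<Longrightarrow> p i y = b i) \<Longrightarrow> r y = y0"
  shows "Y homotopy_equivalent_space wedge X b I"
proof -
  let ?W = "wedge X b I"
  define f where "f = (\<lambda>y. to_wedge b I (\<lambda>i. p i y))"
  define G where "G = from_wedge y0 g"
  \<comment> \<open>\<open>q k\<close> retracts the wedge onto the factor \<open>X k\<close> by
    collapsing all other factors. The map \<open>P\<close> defined below runs the homotopy of each
    factor on these coordinates.\<close>
  define q where "q = (\<lambda>k. from_wedge (b k) (\<lambda>i x. if i = k then x else b k))"
  have f: "continuous_map Y ?W f"
    unfolding f_def by (rule continuous_map_to_wedge) (use assms in auto)
  have G: "continuous_map ?W Y G"
    unfolding G_def by (rule continuous_map_from_wedge) (use assms in auto)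
  have q: "continuous_map ?W (X k) (q k)" if "k \<in> I" for k
    unfolding q_def
    by (rule continuous_map_from_wedge) (use b that in \<open>auto simp: continuous_map_const\<close>)
  have qi: "q k (wedge_incl b i x) = (if i = k then x else b k)" for i k x
    by (simp add: q_def from_wedge_incl wedge_incl_def)
  obtain h where
    h: "\<And>i. i \<in> I \<Longrightarrow> continuous_map (prod_topology (top_of_set {0..1::real}) (X i)) (X i) (h i)"
    and h0: "\<And>i x. i \<in> I \<Longrightarrow> h i (0, x) = p i (g i x)"
    and h1: "\<And>i x. i \<in> I \<Longrightarrow> h i (1, x) = x"
    and hb: "\<And>i t. i \<in> I \<Longrightarrow> t \<in> {0..1} \<Longrightarrow> h i (t, b i) = b i"
  proof -
    have "\<forall>i\<in>I. \<exists>h. continuous_map (prod_topology (top_of_set {0..1::real}) (X i)) (X i) h \<and>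
       (\<forall>x. h (0, x) = p i (g i x)) \<and> (\<forall>x. h (1, x) = x) \<and> (\<forall>t\<in>{0..1}. h (t, b i) = b i)"
      using h unfolding homotopic_with_def by fastforce
    then obtain h where "\<forall>i\<in>I. continuous_map (prod_topology (top_of_set {0..1::real}) (X i)) (X i) (h i) \<and>
       (\<forall>x. h i (0, x) = p i (g i x)) \<and> (\<forall>x. h i (1, x) = x) \<and> (\<forall>t\<in>{0..1}. h i (t, b i) = b i)"
      by (auto simp: bchoice_iff)
    then show thesis by (intro that[of h]) blast+
  qed
  define P where "P = (\<lambda>i (t, w). h i (t, q i w))"
  have Wcases: "w = None \<or> (\<exists>i\<in>I. \<exists>x\<in>topspace (X i). w = wedge_incl b i x)"
    if "w \<in> topspace ?W" for w
    using that unfolding topspace_wedge by auto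
  have P_other: "P k (t, wedge_incl b i x) = b k" if "i \<noteq> k" "k \<in> I" "t \<in> {0..1}" for i k t x
    using that by (simp add: P_def qi hb)
  have P_None: "P k (t, None) = b k" if "k \<in> I" "t \<in> {0..1}" for k t
    using that by (simp add: P_def q_def hb)
  have contP: "continuous_map (prod_topology (top_of_set {0..1::real}) ?W) (X i) (P i)" if "i \<in> I" for i
  proof -
    have "continuous_map (prod_topology (top_of_set {0..1::real}) ?W)
        (prod_topology (top_of_set {0..1::real}) (X i)) (\<lambda>(t, w). (t, q i w))"
      unfolding case_prod_unfold
      by (intro continuous_map_pairedI continuous_map_fst
           continuous_map_compose[OF continuous_map_snd q[OF that], unfolded o_def])
    from continuous_map_compose[OF this h[OF that]] show ?thesis
      by (simp add: P_def o_def case_prod_unfold)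
  qed
  have "continuous_map (prod_topology (top_of_set {0..1::real}) ?W) ?W (\<lambda>z. to_wedge b I (\<lambda>i. P i z))"
  proof (rule continuous_map_to_wedge)
    fix z i k
    assume z: "z \<in> topspace (prod_topology (top_of_set {0..1::real}) ?W)"
      and ik: "i \<in> I" "k \<in> I" "P i z \<noteq> b i" "P k z \<noteq> b k"
    obtain t w where tw: "z = (t, w)" "t \<in> {0..1}" "w \<in> topspace ?W" using z by force
    \<comment> \<open>A point of one factor has base point coordinates in all others, and the
      pointed homotopies keep them there, so a second coordinate never leaves its base
      point.\<close>
    show "i = k" using Wcases[OF tw(3)] ik tw(1,2) P_other P_None by metis
  qed (use assms(1) b contP in auto)
  moreover have "to_wedge b I (\<lambda>i. P i (0, w)) = f (G w)" if "w \<in> topspace ?W" for w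
    using Wcases[OF that]
  proof
    assume "w = None"
    \<comment> \<open>The pointed homotopy at time 0 sends \<open>b i\<close> both to
      \<open>b i\<close> and to \<open>p i (g i (b i))\<close>, that is to
      \<open>p i y0\<close>.\<close>
    moreover have "p i y0 = b i" if "i \<in> I" for i
      using hb[OF that, of 0] h0[OF that] base[OF that] by simp
    ultimately show ?thesis by (simp add: f_def G_def to_wedge_base P_None)
  next
    assume "\<exists>i\<in>I. \<exists>x\<in>topspace (X i). w = wedge_incl b i x"
    then obtain i x where i: "i \<in> I" "x \<in> topspace (X i)" "w = wedge_incl b i x" by blast
    have Gw: "G w = g i x" using from_wedge_incl[of g i b y0 x] base[OF i(1)] by (simp add: G_def i(3))
    have "P i (0, w) = p i (g i x)" using i by (simp add: P_def qi h0)
    moreover have "to_wedge b I (\<lambda>k. P k (0, w)) = wedge_incl b i (P i (0, w))"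
      by (rule to_wedge_incl[OF i(1)]) (use i(3) P_other[of i _ 0 x] in auto)
    moreover have "to_wedge b I (\<lambda>k. p k (g i x)) = wedge_incl b i (p i (g i x))"
      by (rule to_wedge_incl[OF i(1)]) (use i(1,2) cross in auto)
    ultimately show ?thesis by (simp add: f_def Gw)
  qed
  moreover have "to_wedge b I (\<lambda>i. P i (1, w)) = w" if "w \<in> topspace ?W" for w
    using Wcases[OF that]
  proof
    assume "w = None"
    then show ?thesis by (simp add: to_wedge_base P_None)
  next
    assume "\<exists>i\<in>I. \<exists>x\<in>topspace (X i). w = wedge_incl b i x"
    then obtain i x where i: "i \<in> I" "x \<in> topspace (X i)" "w = wedge_incl b i x" by blast
    have "P i (1, w) = x" using i by (simp add: P_def qi h1)
    then show ?thesis using to_wedge_incl[of i I "\<lambda>i. P i (1, w)" b] P_other[of i _ 1 x] i by auto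
  qed
  ultimately have fG: "homotopic_with (\<lambda>_. True) ?W ?W (f \<circ> G) id"
    by (subst homotopic_with, simp, intro exI[of _ "\<lambda>z. to_wedge b I (\<lambda>i. P i z)"]) auto
  have "r y = (G \<circ> f) y" if y: "y \<in> topspace Y" for y
  proof (cases "\<forall>i\<in>I. p i y = b i")
    case True
    then show ?thesis using r0[OF y] by (simp add: f_def G_def to_wedge_base)
  next
    case False
    then obtain i where i: "i \<in> I" "p i y \<noteq> b i" by blast
    moreover have "k = i" if "k \<in> I" "p k y \<noteq> b k" for k using sep[OF y] i that by blast
    ultimately have "f y = Some (i, p i y)" unfolding f_def by (intro to_wedge_eq)
    with r[OF i(1) y i(2)] show ?thesis by (simp add: G_def)
  qed
  then have "homotopic_with (\<lambda>_. True) Y Y (G \<circ> f) id"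
    by (intro homotopic_with_eq[OF H]) auto
  with f G fG show ?thesis unfolding homotopy_equivalent_space_def by blast
qed

section \<open>The boundary of a simplex as a sphere\<close>

lemma continuous_on_Min_image:
  fixes f :: "'v \<Rightarrow> 'a::topological_space \<Rightarrow> real"
  assumes "finite S" "S \<noteq> {}" "\<And>v. v \<in> S \<Longrightarrow> continuous_on A (f v)"
  shows "continuous_on A (\<lambda>x. Min ((\<lambda>v. f v x) ` S))"
  using assms
proof (induction rule: finite_ne_induct)
  case (insert v F)
  then have "continuous_on A (\<lambda>x. min (f v x) (Min ((\<lambda>v. f v x) ` F)))"
    by (intro continuous_on_min) auto
  then show ?case using insert by simp
qed simp

lemma continuous_on_coordinate:
  "continuous_on A (\<lambda>x::'v \<Rightarrow> 'b::topological_space. x v)"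
  by (rule continuous_on_subset[OF continuous_on_product_coordinates]) simp

definition vertex_point :: "'v \<Rightarrow> 'v \<Rightarrow> real" where
  "vertex_point a = (\<lambda>v. if v = a then 1 else 0)"

definition simplex_boundary :: "'v set \<Rightarrow> ('v \<Rightarrow> real) set" where
  "simplex_boundary T = {x. (\<forall>v. 0 \<le> x v) \<and> (\<forall>v. v \<notin> T \<longrightarrow> x v = 0) \<and> (\<exists>v\<in>T. x v = 0) \<and> sum x T = 1}"

definition nsphere_base :: "nat \<Rightarrow> real" where
  "nsphere_base = (\<lambda>m. if m = 0 then 1 else 0)"

lemma nsphere_top_of_set:
  "nsphere d = top_of_set {x. (\<Sum>i\<le>d. (x i)\<^sup>2) = 1 \<and> (\<forall>i>d. x i = 0)}"
  by (simp add: nsphere euclidean_product_topology)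

text \<open>Radial projection: modulo the constant functions on \<open>T\<close>, whose quotient is coordinatized by
  the differences with the value at one vertex \<open>c\<close>, the boundary of the simplex surrounds the
  origin.  Its point on a given ray is found by subtracting the minimum and normalizing the sum.\<close>

lemma simplex_boundary_homeomorphic_nsphere:
  fixes T :: "'v set"
  assumes T: "finite T" "card T = d + 2" and a: "a \<in> T"
  obtains h k where "homeomorphic_maps (top_of_set (simplex_boundary T)) (nsphere d) h k"
    "h (vertex_point a) = nsphere_base" "k nsphere_base = vertex_point a"
proof -
  have "card (T - {a}) = d + 1" using T a by simp
  then obtain c where c: "c \<in> T" "c \<noteq> a"
    by (metis Diff_iff card.empty ex_in_conv insertI1 nat.distinct(1) Suc_eq_plus1)
  have "card (T - {a, c}) = d" using T a c by (simp add: card_Diff_subset)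
  then obtain e where e: "bij_betw e {0..<d} (T - {a, c})"
    using ex_bij_betw_nat_finite[of "T - {a, c}"] T by auto
  \<comment> \<open>An enumeration of \<open>T - {c}\<close> that starts with \<open>a\<close>, so
    that the vertex \<open>a\<close> lands on the first unit vector, which is the base point of the
    sphere. The vertex \<open>c\<close> is the reference for the differences.\<close>
  define \<beta> where "\<beta> = (\<lambda>i. case i of 0 \<Rightarrow> a | Suc n \<Rightarrow> e n)"
  have \<beta>0: "\<beta> 0 = a" by (simp add: \<beta>_def)
  have inj: "inj_on \<beta> {..d}"
  proof (rule inj_onI)
    fix i j assume ij: "i \<in> {..d}" "j \<in> {..d}" "\<beta> i = \<beta> j"
    have "(e n = a) = False" "(a = e n) = False" if "n < d" for n
      using bij_betwE[OF e] that by auto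
    moreover have "(e n = e m) = (n = m)" if "n < d" "m < d" for n m
      using e that by (auto simp: bij_betw_def inj_on_def)
    ultimately show "i = j" using ij by (cases i; cases j) (simp_all add: \<beta>_def Suc_le_eq)
  qed
  have im: "\<beta> ` {..d} = T - {c}"
  proof -
    have "{..d} = insert 0 (Suc ` {0..<d})"
      by auto
    then have "\<beta> ` {..d} = insert a (\<beta> ` Suc ` {0..<d})" by (simp only: image_insert \<beta>0)
    also have "\<beta> ` Suc ` {0..<d} = e ` {0..<d}" by (simp only: image_image) (simp add: \<beta>_def)
    finally have "\<beta> ` {..d} = insert a (e ` {0..<d})" .
    then show ?thesis using e a c by (auto simp: bij_betw_def)
  qed
  have \<beta>T: "\<beta> i \<in> T" "\<beta> i \<noteq> c" if "i \<le> d" for i using im that by auto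
  define \<gamma> where "\<gamma> = inv_into {..d} \<beta>"
  have \<gamma>\<beta>: "\<gamma> (\<beta> i) = i" if "i \<le> d" for i using that inj by (simp add: \<gamma>_def)
  have \<beta>\<gamma>: "\<beta> (\<gamma> v) = v" "\<gamma> v \<le> d" if "v \<in> T" "v \<noteq> c" for v
    using that im f_inv_into_f[of v \<beta> "{..d}"] inv_into_into[of v \<beta> "{..d}"] by (auto simp: \<gamma>_def)
  let ?B = "simplex_boundary T" and ?N = "{x. (\<Sum>i\<le>d. (x i)\<^sup>2) = 1 \<and> (\<forall>i>d. x i = (0::real))}"
  define N where "N = (\<lambda>x::'v \<Rightarrow> real. sqrt (\<Sum>i\<le>d. (x (\<beta> i) - x c)\<^sup>2))"
  define h where "h = (\<lambda>x i. if i \<le> d then (x (\<beta> i) - x c) / N x else 0)"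
  \<comment> \<open>\<open>w z\<close> lifts \<open>z\<close> to a function on \<open>T\<close> that
    is 0 at \<open>c\<close>. Subtracting its minimum \<open>\<mu> z\<close> makes it nonnegative
    with a zero, and \<open>D z\<close> is the resulting total by which \<open>k\<close>
    normalizes.\<close>
  define w where "w = (\<lambda>z v. if v = c then 0 else (z (\<gamma> v) :: real))"
  define \<mu> where "\<mu> = (\<lambda>z. Min ((\<lambda>v. w z v) ` T))"
  define D where "D = (\<lambda>z. \<Sum>v\<in>T. w z v - \<mu> z)"
  define k where "k = (\<lambda>z v. if v \<in> T then (w z v - \<mu> z) / D z else 0)"
  have N_pos: "N x > 0" if "x \<in> ?B" for x
  proof (rule ccontr)
    assume "\<not> N x > 0"
    then have "(\<Sum>i\<le>d. (x (\<beta> i) - x c)\<^sup>2) = 0"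
      unfolding N_def by (metis order.not_eq_order_implies_strict real_sqrt_ge_zero real_sqrt_eq_zero_cancel sum_nonneg zero_le_power2)
    then have eq: "x (\<beta> i) = x c" if "i \<le> d" for i
      using that by (subst (asm) sum_nonneg_eq_0_iff) auto
    have "x v = x c" if "v \<in> T" for v
      using eq[of "\<gamma> v"] \<beta>\<gamma>[OF that] by (cases "v = c") auto
    then have "x v = 0" if "v \<in> T" for v using \<open>x \<in> ?B\<close> that unfolding simplex_boundary_def by auto
    then show False using \<open>x \<in> ?B\<close> unfolding simplex_boundary_def by simp
  qed
  have \<mu>_le: "\<mu> z \<le> w z v" if "v \<in> T" for z v
    unfolding \<mu>_def using T that by simp
  have \<mu>_in: "\<exists>v\<in>T. w z v = \<mu> z" for z
  proof -
    have "\<mu> z \<in> (\<lambda>v. w z v) ` T" unfolding \<mu>_def using T c by (intro Min_in) auto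
    then show ?thesis by auto
  qed
  have D_pos: "D z > 0" if "z \<in> ?N" for z
  proof (rule ccontr)
    assume "\<not> D z > 0"
    moreover have "D z \<ge> 0" unfolding D_def using \<mu>_le by (intro sum_nonneg) simp
    ultimately have "D z = 0" by simp
    then have eq: "w z v = \<mu> z" if "v \<in> T" for v
      unfolding D_def using that \<mu>_le T by (subst (asm) sum_nonneg_eq_0_iff) auto
    have "\<mu> z = 0" using eq[OF c(1)] by (simp add: w_def)
    then have "z i = 0" if "i \<le> d" for i
      using eq[OF \<beta>T(1)[OF that]] \<beta>T(2)[OF that] \<gamma>\<beta>[OF that] by (simp add: w_def)
    then show False using that by simp
  qed
  have hN: "h x \<in> ?N" if "x \<in> ?B" for x
  proof -
    have "(\<Sum>i\<le>d. (h x i)\<^sup>2) = (\<Sum>i\<le>d. (x (\<beta> i) - x c)\<^sup>2) / (N x)\<^sup>2"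
      by (simp add: h_def power_divide sum_divide_distrib)
    also have "(\<Sum>i\<le>d. (x (\<beta> i) - x c)\<^sup>2) = (N x)\<^sup>2"
      unfolding N_def by (simp add: sum_nonneg)
    finally show ?thesis using N_pos[OF that] by (simp add: h_def)
  qed
  have kB: "k z \<in> ?B" if "z \<in> ?N" for z
  proof -
    have "sum (k z) T = 1" using D_pos[OF that] by (simp add: k_def D_def flip: sum_divide_distrib)
    then show ?thesis using \<mu>_le \<mu>_in[of z] D_pos[OF that]
      unfolding simplex_boundary_def by (auto simp: k_def)
  qed
  have kh: "k (h x) = x" if "x \<in> ?B" for x
  proof -
    have w: "w (h x) v = x v / N x - x c / N x" if "v \<in> T" for v
      using \<beta>\<gamma>[OF that] by (simp add: w_def h_def diff_divide_distrib)
    obtain u where u: "u \<in> T" "x u = 0" and x0: "\<And>v. 0 \<le> x v"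
      using \<open>x \<in> ?B\<close> unfolding simplex_boundary_def by auto
    \<comment> \<open>The minimum of \<open>x\<close> over \<open>T\<close> is 0, attained at
      \<open>u\<close>, and \<open>w (h x)\<close> is \<open>x\<close> shifted by
      \<open>- x c\<close> and divided by \<open>N x\<close>.\<close>
    have "\<mu> (h x) = - x c / N x"
      unfolding \<mu>_def
    proof (rule Min_eqI)
      show "- x c / N x \<le> y" if "y \<in> w (h x) ` T" for y
        using that x0 N_pos[OF \<open>x \<in> ?B\<close>] by (auto simp: w divide_simps)
      show "- x c / N x \<in> w (h x) ` T" using u by (intro image_eqI[of _ _ u]) (auto simp: w)
    qed (use T in auto)
    then have wm: "w (h x) v - \<mu> (h x) = x v / N x" if "v \<in> T" for v using w[OF that] by simp
    then have "D (h x) = sum x T / N x" unfolding D_def by (simp add: sum_divide_distrib)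
    then have "D (h x) = 1 / N x" using \<open>x \<in> ?B\<close> by (simp add: simplex_boundary_def)
    then show ?thesis using wm N_pos[OF that] \<open>x \<in> ?B\<close>
      by (auto simp: k_def fun_eq_iff simplex_boundary_def)
  qed
  have hk: "h (k z) = z" if "z \<in> ?N" for z
  proof -
    have diff: "k z (\<beta> i) - k z c = z i / D z" if "i \<le> d" for i
      using \<beta>T[OF that] \<gamma>\<beta>[OF that] c by (simp add: k_def w_def diff_divide_distrib)
    have "N (k z) = sqrt ((\<Sum>i\<le>d. (z i)\<^sup>2) / (D z)\<^sup>2)"
      unfolding N_def by (simp add: diff power_divide sum_divide_distrib)
    also have "\<dots> = 1 / D z" using that D_pos[OF that] by (simp add: real_sqrt_divide)
    finally show ?thesis using that D_pos[OF that] by (auto simp: h_def fun_eq_iff diff)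
  qed
  have "continuous_on ?B h"
  proof (rule continuous_on_coordinatewise_then_product)
    fix i
    have "continuous_on ?B N" unfolding N_def
      by (intro continuous_intros continuous_on_coordinate)
    then have "continuous_on ?B (\<lambda>x. (x (\<beta> i) - x c) / N x)"
      using N_pos by (intro continuous_intros continuous_on_coordinate) force+
    then show "continuous_on ?B (\<lambda>x. h x i)" by (cases "i \<le> d") (auto simp: h_def)
  qed
  moreover have "continuous_on ?N k"
  proof (rule continuous_on_coordinatewise_then_product)
    fix v
    have w: "continuous_on ?N (\<lambda>z. w z v)" for v
      unfolding w_def by (cases "v = c") (auto intro: continuous_on_coordinate)
    have \<mu>: "continuous_on ?N \<mu>" unfolding \<mu>_def
      using T c w by (intro continuous_on_Min_image) auto
    have "continuous_on ?N D" unfolding D_def by (intro continuous_intros w \<mu>)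
    then have "continuous_on ?N (\<lambda>z. (w z v - \<mu> z) / D z)"
      using D_pos by (intro continuous_intros w \<mu>) force+
    then show "continuous_on ?N (\<lambda>z. k z v)" by (cases "v \<in> T") (auto simp: k_def)
  qed
  ultimately have hom: "homeomorphic_maps (top_of_set ?B) (nsphere d) h k"
    unfolding homeomorphic_maps_def nsphere_top_of_set
    using hN kB kh hk by (auto simp: Pi_iff)
  have "N (vertex_point a) = 1"
  proof -
    have "(\<Sum>i\<le>d. (vertex_point a (\<beta> i) - vertex_point a c)\<^sup>2) = (\<Sum>i\<le>d. if i = 0 then 1 else 0)"
    proof (rule sum.cong)
      fix i assume "i \<in> {..d}"
      then have "\<beta> i = a \<longleftrightarrow> i = 0" using inj \<beta>0 by (auto simp: inj_on_def)
      then show "(vertex_point a (\<beta> i) - vertex_point a c)\<^sup>2 = (if i = 0 then 1 else 0)"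
        using c by (auto simp: vertex_point_def)
    qed simp
    then show ?thesis by (simp add: N_def)
  qed
  moreover have "\<beta> i = a \<longleftrightarrow> i = 0" if "i \<le> d" for i using inj \<beta>0 that by (auto simp: inj_on_def)
  ultimately have ha: "h (vertex_point a) = nsphere_base"
    using c by (auto simp: h_def vertex_point_def nsphere_base_def fun_eq_iff)
  moreover have "vertex_point a \<in> ?B"
    using a c T by (auto simp: simplex_boundary_def vertex_point_def)
  ultimately have "k nsphere_base = vertex_point a" using kh by metis
  with hom ha that show thesis by blast
qed

section \<open>Complexes covered by a cone and finitely many cells\<close>

text \<open>The faces outside \<open>F\<close> form a cone with apex \<open>a\<close>, and each
  member of \<open>F\<close> is a maximal face attached to this cone along its boundary. Prime
  complexes are the case \<open>a = 2\<close>; the setting is abstract so that it persists when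
  cells are removed.\<close>

locale coned_complex =
  fixes K :: "'v set set" and a :: 'v and F :: "'v set set"
  assumes face_finite: "S \<in> K \<Longrightarrow> finite S" and face_nonempty: "S \<in> K \<Longrightarrow> S \<noteq> {}"
    and subface: "\<lbrakk>S \<in> K; T \<subseteq> S; T \<noteq> {}\<rbrakk> \<Longrightarrow> T \<in> K"
    and apex: "{a} \<in> K"
    and finite_cells: "finite F" and cells: "F \<subseteq> K"
    and apex_notin_cell: "S \<in> F \<Longrightarrow> a \<notin> S"
    and cell_maximal: "\<lbrakk>S \<in> F; T \<in> K; S \<subseteq> T\<rbrakk> \<Longrightarrow> T = S"
    and cone: "\<lbrakk>S \<in> K; S \<notin> F\<rbrakk> \<Longrightarrow> insert a S \<in> K"

text \<open>The factor \<open>card S\<close> makes the value 1 at the barycenter, and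
  \<open>x - radius S x * barycenter S\<close> is then the component of \<open>x\<close> along the
  boundary of the cell. For a maximal face \<open>S\<close> the radius vanishes at every point of
  the realization outside the interior of \<open>S\<close>.\<close>

definition radius :: "'v set \<Rightarrow> ('v \<Rightarrow> real) \<Rightarrow> real" where
  "radius S x = real (card S) * Min ((\<lambda>v. x v) ` S)"

definition barycenter :: "'v set \<Rightarrow> 'v \<Rightarrow> real" where
  "barycenter S = (\<lambda>v. if v \<in> S then 1 / real (card S) else 0)"

text \<open>In the cone over the boundary of a cell glued to the cell, a point at radius \<open>r\<close> (0 on the
  boundary, 1 at the barycenter) is pushed outwards until, at time 1, the cell covers everything and
  its boundary has reached the apex.  The three weights belong to the barycenter, to the component
  along the boundary, and to the apex.\<close>

definition push_b :: "real \<Rightarrow> real \<Rightarrow> real" where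
  "push_b t r = max 0 (1 - (1 + t) * (1 - r))"

text \<open>Write \<open>u = (1 + t) * (1 - r)\<close>. The component along the boundary has mass
  \<open>1 - r\<close> before scaling. While \<open>u \<le> 1\<close> the factor is
  \<open>1 + t\<close>, so its mass becomes \<open>u\<close>, the barycenter gets
  \<open>1 - u\<close>, and the point stays in the cell. From \<open>u = 1\<close> on, the factor is
  linear in \<open>u\<close>: it starts at \<open>1 + t\<close> and reaches \<open>1 - t\<close> at
  \<open>u = 1 + t\<close>, that is at \<open>r = 0\<close>, where the motion must agree with the
  segment to the apex. These two values force the slope -2.\<close>

definition push_s :: "real \<Rightarrow> real \<Rightarrow> real" where
  "push_s t r = min (1 + t) (3 + t - 2 * ((1 + t) * (1 - r)))"

definition push_a :: "real \<Rightarrow> real \<Rightarrow> real" where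
  "push_a t r = 1 - push_s t r * (1 - r) - push_b t r"

lemma push_bounds:
  assumes "0 \<le> t" "t \<le> 1" "0 \<le> r" "r \<le> 1"
  shows "0 \<le> push_b t r" "0 \<le> push_s t r" "0 \<le> push_a t r" "push_b t r = 0 \<or> push_a t r = 0"
proof -
  define u where "u = (1 + t) * (1 - r)"
  have u: "0 \<le> u" "u \<le> 1 + t" using assms by (auto simp: u_def mult_left_le)
  show "0 \<le> push_b t r" by (simp add: push_b_def)
  show "0 \<le> push_s t r" using assms u by (simp add: push_s_def flip: u_def)
  have "0 \<le> push_a t r \<and> (push_b t r = 0 \<or> push_a t r = 0)"
  proof (cases "u \<le> 1")
    case True
    then have "push_s t r = 1 + t" "push_b t r = 1 - u" by (simp_all add: push_s_def push_b_def u_def)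
    then show ?thesis by (simp add: push_a_def u_def)
  next
    case False
    then have s: "push_s t r = 3 + t - 2 * u" and b: "push_b t r = 0"
      by (simp_all add: push_s_def push_b_def u_def)
    \<comment> \<open>The product equals \<open>1 + t - u * push_s t r\<close>, so its sign says
      that the boundary component gets mass at most 1. The second factor is nonnegative because
      \<open>2 * u > 2 \<ge> 1 + t\<close>.\<close>
    have "0 \<le> (u - 1) * (2 * u - (1 + t))" using False assms by (intro mult_nonneg_nonneg) auto
    then have "(1 + t) * (push_s t r * (1 - r)) \<le> 1 + t"
      unfolding s u_def by (simp add: algebra_simps)
    then have "push_s t r * (1 - r) \<le> 1" using assms(1) by (simp add: mult_le_cancel_left1)
    with b show ?thesis by (simp add: push_a_def)
  qed
  then show "0 \<le> push_a t r" "push_b t r = 0 \<or> push_a t r = 0" by auto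
qed

lemma push_radius0:
  assumes "0 \<le> t" "t \<le> 1"
  shows "push_b t 0 = 0" "push_s t 0 = 1 - t" "push_a t 0 = t"
  using assms by (auto simp: push_b_def push_s_def push_a_def)

lemma push_time0:
  assumes "0 \<le> r" "r \<le> 1"
  shows "push_b 0 r = r" "push_s 0 r = 1" "push_a 0 r = 0"
  using assms by (auto simp: push_b_def push_s_def push_a_def)

definition push :: "'v \<Rightarrow> 'v set \<Rightarrow> real \<Rightarrow> ('v \<Rightarrow> real) \<Rightarrow> 'v \<Rightarrow> real" where
  "push a S t x = (\<lambda>v. push_s t (radius S x) * (x v - radius S x * barycenter S v)
     + push_b t (radius S x) * barycenter S v + push_a t (radius S x) * vertex_point a v)"

lemma continuous_on_radius:
  assumes "finite S" "S \<noteq> {}" "continuous_on A f"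
  shows "continuous_on A (\<lambda>z. radius S (f z))"
proof -
  have "continuous_on A (\<lambda>z. f z v)" for v
    by (rule continuous_on_product_then_coordinatewise[OF assms(3)])
  then show ?thesis unfolding radius_def using assms(1,2)
    by (intro continuous_on_mult continuous_on_const continuous_on_Min_image)
qed

lemma continuous_on_push:
  assumes "finite S" "S \<noteq> {}" "continuous_on A f" "continuous_on A g"
  shows "continuous_on A (\<lambda>z. push a S (g z) (f z))"
proof (rule continuous_on_coordinatewise_then_product)
  fix v
  note [continuous_intros] = continuous_on_product_then_coordinatewise[OF assms(3)]
    continuous_on_radius[OF assms(1-3)] assms(4)
  show "continuous_on A (\<lambda>z. push a S (g z) (f z) v)"
    unfolding push_def push_a_def push_b_def push_s_def
    by (intro continuous_intros)
qed

lemma radius_mult_barycenter: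
  assumes "finite S" "v \<in> S" shows "radius S x * barycenter S v = Min (x ` S)"
  using assms by (auto simp: radius_def barycenter_def)

lemma sum_barycenter: "finite S \<Longrightarrow> S \<noteq> {} \<Longrightarrow> sum (barycenter S) S = 1"
  by (simp add: barycenter_def)

lemma radius_nonneg:
  assumes "finite S" "S \<noteq> {}" "\<And>v. 0 \<le> x v" shows "0 \<le> radius S x"
  using assms by (auto simp: radius_def intro!: mult_nonneg_nonneg)

lemma radius_le_sum:
  assumes "finite S" "S \<noteq> {}" shows "radius S x \<le> sum x S"
proof -
  have "radius S x = (\<Sum>v\<in>S. Min (x ` S))" by (simp add: radius_def)
  also have "\<dots> \<le> sum x S" using assms by (intro sum_mono) auto
  finally show ?thesis .
qed

lemma radius_eq_0_iff:
  assumes "finite S" "S \<noteq> {}" "\<And>v. 0 \<le> x v" shows "radius S x = 0 \<longleftrightarrow> (\<exists>v\<in>S. x v = 0)"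
proof -
  have "Min (x ` S) = 0 \<longleftrightarrow> (\<exists>v\<in>S. x v = 0)"
  proof
    assume "Min (x ` S) = 0"
    moreover have "Min (x ` S) \<in> x ` S" using assms by (intro Min_in) auto
    ultimately show "\<exists>v\<in>S. x v = 0" by (auto simp: image_iff)
  next
    assume "\<exists>v\<in>S. x v = 0"
    then obtain v where v: "v \<in> S" "x v = 0" by blast
    then have "0 \<in> x ` S" by (intro image_eqI[of _ _ v]) auto
    then show "Min (x ` S) = 0" using assms by (intro Min_eqI) auto
  qed
  then show ?thesis using assms by (simp add: radius_def)
qed

lemma push_radius_eq_0:
  assumes "radius S x = 0" "0 \<le> t" "t \<le> 1"
  shows "push a S t x = (\<lambda>v. (1 - t) * x v + t * vertex_point a v)"
  using assms by (simp add: push_def push_radius0)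

lemma push_0:
  assumes "0 \<le> radius S x" "radius S x \<le> 1"
  shows "push a S 0 x = x"
  using assms by (simp add: push_def push_time0)

text \<open>One of the weights of barycenter and apex is always 0. Without apex weight the vertex
  \<open>a\<close> is missing from the support; without barycenter weight the vertex of
  \<open>S\<close> with the smallest coordinate is missing. Either way the point stays in the
  boundary of the simplex.\<close>

lemma push_in_simplex_boundary:
  assumes S: "finite S" "S \<noteq> {}" "a \<notin> S" and t: "0 \<le> t" "t \<le> 1"
    and x: "\<And>v. 0 \<le> x v" "\<And>v. v \<notin> S \<Longrightarrow> x v = 0" "sum x S = 1"
  shows "push a S t x \<in> simplex_boundary (insert a S)"
proof -
  let ?r = "radius S x"
  have r: "0 \<le> ?r" "?r \<le> 1" using radius_nonneg[OF S(1,2) x(1)] radius_le_sum[OF S(1,2), of x] x(3) by auto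
  note pb = push_bounds[OF t r]
  have xr: "x v - ?r * barycenter S v \<ge> 0" for v
    using radius_mult_barycenter[OF S(1), of v x] S x by (cases "v \<in> S") (auto simp: barycenter_def)
  have "0 \<le> push a S t x v" for v
    unfolding push_def using pb xr[of v] by (auto simp: barycenter_def vertex_point_def)
  moreover have "push a S t x v = 0" if "v \<notin> insert a S" for v
    using that x by (simp add: push_def barycenter_def vertex_point_def)
  moreover have "\<exists>v\<in>insert a S. push a S t x v = 0"
  proof (cases "push_a t ?r = 0")
    case True
    then have "push a S t x a = 0" using S x by (simp add: push_def barycenter_def)
    then show ?thesis by blast
  next
    case False
    then have b: "push_b t ?r = 0" using pb by auto
    have "Min (x ` S) \<in> x ` S" using S by (intro Min_in) auto
    then obtain v where v: "v \<in> S" "x v = Min (x ` S)" by auto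
    then have "push a S t x v = 0"
      using S b radius_mult_barycenter[OF S(1) v(1), of x] by (auto simp: push_def vertex_point_def)
    then show ?thesis using v by blast
  qed
  moreover have "sum (push a S t x) (insert a S) = 1"
  proof -
    have "sum (push a S t x) (insert a S) = push a S t x a + sum (push a S t x) S" using S by simp
    also have "push a S t x a = push_a t ?r"
      using S x by (simp add: push_def barycenter_def vertex_point_def)
    also have "sum (push a S t x) S
        = (\<Sum>v\<in>S. push_s t ?r * (x v - ?r * barycenter S v) + push_b t ?r * barycenter S v)"
      using S by (intro sum.cong) (auto simp: push_def vertex_point_def)
    also have "\<dots> = push_s t ?r * (sum x S - ?r * sum (barycenter S) S) + push_b t ?r * sum (barycenter S) S"
      by (simp add: sum.distrib sum_subtractf flip: sum_distrib_left)
    finally show ?thesis using sum_barycenter[OF S(1,2)] x(3) by (simp add: push_a_def)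
  qed
  ultimately show ?thesis unfolding simplex_boundary_def by blast
qed

text \<open>A point of radius 0 lies in the cone over the boundary of \<open>S\<close> and moves
  straight to \<open>a\<close>, keeping the vertex of \<open>S\<close> that it misses. A point of
  nonzero radius must miss \<open>a\<close> and lies in the interior of the cell.\<close>

lemma push_simplex_boundary:
  assumes S: "finite S" "S \<noteq> {}" "a \<notin> S" and t: "0 \<le> t" "t \<le> 1"
    and x: "x \<in> simplex_boundary (insert a S)"
  shows "push a S t x \<in> simplex_boundary (insert a S)"
proof (cases "radius S x = 0")
  case True
  have x': "\<And>v. 0 \<le> x v" "\<And>v. v \<notin> insert a S \<Longrightarrow> x v = 0" "x a + sum x S = 1"
    using x S by (auto simp: simplex_boundary_def)
  obtain v where v: "v \<in> S" "x v = 0" using True radius_eq_0_iff[OF S(1,2) x'(1)] by auto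
  have "\<exists>v\<in>insert a S. (1 - t) * x v + t * vertex_point a v = 0"
    using v S by (intro bexI[of _ v]) (auto simp: vertex_point_def)
  moreover have "0 \<le> (1 - t) * x v + t * vertex_point a v" for v
    using x'(1)[of v] t by (auto simp: vertex_point_def)
  moreover have "(1 - t) * x v + t * vertex_point a v = 0" if "v \<notin> insert a S" for v
    using x'(2)[OF that] that by (auto simp: vertex_point_def)
  moreover have "(\<Sum>v\<in>insert a S. (1 - t) * x v + t * vertex_point a v) = 1"
  proof -
    have "(\<Sum>v\<in>S. (1 - t) * x v + t * vertex_point a v) = (\<Sum>v\<in>S. (1 - t) * x v)"
      using S by (intro sum.cong) (auto simp: vertex_point_def)
    also have "\<dots> = (1 - t) * (1 - x a)" using x'(3) by (simp flip: sum_distrib_left)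
    finally show ?thesis using S by (simp add: vertex_point_def algebra_simps)
  qed
  ultimately show ?thesis
    unfolding push_radius_eq_0[OF True t] simplex_boundary_def by blast
next
  case False
  have x': "\<And>v. 0 \<le> x v" "\<And>v. v \<notin> insert a S \<Longrightarrow> x v = 0" "x a + sum x S = 1" "\<exists>v\<in>insert a S. x v = 0"
    using x S by (auto simp: simplex_boundary_def)
  then have xa: "x a = 0" using False radius_eq_0_iff[OF S(1,2) x'(1)] by auto
  then have "x v = 0" if "v \<notin> S" for v using x'(2)[of v] that by (cases "v = a") auto
  then show ?thesis using x' xa by (intro push_in_simplex_boundary S t) auto
qed

lemma geom_realizationI:
  assumes "finite T" "\<And>v. 0 \<le> x v" "\<And>v. v \<notin> T \<Longrightarrow> x v = 0" "sum x T = 1" "{v. x v \<noteq> 0} \<in> K"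
  shows "x \<in> geom_realization K"
proof -
  have "(\<Sum>v | x v \<noteq> 0. x v) = sum x T"
    using assms by (intro sum.mono_neutral_left) auto
  then show ?thesis using assms by (simp add: geom_realization_def)
qed

lemma geom_realizationD:
  assumes "x \<in> geom_realization K"
  shows "0 \<le> x v" "{v. x v \<noteq> 0} \<in> K" "(\<Sum>v | x v \<noteq> 0. x v) = 1"
  using assms by (auto simp: geom_realization_def)

section \<open>The flow on the whole complex and the bouquet\<close>

context coned_complex
begin

abbreviation "R \<equiv> geom_realization K"

lemma cell_finite: "S \<in> F \<Longrightarrow> finite S" "S \<in> F \<Longrightarrow> S \<noteq> {}"
  using cells face_finite face_nonempty by auto

lemma apex_in: "vertex_point a \<in> R"
  by (rule geom_realizationI[of "{a}"]) (use apex in \<open>auto simp: vertex_point_def\<close>)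

text \<open>By maximality a proper subface of a cell is not itself a cell, so it can be coned; the
  empty subface contributes the apex.\<close>

lemma proper_subface_cone:
  assumes "S \<in> F" "T \<subset> S" shows "insert a T \<in> K"
proof (cases "T = {}")
  case False
  then have "T \<in> K" using assms cells subface[of S T] by auto
  moreover have "T \<notin> F" using cell_maximal[of T S] assms cells by auto
  ultimately show ?thesis using cone by blast
qed (use apex in simp)

text \<open>A point of this boundary misses a vertex of \<open>insert a S\<close>. If it misses
  \<open>a\<close>, its support lies in the face \<open>S\<close>; otherwise the rest of its support
  is a proper subface of \<open>S\<close>, which can be coned.\<close>

lemma simplex_boundary_subset:
  assumes S: "S \<in> F" shows "simplex_boundary (insert a S) \<subseteq> R"
proof
  fix x assume x: "x \<in> simplex_boundary (insert a S)"
  let ?T = "{v. x v \<noteq> 0}"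
  have T: "?T \<subseteq> insert a S" "?T \<noteq> insert a S" using x by (auto simp: simplex_boundary_def)
  have ne: "?T \<noteq> {}"
  proof
    assume "?T = {}"
    then have "sum x (insert a S) = 0" by (intro sum.neutral) auto
    then show False using x by (simp add: simplex_boundary_def)
  qed
  have "?T \<in> K"
  proof (cases "a \<in> ?T")
    case False
    then show ?thesis using T ne subface[of S ?T] S cells by auto
  next
    case True
    then have "?T - {a} \<subset> S" using T by auto
    from proper_subface_cone[OF S this] show ?thesis using True by (simp add: insert_absorb)
  qed
  then show "x \<in> R"
    using x cell_finite[OF S] by (intro geom_realizationI[of "insert a S"]) (auto simp: simplex_boundary_def)
qed

text \<open>A nonzero radius means that all vertices of \<open>S\<close> are in the support, and
  \<open>S\<close> is maximal. Consequently at most one cell has nonzero radius at a given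
  point.\<close>

lemma support_eq_cell:
  assumes "x \<in> R" "S \<in> F" "radius S x \<noteq> 0" shows "{v. x v \<noteq> 0} = S"
proof -
  have "S \<subseteq> {v. x v \<noteq> 0}"
    using assms radius_eq_0_iff[of S x] cell_finite[OF assms(2)] geom_realizationD(1)[OF assms(1)] by auto
  then show ?thesis using cell_maximal[OF assms(2)] geom_realizationD(2)[OF assms(1)] by blast
qed

lemma radius_bounds:
  assumes "x \<in> R" "S \<in> F" shows "0 \<le> radius S x" "radius S x \<le> 1"
proof -
  show "0 \<le> radius S x"
    using cell_finite[OF assms(2)] geom_realizationD(1)[OF assms(1)] by (intro radius_nonneg) auto
  show "radius S x \<le> 1"
  proof (cases "radius S x = 0")
    case False
    then show ?thesis
      using support_eq_cell[OF assms] radius_le_sum[OF cell_finite[OF assms(2)], of x] geom_realizationD(3)[OF assms(1)]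
      by simp
  qed simp
qed

lemma push_cell:
  assumes x: "x \<in> R" "{v. x v \<noteq> 0} = S" and S: "S \<in> F" and t: "0 \<le> t" "t \<le> 1"
  shows "push a S t x \<in> simplex_boundary (insert a S)"
proof (rule push_in_simplex_boundary)
  show "sum x S = 1" using geom_realizationD(3)[OF x(1)] x(2) by simp
qed (use x t cell_finite[OF S] apex_notin_cell[OF S] geom_realizationD(1)[OF x(1)] in auto)

lemma segment_to_apex:
  assumes x: "x \<in> R" "insert a {v. x v \<noteq> 0} \<in> K" and t: "0 \<le> t" "t \<le> 1"
  shows "(\<lambda>v. (1 - t) * x v + t * vertex_point a v) \<in> R" (is "?y \<in> R")
proof (rule geom_realizationI)
  let ?T = "insert a {v. x v \<noteq> 0}"
  show fin: "finite ?T" by (rule face_finite[OF x(2)])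
  have "sum x ?T = (\<Sum>v | x v \<noteq> 0. x v)" using fin by (intro sum.mono_neutral_right) auto
  then have "sum x ?T = 1" using geom_realizationD(3)[OF x(1)] by simp
  moreover have "sum (vertex_point a) ?T = 1" using fin by (simp add: vertex_point_def)
  ultimately show *: "sum ?y ?T = 1" by (simp add: sum.distrib flip: sum_distrib_left)
  show "?y v = 0" if "v \<notin> ?T" for v using that by (auto simp: vertex_point_def)
  show "0 \<le> ?y v" for v using geom_realizationD(1)[OF x(1), of v] t by (auto simp: vertex_point_def)
  have "{v. ?y v \<noteq> 0} \<subseteq> ?T" by (auto simp: vertex_point_def)
  moreover have "{v. ?y v \<noteq> 0} \<noteq> {}"
  proof
    assume "{v. ?y v \<noteq> 0} = {}"
    then have "sum ?y ?T = 0" by (intro sum.neutral) auto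
    with * show False by simp
  qed
  ultimately show "{v. ?y v \<noteq> 0} \<in> K" using subface[OF x(2)] by blast
qed

text \<open>The straight motion to the apex, corrected by the difference between it and
  \<open>push\<close> for each cell. At most one correction is nonzero at a point of the
  realization, and writing them as one finite sum makes continuity immediate where a definition by
  cases on the support would not.\<close>

definition flow :: "real \<Rightarrow> ('v \<Rightarrow> real) \<Rightarrow> 'v \<Rightarrow> real" where
  "flow t x = (\<lambda>v. (1 - t) * x v + t * vertex_point a v
     + (\<Sum>S\<in>F. push a S t x v - ((1 - t) * x v + t * vertex_point a v)))"

lemma flow_cell:
  assumes x: "x \<in> R" "{v. x v \<noteq> 0} = S" and S: "S \<in> F" and t: "0 \<le> t" "t \<le> 1"
  shows "flow t x = push a S t x"
proof
  fix v
  have "push a S' t x v - ((1 - t) * x v + t * vertex_point a v) = 0" if "S' \<in> F - {S}" for S'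
  proof -
    have "radius S' x = 0" using support_eq_cell[OF x(1), of S'] x(2) that by blast
    then show ?thesis by (simp add: push_radius_eq_0 t)
  qed
  then have "(\<Sum>S\<in>F. push a S t x v - ((1 - t) * x v + t * vertex_point a v))
      = push a S t x v - ((1 - t) * x v + t * vertex_point a v)"
    using finite_cells S by (subst sum.remove[of _ S]) auto
  then show "flow t x v = push a S t x v" by (simp add: flow_def)
qed

lemma flow_noncell:
  assumes x: "x \<in> R" "{v. x v \<noteq> 0} \<notin> F" and t: "0 \<le> t" "t \<le> 1"
  shows "flow t x = (\<lambda>v. (1 - t) * x v + t * vertex_point a v)"
proof
  fix v
  have "push a S t x v - ((1 - t) * x v + t * vertex_point a v) = 0" if "S \<in> F" for S
  proof -
    have "radius S x = 0" using support_eq_cell[OF x(1) that] x(2) that by blast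
    then show ?thesis by (simp add: push_radius_eq_0 t)
  qed
  then show "flow t x v = (1 - t) * x v + t * vertex_point a v" by (simp add: flow_def)
qed

lemma flow_in:
  assumes x: "x \<in> R" and t: "0 \<le> t" "t \<le> 1" shows "flow t x \<in> R"
proof (cases "{v. x v \<noteq> 0} \<in> F")
  case True
  then show ?thesis
    using flow_cell[OF x _ True t] push_cell[OF x _ True t] simplex_boundary_subset[OF True] by auto
next
  case False
  then show ?thesis
    using flow_noncell[OF x False t] segment_to_apex[OF x _ t] cone[OF geom_realizationD(2)[OF x] False] by simp
qed

lemma flow_0: "x \<in> R \<Longrightarrow> flow 0 x = x"
  using radius_bounds by (simp add: flow_def push_0)

lemma continuous_on_flow: "continuous_on A (\<lambda>z. flow (fst z) (snd z))"
proof (rule continuous_on_coordinatewise_then_product)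
  fix v
  have "continuous_on A (\<lambda>z. push a S (fst z) (snd z) v)" if "S \<in> F" for S
    by (rule continuous_on_product_then_coordinatewise[OF continuous_on_push[OF cell_finite[OF that]]])
       (intro continuous_on_fst continuous_on_snd continuous_on_id)+
  moreover have "continuous_on A (\<lambda>z. snd z v)"
    by (rule continuous_on_product_then_coordinatewise[OF continuous_on_snd[OF continuous_on_id]])
  ultimately show "continuous_on A (\<lambda>z. flow (fst z) (snd z) v)"
    unfolding flow_def by (intro continuous_intros) auto
qed

text \<open>Up to the homeomorphism with the standard sphere, \<open>g\<close> is the inclusion of
  the boundary of the simplex on \<open>insert a S\<close>, and \<open>p\<close> is
  \<open>push\<close> at time 1, which spreads the cell over this sphere and sends everything else
  to the apex. Since \<open>push\<close> preserves the sphere and fixes the apex, its earlier times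
  give the pointed homotopy.\<close>

lemma cell_sphere:
  assumes S: "S \<in> F" and card: "card S = d + 1"
  obtains p g where
    "continuous_map (top_of_set R) (nsphere d) p" "continuous_map (nsphere d) (top_of_set R) g"
    "g nsphere_base = vertex_point a"
    "\<And>z. z \<in> topspace (nsphere d) \<Longrightarrow> g z \<in> simplex_boundary (insert a S)"
    "\<And>x. x \<in> R \<Longrightarrow> p x \<noteq> nsphere_base \<Longrightarrow> {v. x v \<noteq> 0} = S"
    "\<And>x. x \<in> R \<Longrightarrow> g (p x) = (if {v. x v \<noteq> 0} = S then flow 1 x else vertex_point a)"
    "homotopic_with (\<lambda>f. f nsphere_base = nsphere_base) (nsphere d) (nsphere d) (p \<circ> g) id"
proof -
  let ?B = "simplex_boundary (insert a S)"
  note fS = cell_finite[OF S] and aS = apex_notin_cell[OF S]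
  have BR: "?B \<subseteq> R" by (rule simplex_boundary_subset[OF S])
  obtain h k where hom: "homeomorphic_maps (top_of_set ?B) (nsphere d) h k"
    and h: "h (vertex_point a) = nsphere_base" and k: "k nsphere_base = vertex_point a"
    by (rule simplex_boundary_homeomorphic_nsphere[of "insert a S" d a]) (use fS aS card in auto)
  have ch: "continuous_map (top_of_set ?B) (nsphere d) h" and ck: "continuous_map (nsphere d) (top_of_set ?B) k"
    and kh: "\<And>x. x \<in> ?B \<Longrightarrow> k (h x) = x" and hk: "\<And>z. z \<in> topspace (nsphere d) \<Longrightarrow> h (k z) = z"
    using hom by (auto simp: homeomorphic_maps_def)
  have kB: "k z \<in> ?B" if "z \<in> topspace (nsphere d)" for z
    using ck that by (auto simp: continuous_map_def)
  \<comment> \<open>Off the interior of \<open>S\<close> the radius is 0, and the straight segment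
    has arrived at the apex at time 1.\<close>
  have r: "push a S 1 x = (if {v. x v \<noteq> 0} = S then flow 1 x else vertex_point a)" if "x \<in> R" for x
    using flow_cell[OF that _ S, of 1] push_radius_eq_0[of S x 1] support_eq_cell[OF that S]
    by (cases "{v. x v \<noteq> 0} = S") auto
  have aB: "vertex_point a \<in> ?B"
    using fS aS by (auto simp: simplex_boundary_def vertex_point_def)
  have rB: "push a S 1 x \<in> ?B" if "x \<in> R" for x
  proof (cases "{v. x v \<noteq> 0} = S")
    case True
    then show ?thesis by (intro push_cell that S) auto
  next
    case False
    then show ?thesis using r[OF that] aB by simp
  qed
  have cr: "continuous_map (top_of_set R) (top_of_set ?B) (push a S 1)"
    using rB continuous_on_push[OF fS continuous_on_id continuous_on_const, of R a 1] by auto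
  define p where "p = h \<circ> push a S 1"
  show thesis
  proof (rule that[of p k])
    show "continuous_map (top_of_set R) (nsphere d) p"
      unfolding p_def by (rule continuous_map_compose[OF cr ch])
    show "continuous_map (nsphere d) (top_of_set R) k"
      using ck BR by (simp add: continuous_map_in_subtopology subset_iff image_subset_iff Pi_iff)
    show "{v. x v \<noteq> 0} = S" if "x \<in> R" "p x \<noteq> nsphere_base" for x
      using that r[OF that(1)] h by (auto simp: p_def split: if_splits)
    show "k (p x) = (if {v. x v \<noteq> 0} = S then flow 1 x else vertex_point a)" if "x \<in> R" for x
      using r[OF that] rB[OF that] kh by (simp add: p_def)
    \<comment> \<open>Time is reversed since the homotopy has to lead from
      \<open>p \<circ> k\<close> to the identity.\<close>
    have "continuous_map (prod_topology (top_of_set {0..1::real}) (nsphere d)) (nsphere d)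
        (\<lambda>(t, z). h (push a S (1 - t) (k z)))"
    proof -
      have 1: "continuous_map (prod_topology (top_of_set {0..1::real}) (nsphere d))
         (prod_topology (top_of_set {0..1::real}) (top_of_set ?B)) (\<lambda>(t, z). (t, k z))"
        unfolding case_prod_unfold
        by (intro continuous_map_pairedI continuous_map_fst
           continuous_map_compose[OF continuous_map_snd ck, unfolded o_def])
      have "push a S (1 - t) x \<in> ?B" if "t \<in> {0..1}" "x \<in> ?B" for t x
        using push_simplex_boundary[OF fS aS, of "1 - t" x] that by auto
      then have "continuous_map (top_of_set ({0..1::real} \<times> ?B)) (top_of_set ?B) (\<lambda>z. push a S (1 - fst z) (snd z))"
        by (auto intro!: continuous_on_push[OF fS] continuous_on_diff continuous_on_const continuous_on_fst continuous_on_snd continuous_on_id)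
      then have 2: "continuous_map (prod_topology (top_of_set {0..1::real}) (top_of_set ?B)) (top_of_set ?B) (\<lambda>z. push a S (1 - fst z) (snd z))"
        by (simp add: subtopology_Times)
      show ?thesis
        using continuous_map_compose[OF continuous_map_compose[OF 1 2] ch]
        by (simp add: o_def case_prod_unfold)
    qed
    moreover have "h (push a S 0 (k z)) = z" if "z \<in> topspace (nsphere d)" for z
      using push_0[OF radius_bounds[OF subsetD[OF BR kB[OF that]] S], of a] hk[OF that] by simp
    moreover have "h (push a S (1 - t) (k nsphere_base)) = nsphere_base" if "t \<in> {0..1}" for t
    proof -
      have "radius S (vertex_point a) = 0"
        using radius_eq_0_iff[OF fS, of "vertex_point a"] aS fS by (auto simp: vertex_point_def)
      moreover have "0 \<le> 1 - t" "1 - t \<le> 1" using that by auto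
      ultimately have "push a S (1 - t) (vertex_point a)
          = (\<lambda>v. (1 - (1 - t)) * vertex_point a v + (1 - t) * vertex_point a v)"
        by (rule push_radius_eq_0)
      also have "\<dots> = vertex_point a" by (simp flip: distrib_right)
      finally have "push a S (1 - t) (vertex_point a) = vertex_point a" .
      then show ?thesis by (simp only: k h)
    qed
    moreover have "nsphere_base \<in> topspace (nsphere d)"
      unfolding nsphere_base_def by (rule in_topspace_nsphere)
    ultimately have "\<exists>H. continuous_map (prod_topology (top_of_set {0..1::real}) (nsphere d)) (nsphere d) H \<and>
        (\<forall>x\<in>topspace (nsphere d). H (0, x) = (p \<circ> k) x) \<and> (\<forall>x\<in>topspace (nsphere d). H (1, x) = id x) \<and>
        (\<forall>t\<in>{0..1}. H (t, nsphere_base) = nsphere_base)"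
      by (intro exI[of _ "\<lambda>(t, z). h (push a S (1 - t) (k z))"]) (simp add: p_def)
    then show "homotopic_with (\<lambda>f. f nsphere_base = nsphere_base) (nsphere d) (nsphere d) (p \<circ> k) id"
      using \<open>nsphere_base \<in> topspace (nsphere d)\<close> by (subst homotopic_with) auto
  qed (use k kB in auto)
qed

text \<open>The map \<open>flow 1\<close> factors through the wedge: on the interior of a cell it is
  the composite of the collapse and the inclusion of its sphere, elsewhere it is constantly the
  apex. The flow itself joins it to the identity.\<close>

theorem homotopy_equivalent_bouquet:
  "top_of_set R homotopy_equivalent_space bouquet_of_spheres fst {(j, S). S \<in> F \<and> card S = j + 1}"
proof -
  let ?I = "{(j, S). S \<in> F \<and> card S = j + 1}"
  let ?P = "\<lambda>i p g.
    continuous_map (top_of_set R) (nsphere (fst i)) p \<and> continuous_map (nsphere (fst i)) (top_of_set R) g \<and>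
    g nsphere_base = vertex_point a \<and>
    (\<forall>z. z \<in> topspace (nsphere (fst i)) \<longrightarrow> g z \<in> simplex_boundary (insert a (snd i))) \<and>
    (\<forall>x. x \<in> R \<longrightarrow> p x \<noteq> nsphere_base \<longrightarrow> {v. x v \<noteq> 0} = snd i) \<and>
    (\<forall>x. x \<in> R \<longrightarrow> g (p x) = (if {v. x v \<noteq> 0} = snd i then flow 1 x else vertex_point a)) \<and>
    homotopic_with (\<lambda>f. f nsphere_base = nsphere_base) (nsphere (fst i)) (nsphere (fst i)) (p \<circ> g) id"
  have "\<exists>p g. ?P i p g" if "i \<in> ?I" for i
    by (rule cell_sphere[of "snd i" "fst i"]) (use that in force)+
  then have "\<forall>i\<in>?I. \<exists>pg. ?P i (fst pg) (snd pg)" by simp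
  then obtain pg where pg: "\<forall>i\<in>?I. ?P i (fst (pg i)) (snd (pg i))" by (rule bchoice[THEN exE])
  define p where "p = (\<lambda>i. fst (pg i))"
  define g where "g = (\<lambda>i. snd (pg i))"
  have P: "?P i (p i) (g i)" if "i \<in> ?I" for i using pg that unfolding p_def g_def by blast
  have uniq: "i = i'" if "i \<in> ?I" "i' \<in> ?I" "snd i = snd i'" for i i' using that by auto
  show ?thesis
    unfolding bouquet_of_spheres_def nsphere_base_def[symmetric]
  proof (rule homotopy_equivalent_wedge[where p = p and g = g and ?y0.0 = "vertex_point a" and r = "flow 1"])
    have "?I \<subseteq> (\<lambda>S. (card S - 1, S)) ` F" by force
    then show "finite ?I" using finite_cells finite_surj by blast
    show "homotopic_with (\<lambda>_. True) (top_of_set R) (top_of_set R) (flow 1) id"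
    proof -
      have "continuous_map (prod_topology (top_of_set {0..1}) (top_of_set R)) (top_of_set R) (\<lambda>z. flow (fst z) (snd z))"
        using flow_in by (auto simp: subtopology_Times[symmetric] intro!: continuous_on_flow)
      then have "homotopic_with (\<lambda>_. True) (top_of_set R) (top_of_set R) id (flow 1)"
        by (subst homotopic_with, simp, intro exI[of _ "\<lambda>z. flow (fst z) (snd z)"]) (auto simp: flow_0)
      then show ?thesis by (rule homotopic_with_symD)
    qed
  next
    fix i k x
    assume ik: "i \<in> ?I" "k \<in> ?I" "i \<noteq> k" "x \<in> topspace (nsphere (fst i))"
    show "p k (g i x) = nsphere_base"
    proof (rule ccontr)
      have gB: "g i x \<in> simplex_boundary (insert a (snd i))" using P[OF ik(1)] ik(4) by blast
      moreover have "snd i \<in> F" "snd k \<in> F" using ik by auto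
      ultimately have "g i x \<in> R" using simplex_boundary_subset by blast
      moreover assume "p k (g i x) \<noteq> nsphere_base"
      ultimately have "{v. g i x v \<noteq> 0} = snd k" using P[OF ik(2)] by blast
      \<comment> \<open>A point that \<open>p k\<close> sends off the base point has support
        \<open>snd k\<close>. On the sphere of \<open>i\<close> this support lies in
        \<open>insert a (snd i)\<close>, and maximality makes the two cells equal.\<close>
      then have "snd k \<subseteq> insert a (snd i)" using gB by (auto simp: simplex_boundary_def)
      then have "snd k \<subseteq> snd i" using apex_notin_cell[OF \<open>snd k \<in> F\<close>] by auto
      then have "snd i = snd k" using cell_maximal[OF \<open>snd k \<in> F\<close>] \<open>snd i \<in> F\<close> cells by blast
      then show False using uniq ik by blast
    qed
  next
    fix y assume y: "y \<in> topspace (top_of_set R)" "\<And>i. i \<in> ?I \<Longrightarrow> p i y = nsphere_base"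
    show "flow 1 y = vertex_point a"
    proof (cases "{v. y v \<noteq> 0} \<in> F")
      case True
      let ?S = "{v. y v \<noteq> 0}"
      \<comment> \<open>Nonemptiness ensures that the truncated difference
        \<open>card ?S - 1\<close> is the dimension of the cell.\<close>
      have "card ?S \<noteq> 0" using cell_finite[OF True] by simp
      then have i: "(card ?S - 1, ?S) \<in> ?I" (is "?i \<in> _") using True by simp
      have "g ?i (p ?i y) = (if {v. y v \<noteq> 0} = snd ?i then flow 1 y else vertex_point a)"
        using P[OF i] y(1) by (metis topspace_euclidean_subtopology)
      moreover have "g ?i nsphere_base = vertex_point a" using P[OF i] by blast
      ultimately show ?thesis using y(2)[OF i] by simp
    next
      case False
      then show ?thesis using flow_noncell[of y 1] y(1) by simp
    qed
  next
    show "vertex_point a \<in> topspace (top_of_set R)" using apex_in by simp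
  next
    fix i :: "nat \<times> 'v set"
    show "nsphere_base \<in> topspace (nsphere (fst i))" unfolding nsphere_base_def by (rule in_topspace_nsphere)
  next
    fix i y assume i: "i \<in> ?I" "y \<in> topspace (top_of_set R)" "p i y \<noteq> nsphere_base"
    then have "y \<in> R" by simp
    with P[OF i(1)] i(3) have "{v. y v \<noteq> 0} = snd i"
      and "g i (p i y) = (if {v. y v \<noteq> 0} = snd i then flow 1 y else vertex_point a)" by blast+
    then show "flow 1 y = g i (p i y)" by simp
  next
    fix y i k assume *: "y \<in> topspace (top_of_set R)" "i \<in> ?I" "k \<in> ?I" "p i y \<noteq> nsphere_base" "p k y \<noteq> nsphere_base"
    have "y \<in> R" using * by simp
    then have "{v. y v \<noteq> 0} = snd i" "{v. y v \<noteq> 0} = snd k"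
      using P[OF *(2)] P[OF *(3)] *(4,5) by blast+
    then show "i = k" using uniq * by simp
  qed (use P in blast)+
qed

end

section \<open>Simple connectedness of unions\<close>

lemma homotopic_paths_cancel_middle:
  fixes S :: "'a::real_normed_vector set"
  assumes "path p" "path q" "path r" "path_image p \<subseteq> S" "path_image q \<subseteq> S" "path_image r \<subseteq> S"
    and "pathfinish p = pathstart q" "pathstart r = pathstart q"
  shows "homotopic_paths S ((p +++ q) +++ (reversepath q +++ r)) (p +++ r)"
proof -
  have "homotopic_paths S ((p +++ q) +++ (reversepath q +++ r)) (p +++ (q +++ (reversepath q +++ r)))"
    by (rule homotopic_paths_sym[OF homotopic_paths_assoc])
       (use assms in \<open>auto simp: path_image_join\<close>)
  also have "homotopic_paths S (p +++ (q +++ (reversepath q +++ r))) (p +++ r)"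
  proof (rule homotopic_paths_join)
    have "homotopic_paths S (q +++ (reversepath q +++ r)) ((q +++ reversepath q) +++ r)"
      by (rule homotopic_paths_assoc) (use assms in auto)
    also have "homotopic_paths S ((q +++ reversepath q) +++ r) (linepath (pathstart q) (pathstart q) +++ r)"
      by (rule homotopic_paths_join[OF homotopic_paths_rinv]) (use assms in auto)
    also have "homotopic_paths S (linepath (pathstart q) (pathstart q) +++ r) r"
      by (rule homotopic_paths_lid') (use assms in auto)
    finally show "homotopic_paths S (q +++ (reversepath q +++ r)) r" .
  qed (use assms in auto)
  finally show ?thesis .
qed

text \<open>Every path is homotopic to the path through the base point along the chosen connecting
  paths: this is true locally, and it is additive under the subdivision of the path.\<close>

lemma simply_connected_Un:
  fixes U V :: "'a::real_normed_vector set"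
  assumes U: "openin (top_of_set (U \<union> V)) U" "simply_connected U"
    and V: "openin (top_of_set (U \<union> V)) V" "simply_connected V"
    and UV: "path_connected (U \<inter> V)" "U \<inter> V \<noteq> {}"
  shows "simply_connected (U \<union> V)"
proof -
  let ?X = "U \<union> V"
  have pU: "path_connected U" and pV: "path_connected V"
    using U V simply_connected_imp_path_connected by auto
  obtain b where b: "b \<in> U" "b \<in> V" using UV(2) by blast
  \<comment> \<open>The connecting path of a point in both sets is taken inside the intersection;
    this is where path connectedness of \<open>U \<inter> V\<close> enters.\<close>
  have "\<exists>c. path c \<and> pathstart c = b \<and> pathfinish c = x \<and> path_image c \<subseteq> ?X \<and>
      (x \<in> U \<longrightarrow> path_image c \<subseteq> U) \<and> (x \<in> V \<longrightarrow> path_image c \<subseteq> V)" if x: "x \<in> ?X" for x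
  proof -
    consider "x \<in> U \<inter> V" | "x \<in> U" "x \<notin> V" | "x \<in> V" "x \<notin> U" using x by blast
    then show ?thesis
    proof cases
      case 1
      then show ?thesis using UV(1) b unfolding path_connected_def by (metis IntI le_inf_iff sup.coboundedI1)
    next
      case 2
      then show ?thesis using pU b unfolding path_connected_def by (metis sup.coboundedI1)
    next
      case 3
      then show ?thesis using pV b unfolding path_connected_def by (metis sup.coboundedI2)
    qed
  qed
  then obtain c where c: "\<And>x. x \<in> ?X \<Longrightarrow> path (c x) \<and> pathstart (c x) = b \<and> pathfinish (c x) = x \<and>
      path_image (c x) \<subseteq> ?X \<and> (x \<in> U \<longrightarrow> path_image (c x) \<subseteq> U) \<and> (x \<in> V \<longrightarrow> path_image (c x) \<subseteq> V)"
    by metis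
  have key: "homotopic_paths ?X p (reversepath (c (pathstart p)) +++ c (pathfinish p))"
    if p: "path p" "path_image p \<subseteq> ?X" for p
  proof -
    have pX: "p s \<in> ?X" if "s \<in> {0..1}" for s using p(2) that unfolding path_image_def by blast
    have sub: "path (subpath s t p)" "path_image (subpath s t p) \<subseteq> ?X" if "s \<in> {0..1}" "t \<in> {0..1}" for s t
      using p that path_image_subpath_subset[OF that, of p] by auto
    have "0 \<in> {0..1::real} \<longrightarrow> 1 \<in> {0..1::real} \<longrightarrow>
        homotopic_paths ?X (subpath 0 1 p) (reversepath (c (p 0)) +++ c (p 1))"
    \<comment> \<open>\<open>Bolzano\<close> plays the part of a Lebesgue number: the relation
      passes from two adjacent intervals to their union and holds for all short intervals around
      each point.\<close>
    proof (rule Bolzano[of 0 1 "\<lambda>s t. s \<in> {0..1} \<longrightarrow> t \<in> {0..1} \<longrightarrow>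
        homotopic_paths ?X (subpath s t p) (reversepath (c (p s)) +++ c (p t))"])
      fix s t u :: real
      assume st: "s \<in> {0..1} \<longrightarrow> t \<in> {0..1} \<longrightarrow> homotopic_paths ?X (subpath s t p) (reversepath (c (p s)) +++ c (p t))"
        and tu: "t \<in> {0..1} \<longrightarrow> u \<in> {0..1} \<longrightarrow> homotopic_paths ?X (subpath t u p) (reversepath (c (p t)) +++ c (p u))"
        and le: "s \<le> t" "t \<le> u"
      show "s \<in> {0..1} \<longrightarrow> u \<in> {0..1} \<longrightarrow> homotopic_paths ?X (subpath s u p) (reversepath (c (p s)) +++ c (p u))"
      proof (intro impI)
        assume s: "s \<in> {0..1}" and u: "u \<in> {0..1}"
        then have t: "t \<in> {0..1}" using le by auto
        note cs = c[OF pX[OF s]] and ct = c[OF pX[OF t]] and cu = c[OF pX[OF u]]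
        have "homotopic_paths ?X (subpath s u p) (subpath s t p +++ subpath t u p)"
          by (rule homotopic_paths_sym[OF homotopic_join_subpaths1]) (use p s t u le in auto)
        also have "homotopic_paths ?X (subpath s t p +++ subpath t u p)
            ((reversepath (c (p s)) +++ c (p t)) +++ (reversepath (c (p t)) +++ c (p u)))"
          using st tu s t u by (intro homotopic_paths_join) auto
        also have "homotopic_paths ?X ((reversepath (c (p s)) +++ c (p t)) +++ (reversepath (c (p t)) +++ c (p u)))
            (reversepath (c (p s)) +++ c (p u))"
          by (rule homotopic_paths_cancel_middle) (use cs ct cu in auto)
        finally show "homotopic_paths ?X (subpath s u p) (reversepath (c (p s)) +++ c (p u))" .
      qed
    next
      fix x :: real assume x: "0 \<le> x" "x \<le> 1"
      \<comment> \<open>A short piece of \<open>p\<close> and its replacement through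
        \<open>b\<close> have the same ends and both lie in one \<open>W\<close>, which is
        \<open>U\<close> or \<open>V\<close>, so they are homotopic in \<open>W\<close>.\<close>
      have main: "\<exists>d>0. \<forall>s t. s \<le> x \<and> x \<le> t \<and> t - s < d \<longrightarrow> s \<in> {0..1} \<longrightarrow> t \<in> {0..1} \<longrightarrow>
          homotopic_paths ?X (subpath s t p) (reversepath (c (p s)) +++ c (p t))"
        if W: "openin (top_of_set ?X) W" "simply_connected W" "p x \<in> W"
          and cW: "\<And>y. y \<in> W \<Longrightarrow> path_image (c y) \<subseteq> W" for W
      proof -
        have hW: "homotopic_paths W p q" if "path p" "path_image p \<subseteq> W" "path q" "path_image q \<subseteq> W"
            "pathstart q = pathstart p" "pathfinish q = pathfinish p" for p q
          using W(2) that unfolding simply_connected_eq_homotopic_paths by blast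
        have WX: "W \<subseteq> ?X" using W(1) openin_imp_subset by blast
        have "continuous_on {0..1} p" using p by (simp add: path_def)
        then have "openin (top_of_set {0..1}) ({0..1} \<inter> p -` W)"
          using pX W(1) by (intro continuous_openin_preimage[of _ _ ?X]) auto
        moreover have "x \<in> {0..1} \<inter> p -` W" using x W(3) by simp
        ultimately have "\<exists>d>0. \<forall>y\<in>{0..1}. dist y x < d \<longrightarrow> y \<in> {0..1} \<inter> p -` W"
          unfolding openin_euclidean_subtopology_iff by blast
        then obtain d where d: "d > 0" "\<And>y. y \<in> {0..1} \<Longrightarrow> dist y x < d \<Longrightarrow> p y \<in> W"
          by blast
        have "homotopic_paths ?X (subpath s t p) (reversepath (c (p s)) +++ c (p t))"
          if st: "s \<le> x" "x \<le> t" "t - s < d" "s \<in> {0..1}" "t \<in> {0..1}" for s t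
        proof -
          have pW: "p y \<in> W" if "y \<in> {s..t}" for y
            using d(2)[of y] that st by (auto simp: dist_real_def)
          then have 1: "path_image (subpath s t p) \<subseteq> W"
            using st by (auto simp: path_image_subpath)
          have 2: "path_image (reversepath (c (p s)) +++ c (p t)) \<subseteq> W"
            using cW[of "p s"] cW[of "p t"] pW st by (intro subset_path_image_join) auto
          have cst: "path (c (p s))" "pathstart (c (p s)) = b" "pathfinish (c (p s)) = p s"
              "path (c (p t))" "pathstart (c (p t)) = b" "pathfinish (c (p t)) = p t"
            using c[OF pX[OF st(4)]] c[OF pX[OF st(5)]] by blast+
          have "homotopic_paths W (subpath s t p) (reversepath (c (p s)) +++ c (p t))"
            by (rule hW[OF sub(1)[OF st(4,5)] 1 _ 2]) (simp_all add: cst)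
          then show ?thesis using WX by (rule homotopic_paths_subset)
        qed
        with d(1) show ?thesis by blast
      qed
      have "p x \<in> ?X" using pX x by simp
      then show "\<exists>d>0. \<forall>s t. s \<le> x \<and> x \<le> t \<and> t - s < d \<longrightarrow> s \<in> {0..1} \<longrightarrow> t \<in> {0..1} \<longrightarrow>
          homotopic_paths ?X (subpath s t p) (reversepath (c (p s)) +++ c (p t))"
        using main[OF U] main[OF V] c by blast
    qed simp
    then show ?thesis by (simp add: pathstart_def pathfinish_def)
  qed
  show ?thesis
    unfolding simply_connected_eq_homotopic_paths
  proof (intro conjI allI impI)
    show "path_connected ?X" by (rule path_connected_Un[OF pU pV UV(2)])
    fix p q assume "path p \<and> path_image p \<subseteq> ?X \<and> path q \<and> path_image q \<subseteq> ?X \<and>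
        pathstart q = pathstart p \<and> pathfinish q = pathfinish p"
    then show "homotopic_paths ?X p q"
      using key[of p] key[of q] by (metis homotopic_paths_sym homotopic_paths_trans)
  qed
qed

lemma simply_connected_homeomorphic_image:
  assumes S: "simply_connected S" and f: "continuous_on S f" "f ` S = T"
    and g: "continuous_on T g" "\<And>x. x \<in> S \<Longrightarrow> g (f x) = x"
  shows "simply_connected T"
  unfolding simply_connected_def
proof (intro allI impI)
  have gT: "g y \<in> S" "f (g y) = y" if "y \<in> T" for y using that f(2) g(2) by auto
  have loop: "homotopic_loops T p (f \<circ> (g \<circ> p)) \<and> path (g \<circ> p) \<and> path_image (g \<circ> p) \<subseteq> S \<and>
      pathfinish (g \<circ> p) = pathstart (g \<circ> p)"
    if "path p" "pathfinish p = pathstart p" "path_image p \<subseteq> T" for p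
  proof (intro conjI homotopic_loops_eq)
    show "p t = (f \<circ> (g \<circ> p)) t" if "t \<in> {0..1}" for t
    proof -
      have "p t \<in> T" using that \<open>path_image p \<subseteq> T\<close> unfolding path_image_def by blast
      then show ?thesis using gT(2) by simp
    qed
    show "path (g \<circ> p)"
      using that g(1) by (intro path_continuous_image) (auto intro: continuous_on_subset)
    show "path_image (g \<circ> p) \<subseteq> S" using gT(1) that(3) unfolding path_image_def by fastforce
    show "pathfinish (g \<circ> p) = pathstart (g \<circ> p)" using that(2) by (simp add: pathfinish_def pathstart_def)
  qed (use that in auto)
  fix p q assume *: "path p \<and> pathfinish p = pathstart p \<and> path_image p \<subseteq> T \<and>
    path q \<and> pathfinish q = pathstart q \<and> path_image q \<subseteq> T"
  then have "homotopic_loops S (g \<circ> p) (g \<circ> q)"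
    using loop[of p] loop[of q] S unfolding simply_connected_def by blast
  then have "homotopic_loops T (f \<circ> (g \<circ> p)) (f \<circ> (g \<circ> q))"
    by (rule homotopic_loops_continuous_image) (use f in auto)
  then show "homotopic_loops T p q"
    using homotopic_loops_trans[OF homotopic_loops_trans] homotopic_loops_sym[of T q] * loop[of p] loop[of q]
    by metis
qed

text \<open>Simple connectedness is expressed by free homotopies of loops, so it is enough that
  \<open>H\<close> ends in \<open>S\<close>: each loop in \<open>T\<close> is freely homotopic along
  \<open>H\<close> to one in \<open>S\<close>, and neither \<open>S\<close> nor a base point has to
  stay fixed.\<close>

lemma simply_connected_deform:
  fixes T :: "'a::topological_space set" and H :: "real \<times> 'a \<Rightarrow> 'a"
  assumes S: "simply_connected S" "S \<subseteq> T"
    and H: "continuous_on ({0..1} \<times> T) H" "\<And>t x. t \<in> {0..1} \<Longrightarrow> x \<in> T \<Longrightarrow> H (t, x) \<in> T"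
      "\<And>x. x \<in> T \<Longrightarrow> H (0, x) = x" "\<And>x. x \<in> T \<Longrightarrow> H (1, x) \<in> S"
  shows "simply_connected T"
  unfolding simply_connected_def
proof (intro allI impI)
  have loop: "homotopic_loops T p (\<lambda>s. H (1, p s)) \<and> path (\<lambda>s. H (1, p s)) \<and> path_image (\<lambda>s. H (1, p s)) \<subseteq> S \<and>
      pathfinish (\<lambda>s. H (1, p s)) = pathstart (\<lambda>s. H (1, p s))"
    if p: "path p" "pathfinish p = pathstart p" "path_image p \<subseteq> T" for p
  proof -
    have pT: "p s \<in> T" if "s \<in> {0..1}" for s using p(3) that unfolding path_image_def by blast
    have "continuous_on ({0..1} \<times> {0..1}) (\<lambda>z. p (snd z))"
      by (rule continuous_on_compose2[of "{0..1}" p])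
         (use p(1) in \<open>auto simp: path_def intro: continuous_on_snd continuous_on_id\<close>)
    then have "continuous_on ({0..1} \<times> {0..1}) (\<lambda>z. (fst z, p (snd z)))"
      by (intro continuous_on_Pair continuous_on_fst continuous_on_id)
    then have c: "continuous_on ({0..1} \<times> {0..1}) (\<lambda>z. H (fst z, p (snd z)))"
      by (rule continuous_on_compose2[OF H(1)]) (use pT in auto)
    have "homotopic_loops T p (\<lambda>s. H (1, p s))"
      unfolding homotopic_loops
      by (rule exI[of _ "\<lambda>z. H (fst z, p (snd z))"])
         (use c H(2,3) pT p(2) in \<open>auto simp: pathfinish_def pathstart_def\<close>)
    then show ?thesis
      using homotopic_loops_imp_path homotopic_loops_imp_loop H(4) pT
      by (fastforce simp: path_image_def)
  qed
  fix p q assume *: "path p \<and> pathfinish p = pathstart p \<and> path_image p \<subseteq> T \<and>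
    path q \<and> pathfinish q = pathstart q \<and> path_image q \<subseteq> T"
  then have "homotopic_loops S (\<lambda>s. H (1, p s)) (\<lambda>s. H (1, q s))"
    using loop[of p] loop[of q] S(1) unfolding simply_connected_def by blast
  then show "homotopic_loops T p q"
    using homotopic_loops_trans homotopic_loops_sym
      homotopic_loops_subset[OF _ S(2)] * loop[of p] loop[of q] by metis
qed

lemma simply_connected_singleton: "simply_connected {x}"
  unfolding simply_connected_def
proof (intro allI impI)
  fix p q :: "real \<Rightarrow> 'a"
  assume *: "path p \<and> pathfinish p = pathstart p \<and> path_image p \<subseteq> {x} \<and>
    path q \<and> pathfinish q = pathstart q \<and> path_image q \<subseteq> {x}"
  then have "p t = x" "q t = x" if "t \<in> {0..1}" for t using that unfolding path_image_def by blast+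
  then show "homotopic_loops {x} p q" using * by (intro homotopic_loops_eq) auto
qed

text \<open>The functions supported in a finite set are embedded into a normed space in order to apply
  the library facts about paths, most of which are restricted to normed spaces.\<close>

lemma simply_connected_Un_finite_support:
  fixes U V :: "('v \<Rightarrow> real) set"
  assumes D: "finite D" "\<And>x v. x \<in> U \<union> V \<Longrightarrow> v \<notin> D \<Longrightarrow> x v = 0"
    and U: "openin (top_of_set (U \<union> V)) U" "simply_connected U"
    and V: "openin (top_of_set (U \<union> V)) V" "simply_connected V"
    and UV: "path_connected (U \<inter> V)" "U \<inter> V \<noteq> {}"
  shows "simply_connected (U \<union> V)"
proof -
  let ?X = "U \<union> V"
  define \<iota> where "\<iota> = to_nat_on D"
  have inj: "inj_on \<iota> D" using D(1) by (simp add: \<iota>_def inj_on_to_nat_on countable_finite)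
  \<comment> \<open>The unit vectors of the normed space of bounded functions on the natural
    numbers. With \<open>\<iota>\<close> numbering the vertices in \<open>D\<close>, they carry the
    coordinates of \<open>x\<close> to the vector \<open>e x\<close>, and evaluation at
    \<open>\<iota> v\<close> recovers them.\<close>
  define \<delta> where "\<delta> = (\<lambda>n. Bcontfun (\<lambda>m::nat. if m = n then 1 else 0 :: real))"
  have \<delta>: "apply_bcontfun (\<delta> n) m = (if m = n then 1 else 0)" for m n
  proof -
    have "(\<lambda>m. if m = n then 1 else 0 :: real) \<in> bcontfun"
      by (rule bcontfun_normI[of _ 1]) auto
    then show ?thesis by (simp add: \<delta>_def Bcontfun_inverse)
  qed
  define e where "e = (\<lambda>x. \<Sum>v\<in>D. x v *\<^sub>R \<delta> (\<iota> v))"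
  define g where "g = (\<lambda>f v. if v \<in> D then apply_bcontfun f (\<iota> v) else (0::real))"
  have "apply_bcontfun (\<Sum>v\<in>E. x v *\<^sub>R \<delta> (\<iota> v)) m = (\<Sum>v\<in>E. x v * (if m = \<iota> v then 1 else 0))"
    if "finite E" for E x m
    using that by (induction E) (simp_all add: \<delta>)
  then have "apply_bcontfun (e x) (\<iota> u) = x u" if "u \<in> D" for x u
    using that D(1) inj by (simp add: e_def inj_on_eq_iff if_distrib[of "(*) _"] cong: if_cong)
  then have ge: "g (e x) = x" if "x \<in> ?X" for x
    using D(2)[OF that] by (auto simp: g_def)
  have ce: "continuous_on A e" for A
    unfolding e_def by (intro continuous_on_sum continuous_on_scaleR continuous_on_coordinate continuous_on_const)
  have cg: "continuous_on A g" for A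
  proof (rule continuous_on_coordinatewise_then_product)
    fix v
    have "continuous_on A (\<lambda>f. apply_bcontfun f n :: real)" for n :: nat
      unfolding continuous_on_iff using dist_bounded le_less_trans by metis
    then show "continuous_on A (\<lambda>f. g f v)" by (cases "v \<in> D") (auto simp: g_def)
  qed
  have geX: "g \<in> e ` ?X \<rightarrow> ?X" using ge by auto
  have img: "e ` W = e ` ?X \<inter> g -` W" if "W \<subseteq> ?X" for W
    using that ge by force
  have op: "openin (top_of_set (e ` ?X)) (e ` W)" if "openin (top_of_set ?X) W" for W
    unfolding img[OF openin_imp_subset[OF that]]
    by (rule continuous_openin_preimage[OF cg geX that])
  have sc: "simply_connected (e ` W)" if "simply_connected W" "W \<subseteq> ?X" for W
    by (rule simply_connected_homeomorphic_image[OF that(1) ce refl cg]) (use ge that(2) in auto)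
  have int: "e ` U \<inter> e ` V = e ` (U \<inter> V)"
    by (subst inj_on_image_Int[of e ?X]) (auto intro: inj_on_inverseI[of _ g] ge)
  have "simply_connected (e ` U \<union> e ` V)"
  proof (rule simply_connected_Un)
    show "path_connected (e ` U \<inter> e ` V)"
      unfolding int by (rule path_connected_continuous_image[OF ce UV(1)])
    show "e ` U \<inter> e ` V \<noteq> {}" unfolding int using UV(2) by simp
  qed (use op[OF U(1)] op[OF V(1)] sc U V in \<open>auto simp: image_Un\<close>)
  then have "simply_connected (e ` ?X)" by (simp add: image_Un)
  then show ?thesis
  proof (rule simply_connected_homeomorphic_image[OF _ cg _ ce])
    show "g ` (e ` ?X) = ?X" using ge by force
  qed (use ge in auto)
qed

section \<open>Connectedness and simple connectedness of coned complexes\<close>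

text \<open>The difference is the sum of the excesses over the minimum and vanishes only if
  \<open>x\<close> is constant on \<open>S\<close>. This expresses avoidance of the barycenter by a
  strict inequality of two coordinates, a condition that convex combinations preserve.\<close>

lemma radius_less_sum_iff:
  assumes "finite S" "S \<noteq> {}"
  shows "radius S x < sum x S \<longleftrightarrow> (\<exists>u\<in>S. \<exists>v\<in>S. x u < x v)"
proof -
  have eq: "sum x S - radius S x = (\<Sum>v\<in>S. x v - Min (x ` S))"
    by (simp add: radius_def sum_subtractf)
  have ge: "Min (x ` S) \<le> x v" if "v \<in> S" for v using assms that by simp
  have "Min (x ` S) \<in> x ` S" using assms by (intro Min_in) auto
  then obtain u where u: "u \<in> S" "x u = Min (x ` S)" by auto
  have "sum x S - radius S x \<ge> 0" unfolding eq using ge by (intro sum_nonneg) simp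
  then have "radius S x < sum x S \<longleftrightarrow> sum x S - radius S x \<noteq> 0" by auto
  also have "\<dots> \<longleftrightarrow> (\<exists>v\<in>S. x v \<noteq> Min (x ` S))"
    unfolding eq using ge assms by (subst sum_nonneg_eq_0_iff) auto
  also have "\<dots> \<longleftrightarrow> (\<exists>u\<in>S. \<exists>v\<in>S. x u < x v)"
    using u ge by (metis le_less less_le_trans not_less_iff_gr_or_eq)
  finally show ?thesis .
qed

lemma continuous_on_segment_map:
  fixes f g :: "'a::topological_space \<Rightarrow> 'v \<Rightarrow> real"
  assumes "continuous_on A h" "continuous_on A f" "continuous_on A g"
  shows "continuous_on A (\<lambda>z v. (1 - h z) * f z v + h z * g z v)"
proof (rule continuous_on_coordinatewise_then_product)
  note [continuous_intros] = continuous_on_product_then_coordinatewise[OF assms(2)]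
    continuous_on_product_then_coordinatewise[OF assms(3)] assms(1)
  show "continuous_on A (\<lambda>z. (1 - h z) * f z v + h z * g z v)" for v
    by (intro continuous_intros)
qed

lemma path_component_segment:
  fixes x y :: "'v \<Rightarrow> real"
  assumes "\<And>t. 0 \<le> t \<Longrightarrow> t \<le> 1 \<Longrightarrow> (\<lambda>v. (1 - t) * x v + t * y v) \<in> A"
  shows "path_component A x y"
proof -
  let ?p = "\<lambda>t v. (1 - t) * x v + t * y v"
  have "path ?p"
    unfolding path_def by (intro continuous_on_segment_map continuous_on_id continuous_on_const)
  moreover have "path_image ?p \<subseteq> A" using assms by (auto simp: path_image_def)
  moreover have "pathstart ?p = x" "pathfinish ?p = y" by (auto simp: pathstart_def pathfinish_def)
  ultimately show ?thesis unfolding path_component_def by blast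
qed

section \<open>Open simplices, with and without their barycenter\<close>

definition open_simplex :: "'v set \<Rightarrow> ('v \<Rightarrow> real) set" where
  "open_simplex S = {x. (\<forall>v\<in>S. 0 < x v) \<and> (\<forall>v. v \<notin> S \<longrightarrow> x v = 0) \<and> sum x S = 1}"

lemma open_simplex_segment:
  assumes x: "x \<in> open_simplex S" and y: "y \<in> open_simplex S" and t: "0 \<le> t" "t \<le> 1"
  shows "(\<lambda>v. (1 - t) * x v + t * y v) \<in> open_simplex S"
proof -
  have "0 < (1 - t) * x v + t * y v" if "v \<in> S" for v
  proof (cases "t = 1")
    case True
    then show ?thesis using y that by (simp add: open_simplex_def)
  next
    case False
    then have "0 < (1 - t) * x v" using x that t by (simp add: open_simplex_def)
    moreover have "0 < y v" using y that by (simp add: open_simplex_def)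
    then have "0 \<le> t * y v" using t by simp
    ultimately show ?thesis by linarith
  qed
  moreover have "(\<Sum>v\<in>S. (1 - t) * x v + t * y v) = 1"
    using x y by (simp add: open_simplex_def sum.distrib flip: sum_distrib_left)
  ultimately show ?thesis using x y by (simp add: open_simplex_def)
qed

lemma barycenter_open_simplex: "finite S \<Longrightarrow> S \<noteq> {} \<Longrightarrow> barycenter S \<in> open_simplex S"
  by (auto simp: open_simplex_def barycenter_def card_gt_0_iff)

lemma simply_connected_open_simplex:
  assumes "finite S" "S \<noteq> {}"
  shows "simply_connected (open_simplex S)"
proof (rule simply_connected_deform[OF simply_connected_singleton])
  note b = barycenter_open_simplex[OF assms]
  show "{barycenter S} \<subseteq> open_simplex S" using b by simp
  let ?H = "\<lambda>z v. (1 - fst z) * snd z v + fst z * barycenter S v"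
  show "continuous_on ({0..1} \<times> open_simplex S) ?H"
    by (intro continuous_on_segment_map continuous_on_fst continuous_on_snd continuous_on_id continuous_on_const)
  show "?H (t, x) \<in> open_simplex S" if "t \<in> {0..1}" "x \<in> open_simplex S" for t x
    using open_simplex_segment[OF that(2) b] that(1) by simp
qed auto

text \<open>A segment avoids the barycenter if the values at two fixed vertices are in the same strict
  order at both ends.  Points with larger values on one or two vertices serve as relays.\<close>

lemma path_connected_punctured_open_simplex:
  assumes S: "finite S" "card S \<ge> 3"
  shows "path_connected {x \<in> open_simplex S. \<exists>u\<in>S. \<exists>v\<in>S. x u < x v}" (is "path_connected ?W")
    and "{x \<in> open_simplex S. \<exists>u\<in>S. \<exists>v\<in>S. x u < x v} \<noteq> {}"
proof -
  have seg: "path_component ?W x y"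
    if "x \<in> ?W" "y \<in> ?W" "u \<in> S" "v \<in> S" "x u < x v" "y u < y v" for x y u v
  proof (rule path_component_segment)
    fix t :: real assume t: "0 \<le> t" "t \<le> 1"
    have "(1 - t) * x u + t * y u < (1 - t) * x v + t * y v"
    proof (cases "t = 1")
      case False
      then have "(1 - t) * x u < (1 - t) * x v" using t that by simp
      moreover have "t * y u \<le> t * y v" using t that by (intro mult_left_mono) auto
      ultimately show ?thesis by linarith
    qed (use that in simp)
    then show "(\<lambda>v. (1 - t) * x v + t * y v) \<in> ?W"
      using open_simplex_segment[of x S y t] that t by blast
  qed
  \<comment> \<open>The relay points: weight 2 on \<open>A\<close> and 1 on the rest of
    \<open>S\<close>, divided by the total \<open>card S + card A\<close>.\<close>
  define z where "z = (\<lambda>A v. if v \<in> S then (if v \<in> A then 2 else 1) / (real (card S) + real (card A)) else 0)"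
  have cS: "real (card S) > 0" using S by simp
  have z_less: "z A c < z A d" if "c \<in> S" "d \<in> A" "c \<notin> A" "A \<subseteq> S" for A c d
    using that cS by (auto simp: z_def divide_strict_right_mono subset_iff)
  have zW: "z A \<in> ?W" if A: "A \<subseteq> S" "d \<in> A" "c \<in> S" "c \<notin> A" for A c d
  proof -
    have "(\<Sum>v\<in>S. if v \<in> A then 2 else 1 :: real) = (\<Sum>v\<in>S. 1) + (\<Sum>v\<in>S. if v \<in> A then 1 else 0)"
      by (subst sum.distrib[symmetric]) (rule sum.cong, auto)
    also have "\<dots> = real (card S) + real (card A)"
      using S(1) A by (simp add: sum.If_cases Int_absorb1)
    finally have "sum (z A) S = 1"
      using cS by (simp add: z_def flip: sum_divide_distrib)
    moreover have "z A v > 0" if "v \<in> S" for v using that cS by (simp add: z_def)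
    ultimately have "z A \<in> open_simplex S" by (simp add: open_simplex_def z_def)
    then show ?thesis using z_less[OF A(3,2,4,1)] A by blast
  qed
  have third: "\<exists>c\<in>S. c \<noteq> a \<and> c \<noteq> b" for a b
  proof -
    have "card {a, b} \<le> 2" by (simp add: card_insert_if)
    then have "\<not> S \<subseteq> {a, b}" using card_mono[of "{a, b}" S] S by auto
    then show ?thesis by blast
  qed
  have to_z: "\<exists>a\<in>S. path_component ?W x (z {a})" if x: "x \<in> ?W" for x
  proof -
    obtain u v where uv: "u \<in> S" "v \<in> S" "x u < x v" using x by blast
    then have "z {v} u < z {v} v" by (intro z_less) auto
    moreover have "z {v} \<in> ?W" using uv by (intro zW[of _ v u]) auto
    ultimately show ?thesis using seg[OF x _ uv(1,2,3)] uv(2) by blast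
  qed
  \<comment> \<open>The third vertex \<open>c\<close> has a smaller value than \<open>a\<close> at
    both \<open>z {a}\<close> and \<open>z {a, b}\<close>, and a smaller value than \<open>b\<close>
    at both \<open>z {a, b}\<close> and \<open>z {b}\<close>, so neither segment meets the
    barycenter.\<close>
  have zz: "path_component ?W (z {a}) (z {b})" if ab: "a \<in> S" "b \<in> S" for a b
  proof -
    obtain c where c: "c \<in> S" "c \<noteq> a" "c \<noteq> b" using third by blast
    have W: "z {a} \<in> ?W" "z {b} \<in> ?W" "z {a, b} \<in> ?W"
      by (rule zW[of _ a c] zW[of _ b c]; use ab c in simp)+
    have "path_component ?W (z {a}) (z {a, b})"
      by (rule seg[OF W(1,3) c(1) ab(1)]) (use ab c in \<open>auto intro!: z_less\<close>)
    moreover have "path_component ?W (z {a, b}) (z {b})"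
      by (rule seg[OF W(3,2) c(1) ab(2)]) (use ab c in \<open>auto intro!: z_less\<close>)
    ultimately show ?thesis by (rule path_component_trans)
  qed
  show "path_connected ?W"
    unfolding path_connected_component
  proof (intro ballI)
    fix x y assume "x \<in> ?W" "y \<in> ?W"
    then obtain a b where "a \<in> S" "path_component ?W x (z {a})" "b \<in> S" "path_component ?W y (z {b})"
      using to_z[of x] to_z[of y] by blast
    then show "path_component ?W x y"
      using path_component_trans[OF path_component_trans[OF _ zz]] path_component_sym by blast
  qed
  obtain a where a: "a \<in> S" using S by fastforce
  obtain c where "c \<in> S" "c \<noteq> a" using third by blast
  then have "z {a} \<in> ?W" using a by (intro zW[of _ a c]) auto
  then show "?W \<noteq> {}" by blast
qed

section \<open>Connectedness and removal of cells\<close>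

context coned_complex
begin

lemma segment_in:
  assumes T: "T \<in> K" and x: "x \<in> R" "{v. x v \<noteq> 0} \<subseteq> T" and y: "y \<in> R" "{v. y v \<noteq> 0} \<subseteq> T"
    and t: "0 \<le> t" "t \<le> 1"
  shows "(\<lambda>v. (1 - t) * x v + t * y v) \<in> R" (is "?z \<in> R")
proof (rule geom_realizationI)
  show fin: "finite T" by (rule face_finite[OF T])
  have sm: "sum x T = 1" if "x \<in> R" "{v. x v \<noteq> 0} \<subseteq> T" for x
  proof -
    have "sum x T = (\<Sum>v | x v \<noteq> 0. x v)" using fin that(2) by (intro sum.mono_neutral_right) auto
    then show ?thesis using geom_realizationD(3)[OF that(1)] by simp
  qed
  then show *: "sum ?z T = 1" using x y by (simp add: sum.distrib flip: sum_distrib_left)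
  show "?z v = 0" if "v \<notin> T" for v
  proof -
    have "x v = 0" "y v = 0" using that x(2) y(2) by blast+
    then show ?thesis by simp
  qed
  show "0 \<le> ?z v" for v using geom_realizationD(1)[OF x(1)] geom_realizationD(1)[OF y(1)] t by simp
  have "{v. ?z v \<noteq> 0} \<subseteq> {v. x v \<noteq> 0} \<union> {v. y v \<noteq> 0}" by auto
  then have "{v. ?z v \<noteq> 0} \<subseteq> T" using x(2) y(2) by blast
  moreover have "{v. ?z v \<noteq> 0} \<noteq> {}"
  proof
    assume "{v. ?z v \<noteq> 0} = {}"
    then have "sum ?z T = 0" by (intro sum.neutral) auto
    with * show False by simp
  qed
  ultimately show "{v. ?z v \<noteq> 0} \<in> K" using subface[OF T] by blast
qed

lemma vertex_point_in: "{v} \<in> K \<Longrightarrow> vertex_point v \<in> R"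
  by (rule geom_realizationI[of "{v}"]) (auto simp: vertex_point_def)

lemma support_vertex_point: "{u. vertex_point v u \<noteq> 0} = {v}"
  by (auto simp: vertex_point_def)

text \<open>A point inside a cell is joined within the cell to one of its vertices. By assumption
  this vertex is not a cell, so the segment from it to the apex is available.\<close>

lemma path_connected_if_no_points:
  assumes "\<And>S. S \<in> F \<Longrightarrow> card S \<noteq> 1"
  shows "path_connected R"
proof -
  have cone_path: "path_component R x (vertex_point a)" if "x \<in> R" "{v. x v \<noteq> 0} \<notin> F" for x
    by (rule path_component_segment) (use that cone geom_realizationD(2) in \<open>auto intro!: segment_to_apex\<close>)
  have "path_component R x (vertex_point a)" if x: "x \<in> R" for x
  proof (cases "{v. x v \<noteq> 0} \<in> F")
    case True
    let ?S = "{v. x v \<noteq> 0}"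
    obtain v where v: "v \<in> ?S" using cell_finite[OF True] by blast
    have SK: "?S \<in> K" using True cells by blast
    then have vK: "{v} \<in> K" using v subface[of ?S "{v}"] by blast
    have "{u. vertex_point v u \<noteq> 0} \<subseteq> ?S" unfolding support_vertex_point using v by simp
    then have "path_component R x (vertex_point v)"
      by (intro path_component_segment segment_in[OF SK x subset_refl vertex_point_in[OF vK]])
    moreover have "{v} \<notin> F" using assms by fastforce
    then have "path_component R (vertex_point v) (vertex_point a)"
      using cone_path[OF vertex_point_in[OF vK]] by (simp add: support_vertex_point)
    ultimately show ?thesis by (rule path_component_trans)
  qed (use cone_path x in blast)
  then show ?thesis
    unfolding path_connected_component by (meson path_component_sym path_component_trans)
qed

text \<open>As \<open>{v}\<close> is a maximal face, the coordinate at \<open>v\<close> takes only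
  the values 0 and 1 on the realization, and 1 only at the vertex. The conditions
  \<open>0 < x v\<close> and \<open>1 \<le> x v\<close> thus cut out the same set, which is
  clopen.\<close>

lemma vertex_point_isolated:
  assumes v: "{v} \<in> F" and A: "A \<subseteq> R" "vertex_point v \<in> A" "connected A"
  shows "A = {vertex_point v}"
proof -
  have val: "x = vertex_point v \<or> x v = 0" if "x \<in> A" for x
  proof (cases "x v = 0")
    case False
    have xR: "x \<in> R" using that A(1) by blast
    have "{v. x v \<noteq> 0} = {v}"
      using cell_maximal[OF v geom_realizationD(2)[OF xR]] False by blast
    moreover from this have "x v = 1" using geom_realizationD(3)[OF xR] by simp
    ultimately show ?thesis by (auto simp: vertex_point_def fun_eq_iff)
  qed blast
  let ?T = "{vertex_point v}"
  have "openin (top_of_set A) ({x. 0 < x v} \<inter> A)"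
    by (subst Int_commute, intro openin_open_Int open_Collect_less continuous_on_const continuous_on_coordinate)
  moreover have "closedin (top_of_set A) ({x. 1 \<le> x v} \<inter> A)"
    by (subst Int_commute, intro closedin_closed_Int closed_Collect_le continuous_on_const continuous_on_coordinate)
  moreover have "{x. 0 < x v} \<inter> A = ?T" "{x. 1 \<le> x v} \<inter> A = ?T"
    using val A(2) by (force simp: vertex_point_def)+
  ultimately show ?thesis using A(3) unfolding connected_clopen by auto
qed

lemma connected_iff: "connected R \<longleftrightarrow> (\<forall>S\<in>F. card S \<noteq> 1)"
proof
  assume con: "connected R"
  show "\<forall>S\<in>F. card S \<noteq> 1"
  proof (intro ballI notI)
    fix S assume S: "S \<in> F" "card S = 1"
    then obtain v where v: "S = {v}" using card_1_singletonE by blast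
    have "R = {vertex_point v}"
      by (rule vertex_point_isolated) (use S v con cells vertex_point_in in auto)
    then have "vertex_point a = vertex_point v" using apex_in by auto
    then have "a = v" by (metis support_vertex_point singleton_inject)
    then show False using apex_notin_cell[OF S(1)] v by simp
  qed
next
  assume "\<forall>S\<in>F. card S \<noteq> 1"
  then show "connected R" using path_connected_if_no_points path_connected_imp_connected by blast
qed

text \<open>Allows induction on the number of cells. Maximality keeps the faces closed under
  subfaces, and coning never produces a removed cell because cells avoid \<open>a\<close>.\<close>

lemma remove_cells: "G \<subseteq> F \<Longrightarrow> coned_complex (K - G) a (F - G)"
proof
  assume G: "G \<subseteq> F"
  show "T \<in> K - G" if "S \<in> K - G" "T \<subseteq> S" "T \<noteq> {}" for S T
  proof -
    have "T \<in> K" using that subface by blast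
    moreover have "T \<notin> G" using that G cell_maximal[of T S] by auto
    ultimately show ?thesis by blast
  qed
  show "{a} \<in> K - G" using G apex apex_notin_cell by blast
  show "insert a S \<in> K - G" if "S \<in> K - G" "S \<notin> F - G" for S
    using that G cone[of S] apex_notin_cell[of "insert a S"] by blast
qed (use face_finite face_nonempty finite_cells cells apex_notin_cell cell_maximal in auto)

lemma open_simplex_eq_radius_pos:
  assumes S: "S \<in> F" shows "open_simplex S = {x \<in> R. 0 < radius S x}"
proof (intro equalityI subsetI)
  fix x assume x: "x \<in> open_simplex S"
  have nn: "0 \<le> x v" for v using x by (cases "v \<in> S") (auto simp: open_simplex_def)
  have supp: "{v. x v \<noteq> 0} = S" using x by (force simp: open_simplex_def)
  have "x \<in> R"
    by (rule geom_realizationI[of S]) (use x nn supp cells S cell_finite in \<open>auto simp: open_simplex_def\<close>)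
  moreover have "radius S x \<noteq> 0"
    using radius_eq_0_iff[OF cell_finite[OF S], of x] nn x by (auto simp: open_simplex_def)
  ultimately show "x \<in> {x \<in> R. 0 < radius S x}" using radius_bounds[OF _ S, of x] by auto
next
  fix x assume "x \<in> {x \<in> R. 0 < radius S x}"
  then have x: "x \<in> R" "radius S x \<noteq> 0" by auto
  note supp = support_eq_cell[OF x(1) S x(2)]
  have "sum x S = 1" using geom_realizationD(3)[OF x(1)] supp by simp
  moreover have "0 < x v" if "v \<in> S" for v
    using geom_realizationD(1)[OF x(1), of v] supp that by (metis (mono_tags) less_eq_real_def mem_Collect_eq)
  ultimately show "x \<in> open_simplex S" using supp by (auto simp: open_simplex_def)
qed

text \<open>Removing the barycenter of a cell leaves a space that deforms radially onto the complex
  without the cell.\<close>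

lemma simply_connected_punctured_cell:
  assumes S: "S \<in> F" and sc: "simply_connected (geom_realization (K - {S}))"
  shows "simply_connected {x \<in> R. radius S x < 1}" (is "simply_connected ?U")
proof (rule simply_connected_deform[OF sc])
  note fS = cell_finite[OF S]
  \<comment> \<open>The radial projection from the barycenter to the boundary of the cell: the
    barycenter component is removed and the rest rescaled to total mass 1. At radius 0 it is the
    identity.\<close>
  define y where "y = (\<lambda>x v. (x v - radius S x * barycenter S v) / (1 - radius S x))"
  let ?H = "\<lambda>z v. (1 - fst z) * snd z v + fst z * y (snd z) v"
  have y0: "y x = x" if "radius S x = 0" for x using that by (simp add: y_def)
  have ypos: "y x \<in> R \<and> {v. y x v \<noteq> 0} \<subset> S" if x: "x \<in> R" "radius S x < 1" "radius S x \<noteq> 0" for x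
  proof -
    note supp = support_eq_cell[OF x(1) S x(3)]
    have out: "y x v = 0" if "v \<notin> S" for v using that supp by (auto simp: y_def barycenter_def)
    have "Min (x ` S) \<in> x ` S" using fS by (intro Min_in) auto
    then obtain u where u: "u \<in> S" "x u = Min (x ` S)" by auto
    then have yu: "y x u = 0" using radius_mult_barycenter[OF fS(1), of u x] by (simp add: y_def)
    have sub: "{v. y x v \<noteq> 0} \<subset> S" using out yu u(1) by blast
    have sm: "sum (y x) S = 1"
    proof -
      have "sum (y x) S = (sum x S - radius S x * sum (barycenter S) S) / (1 - radius S x)"
        by (simp add: y_def sum_subtractf flip: sum_divide_distrib sum_distrib_left)
      then show ?thesis using geom_realizationD(3)[OF x(1)] supp sum_barycenter[OF fS] x(2) by simp
    qed
    have "{v. y x v \<noteq> 0} \<noteq> {}"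
    proof
      assume "{v. y x v \<noteq> 0} = {}"
      then have "sum (y x) S = 0" by (intro sum.neutral) blast
      with sm show False by simp
    qed
    then have "{v. y x v \<noteq> 0} \<in> K" using subface[of S] sub S cells by blast
    moreover have "0 \<le> y x v" for v
      using radius_mult_barycenter[OF fS(1), of v x] fS x(2) out[of v]
      by (cases "v \<in> S") (auto simp: y_def intro!: divide_nonneg_nonneg)
    ultimately have "y x \<in> R" using out sm fS by (intro geom_realizationI[of S]) auto
    with sub show ?thesis by blast
  qed
  show "geom_realization (K - {S}) \<subseteq> ?U"
  proof
    fix x assume x: "x \<in> geom_realization (K - {S})"
    then have xR: "x \<in> R" "{v. x v \<noteq> 0} \<noteq> S" by (auto simp: geom_realization_def)
    then have "radius S x = 0" using support_eq_cell[OF _ S] by blast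
    with xR show "x \<in> ?U" by simp
  qed
  show "?H (1, x) \<in> geom_realization (K - {S})" if "x \<in> ?U" for x
  proof (cases "radius S x = 0")
    case True
    have "x \<in> R" using that by simp
    moreover have "{v. x v \<noteq> 0} \<noteq> S"
      using True radius_eq_0_iff[OF fS, of x] geom_realizationD(1)[OF \<open>x \<in> R\<close>] by auto
    ultimately have "x \<in> geom_realization (K - {S})" by (auto simp: geom_realization_def)
    then show ?thesis using y0[OF True] by simp
  next
    case False
    then show ?thesis using ypos[of x] that by (auto simp: geom_realization_def)
  qed
  show "?H (t, x) \<in> ?U" if t: "t \<in> {0..1}" and x: "x \<in> ?U" for t x
  proof (cases "radius S x = 0")
    case True
    have "?H (t, x) = x" using y0[OF True] by (simp add: algebra_simps)
    then show ?thesis using x by simp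
  next
    case False
    have xR: "x \<in> R" "radius S x < 1" using x by auto
    note supp = support_eq_cell[OF xR(1) S False] and yS = ypos[OF xR False]
    have H: "?H (t, x) \<in> R"
      using segment_in[of S x "y x" t] S cells xR supp yS t by auto
    have "sum x S = 1" using geom_realizationD(3)[OF xR(1)] supp by simp
    then have "radius S x < sum x S" using xR by simp
    then obtain u v where uv: "u \<in> S" "v \<in> S" "x u < x v"
      using radius_less_sum_iff[OF fS] by blast
    \<comment> \<open>The projection subtracts one amount from all coordinates in \<open>S\<close>
      and rescales, so it keeps the order of \<open>x u\<close> and \<open>x v\<close>. The segment
      from \<open>x\<close> to \<open>y x\<close> keeps it too and therefore misses the
      barycenter.\<close>
    have yuv: "y x u < y x v"
      using uv xR unfolding y_def by (intro divide_strict_right_mono) (auto simp: barycenter_def)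
    have "?H (t, x) u < ?H (t, x) v"
    proof (cases "t = 1")
      case True
      then show ?thesis using yuv by simp
    next
      case False
      then have "(1 - t) * x u < (1 - t) * x v" using t uv by simp
      moreover have "t * y x u \<le> t * y x v" using t yuv by (intro mult_left_mono) auto
      ultimately show ?thesis by simp
    qed
    then have "radius S (?H (t, x)) < sum (?H (t, x)) S"
      using uv radius_less_sum_iff[OF fS, of "?H (t, x)"] by blast
    also have "sum (?H (t, x)) S \<le> 1"
    proof -
      have "{v. ?H (t, x) v \<noteq> 0} \<subseteq> {v. x v \<noteq> 0} \<union> {v. y x v \<noteq> 0}" by auto
      then have "{v. ?H (t, x) v \<noteq> 0} \<subseteq> S" using supp yS by blast
      then have "sum (?H (t, x)) S = (\<Sum>v | ?H (t, x) v \<noteq> 0. ?H (t, x) v)"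
        using fS by (intro sum.mono_neutral_right) auto
      then show ?thesis using geom_realizationD(3)[OF H] by simp
    qed
    finally show ?thesis using H by simp
  qed
  have cr: "continuous_on ({0..1::real} \<times> ?U) (\<lambda>z. radius S (snd z))"
    by (intro continuous_on_radius fS continuous_on_snd continuous_on_id)
  have "continuous_on ({0..1::real} \<times> ?U) (\<lambda>z. y (snd z))"
  proof (rule continuous_on_coordinatewise_then_product)
    fix v
    have "continuous_on ({0..1::real} \<times> ?U) (\<lambda>z. snd z v)"
      by (rule continuous_on_product_then_coordinatewise[OF continuous_on_snd[OF continuous_on_id]])
    then show "continuous_on ({0..1::real} \<times> ?U) (\<lambda>z. y (snd z) v)"
      unfolding y_def by (intro continuous_on_divide continuous_on_diff continuous_on_mult continuous_on_const cr) auto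
  qed
  then show "continuous_on ({0..1} \<times> ?U) ?H"
    by (intro continuous_on_segment_map continuous_on_fst continuous_on_snd continuous_on_id)
qed auto

end

text \<open>Without cells the flow contracts everything to the apex. A further cell \<open>S\<close>
  is attached by covering the space with the complement of its barycenter, which deforms onto the
  smaller complex, and its open simplex. They meet in a punctured open simplex, path connected since
  \<open>S\<close> has at least three vertices.\<close>

lemma simply_connected_coned_complex:
  assumes "coned_complex K a F" "finite (\<Union>K)" "\<And>S. S \<in> F \<Longrightarrow> card S \<ge> 3"
  shows "simply_connected (geom_realization K)"
proof -
  have "finite F" using assms(1) by (rule coned_complex.finite_cells)
  then show ?thesis using assms
  proof (induction F arbitrary: K rule: finite_induct)
    case empty
    interpret coned_complex K a "{}" by (rule empty.prems(1))
    show ?case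
    proof (rule simply_connected_deform[OF simply_connected_singleton])
      show "{vertex_point a} \<subseteq> R" using apex_in by simp
      show "continuous_on ({0..1} \<times> R) (\<lambda>z. flow (fst z) (snd z))" by (rule continuous_on_flow)
    qed (use flow_in flow_0 flow_noncell[of _ 1] in auto)
  next
    case (insert S F)
    interpret coned_complex K a "insert S F" by (rule insert.prems(1))
    have S: "S \<in> insert S F" by simp
    note fS = cell_finite[OF S]
    have "insert S F - {S} = F" using insert.hyps by auto
    then have sc: "simply_connected (geom_realization (K - {S}))"
      using insert.IH[of "K - {S}"] remove_cells[of "{S}"] insert.prems(2,3)
      by (auto intro: finite_subset[of _ "\<Union>K"])
    let ?U = "{x \<in> R. radius S x < 1}" and ?V = "{x \<in> R. 0 < radius S x}"
    have UV: "?U \<union> ?V = R" by auto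
    have V: "?V = open_simplex S" using open_simplex_eq_radius_pos[OF S] by simp
    have W: "?U \<inter> ?V = {x \<in> open_simplex S. \<exists>u\<in>S. \<exists>v\<in>S. x u < x v}"
    proof -
      have "radius S x < 1 \<longleftrightarrow> (\<exists>u\<in>S. \<exists>v\<in>S. x u < x v)" if "x \<in> open_simplex S" for x
        using radius_less_sum_iff[OF fS, of x] that by (simp add: open_simplex_def)
      moreover have "?U \<inter> ?V = {x \<in> ?V. radius S x < 1}" by auto
      ultimately show ?thesis unfolding V by auto
    qed
    have cr: "continuous_on R (radius S)"
      using continuous_on_radius[OF fS continuous_on_id] by simp
    have "simply_connected (?U \<union> ?V)"
    proof (rule simply_connected_Un_finite_support[OF insert.prems(2)])
      show "x v = 0" if "x \<in> ?U \<union> ?V" "v \<notin> \<Union>K" for x v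
        using that geom_realizationD(2)[of x K] by auto
      have "openin (top_of_set R) (R \<inter> radius S -` {..<1})" "openin (top_of_set R) (R \<inter> radius S -` {0<..})"
        using cr by (auto intro!: continuous_openin_preimage_gen)
      moreover have "R \<inter> radius S -` {..<1} = ?U" "R \<inter> radius S -` {0<..} = ?V" by auto
      ultimately show "openin (top_of_set (?U \<union> ?V)) ?U" "openin (top_of_set (?U \<union> ?V)) ?V"
        unfolding UV by simp_all
      show "simply_connected ?U" by (rule simply_connected_punctured_cell[OF S sc])
      show "simply_connected ?V" unfolding V by (rule simply_connected_open_simplex[OF fS])
      have c3: "card S \<ge> 3" using insert.prems(3) by simp
      show "path_connected (?U \<inter> ?V)" "?U \<inter> ?V \<noteq> {}"
        unfolding W using path_connected_punctured_open_simplex[OF fS(1) c3] by blast+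
    qed
    then show ?case unfolding UV .
  qed
qed

context coned_complex
begin

text \<open>A component is either an isolated vertex that is a cell, or it lies in the complex
  without the one-vertex cells. That complex is connected, hence equal to the component, and its
  remaining cells have at least three vertices.\<close>

lemma simply_connected_components:
  assumes fin: "finite (\<Union>K)" and no2: "\<And>S. S \<in> F \<Longrightarrow> card S \<noteq> 2"
    and C: "C \<in> components R"
  shows "simply_connected C"
proof -
  have CR: "C \<subseteq> R" "connected C" "C \<noteq> {}"
    using C in_components_subset in_components_connected in_components_nonempty by blast+
  let ?G = "{S \<in> F. card S = 1}"
  show ?thesis
  proof (cases "\<exists>v. {v} \<in> F \<and> vertex_point v \<in> C")
    case True
    then show ?thesis using vertex_point_isolated CR simply_connected_singleton by metis
  next
    case False
    interpret M: coned_complex "K - ?G" a "F - ?G" by (rule remove_cells) auto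
    have CM: "C \<subseteq> geom_realization (K - ?G)"
    proof
      fix x assume x: "x \<in> C"
      then have xR: "x \<in> R" using CR by blast
      have "{v. x v \<noteq> 0} \<notin> ?G"
      proof
        assume G: "{v. x v \<noteq> 0} \<in> ?G"
        then have "card {v. x v \<noteq> 0} = 1" by simp
        then obtain v where v: "{v. x v \<noteq> 0} = {v}" by (rule card_1_singletonE)
        then have "x v = 1" using geom_realizationD(3)[OF xR] by simp
        then have "x = vertex_point v" using v by (auto simp: vertex_point_def fun_eq_iff)
        then show False using False x v G by auto
      qed
      then show "x \<in> geom_realization (K - ?G)" using xR by (auto simp: geom_realization_def)
    qed
    have "card S \<ge> 3" if "S \<in> F - ?G" for S
    proof -
      have "card S \<noteq> 0" using that cell_finite[of S] by auto
      then show ?thesis using that no2[of S] by force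
    qed
    then have sc: "simply_connected (geom_realization (K - ?G))"
      by (intro simply_connected_coned_complex[OF M.coned_complex_axioms])
         (auto intro: finite_subset[OF _ fin])
    have "connected (geom_realization (K - ?G))" using M.connected_iff by auto
    moreover have "geom_realization (K - ?G) \<subseteq> R" by (auto simp: geom_realization_def)
    moreover have "C \<inter> geom_realization (K - ?G) \<noteq> {}" using CM CR(3) by auto
    ultimately have "geom_realization (K - ?G) \<subseteq> C" using components_maximal[OF C] by blast
    with CM sc show ?thesis by (metis subset_antisym)
  qed
qed

text \<open>The circle of an edge cell is a retract of the realization up to homotopy. Contracting
  its image under \<open>g\<close> inside a simply connected component and applying \<open>p\<close>
  would contract the standard circle, contradicting its winding number 1 around the origin.\<close>

lemma non_simply_connected_component:
  assumes S: "S \<in> F" "card S = 2"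
  shows "\<exists>C\<in>components R. \<not> simply_connected C"
proof -
  have "card S = 1 + 1" using S by simp
  then obtain p g where
    p: "continuous_map (top_of_set R) (nsphere 1) p" and g: "continuous_map (nsphere 1) (top_of_set R) g"
    and pg: "homotopic_with (\<lambda>f. f nsphere_base = nsphere_base) (nsphere 1) (nsphere 1) (p \<circ> g) id"
    by (rule cell_sphere[OF S(1)])
  \<comment> \<open>\<open>w\<close> runs once around \<open>nsphere 1\<close>, and \<open>c\<close>
    reads the two coordinates as a complex number, so that winding numbers apply.\<close>
  define w where "w = (\<lambda>s::real. \<lambda>i::nat. if i = 0 then cos (2 * pi * s) else if i = 1 then sin (2 * pi * s) else 0)"
  define c where "c = (\<lambda>x::nat \<Rightarrow> real. Complex (x 0) (x 1))"
  let ?N = "{x. (\<Sum>i\<le>1. (x i)\<^sup>2) = 1 \<and> (\<forall>i>1. x i = (0::real))} :: (nat \<Rightarrow> real) set"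
  have N: "nsphere 1 = top_of_set ?N" by (rule nsphere_top_of_set)
  have wN: "w s \<in> ?N" for s by (simp add: w_def)
  have cw: "continuous_on A w" for A
  proof (rule continuous_on_coordinatewise_then_product)
    show "continuous_on A (\<lambda>s. w s i)" for i
      unfolding w_def by (cases "i = 0"; cases "i = 1") (auto intro!: continuous_intros)
  qed
  have w01: "w 1 = w 0" by (auto simp: w_def fun_eq_iff)
  have cc: "continuous_on A c" for A
    unfolding c_def Complex_eq
    by (intro continuous_on_add continuous_on_mult continuous_on_of_real continuous_on_const continuous_on_coordinate)
  have c0: "c x \<noteq> 0" if "x \<in> ?N" for x
    using that by (auto simp: c_def complex_eq_iff)
  have pc: "continuous_on R p" "p \<in> R \<rightarrow> ?N" using p unfolding N by auto
  have gc: "continuous_on ?N g" "g \<in> ?N \<rightarrow> R" using g unfolding N by auto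
  have lw: "homotopic_loops ?N w w"
    unfolding homotopic_loops_refl
    using cw wN w01 by (auto simp: path_def path_image_def pathfinish_def pathstart_def simp del: One_nat_def)
  have lg: "homotopic_loops R (g \<circ> w) (g \<circ> w)"
    by (rule homotopic_loops_continuous_image[OF lw gc])
  define C where "C = connected_component_set R ((g \<circ> w) 0)"
  have gw: "path (g \<circ> w)" "path_image (g \<circ> w) \<subseteq> R" "pathfinish (g \<circ> w) = pathstart (g \<circ> w)"
    using lg unfolding homotopic_loops_refl by auto
  have w0: "(g \<circ> w) 0 \<in> path_image (g \<circ> w)" by (auto simp: path_image_def)
  have CC: "C \<in> components R" unfolding C_def using w0 gw(2) by (intro componentsI) blast
  have "path_image (g \<circ> w) \<subseteq> C"
    unfolding C_def using w0 gw by (intro connected_component_maximal connected_path_image) auto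
  moreover have "\<not> simply_connected C"
  proof
    assume "simply_connected C"
    then have "homotopic_loops C (g \<circ> w) (\<lambda>_. (g \<circ> w) 0)"
    proof -
      have "path (\<lambda>_::real. (g \<circ> w) 0)" "path_image (\<lambda>_. (g \<circ> w) 0) \<subseteq> C"
        "pathfinish (\<lambda>_. (g \<circ> w) 0) = pathstart (\<lambda>_. (g \<circ> w) 0)"
        using w0 \<open>path_image (g \<circ> w) \<subseteq> C\<close>
        by (auto simp: path_def path_image_def pathfinish_def pathstart_def)
      then show ?thesis
        using \<open>simply_connected C\<close> gw \<open>path_image (g \<circ> w) \<subseteq> C\<close> unfolding simply_connected_def by blast
    qed
    then have "homotopic_loops R (g \<circ> w) (\<lambda>_. (g \<circ> w) 0)"
      by (rule homotopic_loops_subset) (use CC in_components_subset in blast)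
    then have "homotopic_loops ?N (p \<circ> (g \<circ> w)) (p \<circ> (\<lambda>_. (g \<circ> w) 0))"
      by (rule homotopic_loops_continuous_image[OF _ pc])
    moreover have "homotopic_loops ?N (p \<circ> (g \<circ> w)) w"
    proof -
      obtain h where h: "continuous_on ({0..1::real} \<times> ?N) h" "h \<in> {0..1} \<times> ?N \<rightarrow> ?N"
        "\<And>x. x \<in> ?N \<Longrightarrow> h (0, x) = p (g x)" "\<And>x. x \<in> ?N \<Longrightarrow> h (1, x) = x"
        using pg unfolding N homotopic_with_def
        by (auto simp: subtopology_Times[symmetric] simp del: One_nat_def)
      have "continuous_on ({0..1} \<times> {0..1}) (\<lambda>z. (fst z, w (snd z)))"
        by (intro continuous_on_Pair continuous_on_fst continuous_on_id
              continuous_on_compose2[OF cw[of UNIV] continuous_on_snd[OF continuous_on_id]]) auto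
      then have "continuous_on ({0..1} \<times> {0..1}) (\<lambda>z. h (fst z, w (snd z)))"
        by (rule continuous_on_compose2[OF h(1)]) (use wN in auto)
      then show ?thesis
        unfolding homotopic_loops using h(2-4) wN w01
        by (intro exI[of _ "\<lambda>z. h (fst z, w (snd z))"]) (auto simp: pathfinish_def pathstart_def simp del: One_nat_def)
    qed
    ultimately have "homotopic_loops ?N w (p \<circ> (\<lambda>_. (g \<circ> w) 0))"
      using homotopic_loops_sym homotopic_loops_trans by blast
    then have *: "homotopic_loops (- {0}) (c \<circ> w) (c \<circ> (p \<circ> (\<lambda>_. (g \<circ> w) 0)))"
      by (rule homotopic_loops_continuous_image[OF _ cc]) (use c0 in auto)
    have "c \<circ> w = circlepath 0 1"
      by (auto simp: c_def w_def circlepath exp_Euler complex_eq_iff fun_eq_iff cos_of_real sin_of_real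
            Re_exp Im_exp)
    moreover define d where "d = c (p ((g \<circ> w) 0))"
    have "c \<circ> (p \<circ> (\<lambda>_. (g \<circ> w) 0)) = linepath d d"
      by (auto simp: d_def fun_eq_iff linepath_refl)
    ultimately have "homotopic_loops (- {0}) (circlepath 0 1) (linepath d d)" using * by simp
    moreover from this have "d \<noteq> 0" using homotopic_loops_imp_subset by fastforce
    ultimately show False
      using winding_number_homotopic_loops[of 0 "circlepath 0 1" "linepath d d"]
      by (simp add: winding_number_circlepath_centre)
  qed
  ultimately show ?thesis using CC by blast
qed

end

section \<open>Homology of coned complexes\<close>

definition pm_scale :: "rat \<Rightarrow> ('b \<Rightarrow>\<^sub>0 rat) \<Rightarrow> ('b \<Rightarrow>\<^sub>0 rat)" where
  "pm_scale t x = Poly_Mapping.map (\<lambda>s. t * s) x"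

lemma lookup_pm_scale [simp]: "Poly_Mapping.lookup (pm_scale t x) k = t * Poly_Mapping.lookup x k"
  unfolding pm_scale_def by (simp add: Poly_Mapping.map.rep_eq when_def)

lemma pm_scale_simps:
  "pm_scale t (x + y) = pm_scale t x + pm_scale t y" "pm_scale (s + t) x = pm_scale s x + pm_scale t x"
  "pm_scale s (pm_scale t x) = pm_scale (s * t) x" "pm_scale 1 x = x" "pm_scale 0 x = 0" "pm_scale t 0 = 0"
  by (rule poly_mapping_eqI; simp add: lookup_add algebra_simps)+

lemma pm_scale_sum: "pm_scale t (sum f A) = (\<Sum>x\<in>A. pm_scale t (f x))"
  by (rule poly_mapping_eqI) (simp add: lookup_sum sum_distrib_left)

definition pm_subspace :: "('b \<Rightarrow>\<^sub>0 rat) set \<Rightarrow> bool" where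
  "pm_subspace Z \<longleftrightarrow> 0 \<in> Z \<and> (\<forall>x\<in>Z. \<forall>y\<in>Z. x + y \<in> Z) \<and> (\<forall>t. \<forall>x\<in>Z. pm_scale t x \<in> Z)"

lemma pm_subspaceD:
  assumes "pm_subspace Z"
  shows "0 \<in> Z" "x \<in> Z \<Longrightarrow> y \<in> Z \<Longrightarrow> x + y \<in> Z" "x \<in> Z \<Longrightarrow> pm_scale t x \<in> Z"
    "x \<in> Z \<Longrightarrow> - x \<in> Z" "x \<in> Z \<Longrightarrow> y \<in> Z \<Longrightarrow> x - y \<in> Z"
proof -
  show s: "0 \<in> Z" "x \<in> Z \<Longrightarrow> y \<in> Z \<Longrightarrow> x + y \<in> Z" "x \<in> Z \<Longrightarrow> pm_scale t x \<in> Z" for x y t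
    using assms by (auto simp: pm_subspace_def)
  have "- x = pm_scale (- 1) x" for x :: "'a \<Rightarrow>\<^sub>0 rat" by (rule poly_mapping_eqI) simp
  then show m: "x \<in> Z \<Longrightarrow> - x \<in> Z" for x using s(3)[of x "-1"] by simp
  show "x \<in> Z \<Longrightarrow> y \<in> Z \<Longrightarrow> x - y \<in> Z" using s(2)[of x "- y"] m by simp
qed

lemma pm_subspace_sum:
  assumes "pm_subspace Z" "\<And>i. i \<in> A \<Longrightarrow> f i \<in> Z" shows "sum f A \<in> Z"
  using assms(2) by (induction A rule: infinite_finite_induct) (auto simp: pm_subspaceD[OF assms(1)])

text \<open>The coefficients at the elements of \<open>I\<close> are linear functionals on
  \<open>Z\<close> whose common kernel is \<open>B\<close>, and the \<open>z S\<close> form a dual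
  family. Their classes are therefore a basis of the quotient.\<close>

lemma dim_quotient_space:
  fixes Z B :: "('b \<Rightarrow>\<^sub>0 rat) set" and I :: "'b set"
  assumes Z: "pm_subspace Z" and I: "finite I"
    and B: "B = {c \<in> Z. \<forall>S\<in>I. Poly_Mapping.lookup c S = 0}"
    and z: "\<And>S. S \<in> I \<Longrightarrow> z S \<in> Z"
    and dual: "\<And>S T. S \<in> I \<Longrightarrow> T \<in> I \<Longrightarrow> Poly_Mapping.lookup (z S) T = (if S = T then 1 else 0)"
  shows "vectorspace.dim class_ring (quotient_space Z B) = card I"
proof -
  let ?V = "quotient_space Z B"
  have Bs: "pm_subspace B"
    unfolding B pm_subspace_def using pm_subspaceD[OF Z] by (auto simp: lookup_add)
  note ZD = pm_subspaceD[OF Z] and BD = pm_subspaceD[OF Bs]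
  define cl where "cl = (\<lambda>x. (+) x ` B)"
  have cl_mem: "w \<in> cl x \<longleftrightarrow> w - x \<in> B" for w x
    unfolding cl_def by (metis (no_types, lifting) add_diff_cancel_left' diff_add_cancel add.commute image_iff)
  have cl_eq: "cl x = cl y \<longleftrightarrow> x - y \<in> B" for x y
  proof
    assume "cl x = cl y"
    moreover have "x \<in> cl x" using BD(1) by (simp add: cl_mem)
    ultimately show "x - y \<in> B" by (simp add: cl_mem)
  next
    assume xy: "x - y \<in> B"
    have "w - x \<in> B \<longleftrightarrow> w - y \<in> B" for w
    proof
      assume "w - x \<in> B" from BD(2)[OF this xy] show "w - y \<in> B" by simp
    next
      assume "w - y \<in> B" from BD(5)[OF this xy] show "w - x \<in> B" by simp
    qed
    then show "cl x = cl y" by (auto simp: cl_mem)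
  qed
  have carr: "carrier ?V = cl ` Z" by (simp add: quotient_space_def cl_def)
  have clZ: "cl x \<in> carrier ?V" if "x \<in> Z" for x using that carr by simp
  have zero: "\<zero>\<^bsub>?V\<^esub> = cl 0" by (simp add: quotient_space_def cl_def)
  have add: "cl x \<oplus>\<^bsub>?V\<^esub> cl y = cl (x + y)" for x y
  proof -
    have "(\<exists>u v. w = u + v \<and> u \<in> cl x \<and> v \<in> cl y) \<longleftrightarrow> w \<in> cl (x + y)" for w
    proof
      assume "\<exists>u v. w = u + v \<and> u \<in> cl x \<and> v \<in> cl y"
      then obtain u v where uv: "w = u + v" "u - x \<in> B" "v - y \<in> B" by (auto simp: cl_mem)
      have "w - (x + y) = (u - x) + (v - y)" using uv by simp
      then show "w \<in> cl (x + y)" using BD(2)[OF uv(2,3)] by (simp only: cl_mem)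
    next
      assume "w \<in> cl (x + y)"
      then have "w = (w - y) + y" "w - y \<in> cl x" "y \<in> cl y" using BD(1) by (auto simp: cl_mem algebra_simps)
      then show "\<exists>u v. w = u + v \<and> u \<in> cl x \<and> v \<in> cl y" by blast
    qed
    then show ?thesis by (auto simp: quotient_space_def)
  qed
  have smult: "t \<odot>\<^bsub>?V\<^esub> cl x = cl (pm_scale t x)" for t x
  proof -
    have "(\<exists>u v. w = pm_scale t u + v \<and> u \<in> cl x \<and> v \<in> B) \<longleftrightarrow> w \<in> cl (pm_scale t x)" for w
    proof
      assume "\<exists>u v. w = pm_scale t u + v \<and> u \<in> cl x \<and> v \<in> B"
      then obtain u v where uv: "w = pm_scale t u + v" "u - x \<in> B" "v \<in> B" by (auto simp: cl_mem)
      have "w - pm_scale t x = pm_scale t (u - x) + v"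
        unfolding uv(1) by (rule poly_mapping_eqI) (simp add: lookup_add lookup_minus algebra_simps)
      then show "w \<in> cl (pm_scale t x)" using BD(2)[OF BD(3)[OF uv(2)] uv(3)] by (simp add: cl_mem)
    next
      assume "w \<in> cl (pm_scale t x)"
      then have "w = pm_scale t x + (w - pm_scale t x)" "x \<in> cl x" "w - pm_scale t x \<in> B"
        using BD(1) by (auto simp: cl_mem)
      then show "\<exists>u v. w = pm_scale t u + v \<and> u \<in> cl x \<and> v \<in> B" by blast
    qed
    then show ?thesis by (auto simp: quotient_space_def pm_scale_def)
  qed
  have ag: "abelian_group ?V"
  proof (rule abelian_groupI)
    show "\<exists>y\<in>carrier ?V. y \<oplus>\<^bsub>?V\<^esub> x = \<zero>\<^bsub>?V\<^esub>" if "x \<in> carrier ?V" for x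
    proof -
      obtain w where w: "x = cl w" "w \<in> Z" using \<open>x \<in> carrier ?V\<close> unfolding carr by blast
      then have "cl (- w) \<oplus>\<^bsub>?V\<^esub> x = \<zero>\<^bsub>?V\<^esub>" by (simp add: add zero)
      then show ?thesis using clZ[OF ZD(4)[OF w(2)]] by blast
    qed
  qed (auto simp: carr add zero ZD algebra_simps)
  have "vectorspace class_ring ?V"
  proof (rule vectorspace.intro)
    show "field (class_ring :: rat ring)" by (rule class_field)
    show "Module.module class_ring ?V"
    proof (rule moduleI)
      show "cring (class_ring :: rat ring)" by (rule class_cring.cring_axioms)
    qed (auto simp: ag carr add smult ZD pm_scale_simps)
  qed
  then interpret vectorspace class_ring ?V .
  have fs: "finsum ?V (\<lambda>S. cl (x S)) J = cl (\<Sum>S\<in>J. x S)" if "finite J" "\<And>S. S \<in> J \<Longrightarrow> x S \<in> Z" for x and J :: "'b set"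
    using that
  proof (induction J rule: finite_induct)
    case (insert S J)
    then have "finsum ?V (\<lambda>S. cl (x S)) (insert S J) = cl (x S) \<oplus>\<^bsub>?V\<^esub> finsum ?V (\<lambda>S. cl (x S)) J"
      by (intro finsum_insert) (auto intro: clZ)
    then show ?case using insert by (simp add: add)
  qed (simp add: zero)
  let ?A = "(\<lambda>S. cl (z S)) ` I"
  have inj: "inj_on (\<lambda>S. cl (z S)) I"
  proof (rule inj_onI)
    fix S T assume ST: "S \<in> I" "T \<in> I" "cl (z S) = cl (z T)"
    then have "Poly_Mapping.lookup (z S - z T) S = 0" unfolding cl_eq by (simp add: B)
    then show "S = T" using dual[of S S] dual[of T S] ST by (auto simp: lookup_minus split: if_splits)
  qed
  have A: "?A \<subseteq> carrier ?V" using z clZ by auto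
  have lc: "lincomb c ?A = cl (\<Sum>S\<in>I. pm_scale (c (cl (z S))) (z S))" for c
  proof -
    have "lincomb c ?A = finsum ?V (\<lambda>X. c X \<odot>\<^bsub>?V\<^esub> X) ?A" by (simp add: lincomb_def)
    also have "\<dots> = finsum ?V (\<lambda>S. c (cl (z S)) \<odot>\<^bsub>?V\<^esub> cl (z S)) I"
      by (rule finsum_reindex[OF _ inj]) (use z ZD(3) in \<open>auto simp: smult intro!: clZ\<close>)
    also have "\<dots> = cl (\<Sum>S\<in>I. pm_scale (c (cl (z S))) (z S))"
      unfolding smult by (rule fs[OF I]) (use z ZD in auto)
    finally show ?thesis .
  qed
  have lk: "Poly_Mapping.lookup (\<Sum>S\<in>I. pm_scale (c S) (z S)) T = c T" if "T \<in> I" for c T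
    using that I by (simp add: lookup_sum dual if_distrib[of "(*) _"] cong: if_cong)
  have "lin_indpt ?A"
  proof (rule finite_lin_indpt2)
    fix c :: "('b \<Rightarrow>\<^sub>0 rat) set \<Rightarrow> rat"
    assume "lincomb c ?A = \<zero>\<^bsub>?V\<^esub>"
    then have "(\<Sum>S\<in>I. pm_scale (c (cl (z S))) (z S)) \<in> B" unfolding lc zero cl_eq by simp
    then have "c (cl (z T)) = 0" if "T \<in> I" for T
      using lk[OF that, of "\<lambda>S. c (cl (z S))"] that by (simp add: B)
    then show "\<forall>v\<in>?A. c v = \<zero>\<^bsub>class_ring\<^esub>" by auto
  qed (use I A in auto)
  moreover have "gen_set ?A"
  proof -
    have "X \<in> span ?A" if X: "X \<in> carrier ?V" for X
    proof -
      obtain x where x: "X = cl x" "x \<in> Z" using X carr by auto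
      \<comment> \<open>The coefficients of \<open>lincomb\<close> are indexed by cosets;
        \<open>inv_into\<close> recovers the element of \<open>I\<close> at which the representative
        \<open>x\<close> is to be read off.\<close>
      define c where "c = (\<lambda>Y. Poly_Mapping.lookup x (inv_into I (\<lambda>S. cl (z S)) Y))"
      have c: "c (cl (z S)) = Poly_Mapping.lookup x S" if "S \<in> I" for S
        using that inj inv_into_f_f[OF inj that] by (simp add: c_def)
      let ?s = "\<Sum>S\<in>I. pm_scale (c (cl (z S))) (z S)"
      have "?s \<in> Z" by (rule pm_subspace_sum[OF Z]) (use z ZD in auto)
      then have "x - ?s \<in> B"
        using x(2) ZD lk[of _ "\<lambda>S. c (cl (z S))"] c by (auto simp: B lookup_minus)
      then have "X = lincomb c ?A" unfolding lc x(1) by (simp add: cl_eq)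
      then show ?thesis unfolding finite_span[OF finite_imageI[OF I] A] by auto
    qed
    moreover have "span ?A \<subseteq> carrier ?V" by (rule span_is_subset2[OF A])
    ultimately show ?thesis by blast
  qed
  ultimately have "dim = card ?A" using I A by (intro dim_basis) (auto simp: basis_def)
  then show ?thesis by (simp add: card_image[OF inj])
qed

section \<open>Linear extension of maps given on faces\<close>

definition pm_extend :: "('a \<Rightarrow> ('b \<Rightarrow>\<^sub>0 rat)) \<Rightarrow> ('a \<Rightarrow>\<^sub>0 rat) \<Rightarrow> ('b \<Rightarrow>\<^sub>0 rat)" where
  "pm_extend f c = (\<Sum>S\<in>Poly_Mapping.keys c. pm_scale (Poly_Mapping.lookup c S) (f S))"

lemma pm_extend_superset:
  assumes "finite A" "Poly_Mapping.keys c \<subseteq> A"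
  shows "pm_extend f c = (\<Sum>S\<in>A. pm_scale (Poly_Mapping.lookup c S) (f S))"
  unfolding pm_extend_def using assms
  by (intro sum.mono_neutral_left) (auto simp: in_keys_iff pm_scale_simps)

lemma pm_extend_add: "pm_extend f (c + d) = pm_extend f c + pm_extend f d"
proof -
  let ?A = "Poly_Mapping.keys c \<union> Poly_Mapping.keys d"
  have "pm_extend f e = (\<Sum>S\<in>?A. pm_scale (Poly_Mapping.lookup e S) (f S))" if "e \<in> {c, d, c + d}" for e
    using that keys_add[of c d] by (intro pm_extend_superset) auto
  then show ?thesis by (simp add: lookup_add pm_scale_simps sum.distrib)
qed

lemma pm_extend_scale: "pm_extend f (pm_scale t c) = pm_scale t (pm_extend f c)"
proof -
  have "pm_extend f (pm_scale t c) = (\<Sum>S\<in>Poly_Mapping.keys c. pm_scale (Poly_Mapping.lookup (pm_scale t c) S) (f S))"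
    by (intro pm_extend_superset) (auto simp: in_keys_iff)
  then show ?thesis by (simp add: pm_extend_def pm_scale_sum pm_scale_simps)
qed

lemma pm_extend_0 [simp]: "pm_extend f 0 = 0"
  by (simp add: pm_extend_def)

lemma pm_extend_sum: "pm_extend f (sum g A) = (\<Sum>x\<in>A. pm_extend f (g x))"
  by (induction A rule: infinite_finite_induct) (auto simp: pm_extend_add)

lemma pm_extend_single: "pm_extend f (Poly_Mapping.single S t) = pm_scale t (f S)"
  by (simp add: pm_extend_def pm_scale_simps)

lemma pm_extend_extend: "pm_extend f (pm_extend g c) = pm_extend (\<lambda>S. pm_extend f (g S)) c"
  unfolding pm_extend_def[of g] pm_extend_def[of "\<lambda>S. pm_extend f (g S)"]
  by (simp add: pm_extend_sum pm_extend_scale)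

lemma pm_extend_plus_fun: "pm_extend f c + pm_extend g c = pm_extend (\<lambda>S. f S + g S) c"
  by (simp add: pm_extend_def pm_scale_simps sum.distrib)

lemma pm_extend_identity: "pm_extend (\<lambda>S. Poly_Mapping.single S 1) c = c"
  by (rule poly_mapping_eqI)
     (simp add: pm_extend_def lookup_sum lookup_single when_def in_keys_iff if_distrib[of "(*) _"] cong: if_cong)

lemma pm_extend_cong:
  "(\<And>S. S \<in> Poly_Mapping.keys c \<Longrightarrow> f S = g S) \<Longrightarrow> pm_extend f c = pm_extend g c"
  by (simp add: pm_extend_def)

lemma keys_pm_extend: "Poly_Mapping.keys (pm_extend f c) \<subseteq> (\<Union>S\<in>Poly_Mapping.keys c. Poly_Mapping.keys (f S))"
  by (rule ccontr) (auto simp: pm_extend_def in_keys_iff lookup_sum intro!: sum.neutral dest: sum.neutral)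

section \<open>Boundary and cone operators on faces\<close>

definition face_sign :: "'v::linorder set \<Rightarrow> 'v \<Rightarrow> rat" where
  "face_sign S v = (-1) ^ card {u \<in> S. u < v}"

definition face_boundary :: "'v::linorder set \<Rightarrow> ('v set \<Rightarrow>\<^sub>0 rat)" where
  "face_boundary S = (\<Sum>v\<in>S. Poly_Mapping.single (S - {v}) (face_sign S v))"

lemma pm_scale_single: "pm_scale t (Poly_Mapping.single S s) = Poly_Mapping.single S (t * s)"
  by (rule poly_mapping_eqI) (simp add: lookup_single when_def)

lemma boundary_eq_extend: "boundary c = pm_extend face_boundary c"
  by (simp add: boundary_def pm_extend_def face_boundary_def face_sign_def pm_scale_sum pm_scale_single mult.commute)

lemma keys_face_boundary: "Poly_Mapping.keys (face_boundary S) \<subseteq> (\<lambda>v. S - {v}) ` S"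
proof
  fix T assume "T \<in> Poly_Mapping.keys (face_boundary S)"
  then have "(\<Sum>v\<in>S. Poly_Mapping.lookup (Poly_Mapping.single (S - {v}) (face_sign S v)) T) \<noteq> 0"
    by (simp add: face_boundary_def in_keys_iff lookup_sum)
  then obtain v where "v \<in> S" "Poly_Mapping.lookup (Poly_Mapping.single (S - {v}) (face_sign S v)) T \<noteq> 0"
    by (meson sum.not_neutral_contains_not_neutral)
  then show "T \<in> (\<lambda>v. S - {v}) ` S" by (auto simp: lookup_single when_def split: if_splits)
qed

text \<open>For \<open>v < w\<close>, removing \<open>v\<close> moves \<open>w\<close> down by one
  position, whereas removing \<open>w\<close> leaves the position of \<open>v\<close>
  unchanged.\<close>

lemma face_sign_swap:
  assumes "finite S" "v \<in> S" "w \<in> S" "v \<noteq> w"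
  shows "face_sign S v * face_sign (S - {v}) w = - (face_sign S w * face_sign (S - {w}) v)"
  using assms
proof (induction v w rule: linorder_wlog)
  case (le v w)
  then have "v < w" by simp
  have "{u \<in> S. u < w} = insert v {u \<in> S - {v}. u < w}" using \<open>v < w\<close> le by auto
  then have "card {u \<in> S. u < w} = Suc (card {u \<in> S - {v}. u < w})" using le by simp
  moreover have "{u \<in> S - {w}. u < v} = {u \<in> S. u < v}" using \<open>v < w\<close> by auto
  ultimately show ?case by (simp add: face_sign_def)
next
  case (sym v w)
  then show ?case by simp
qed

text \<open>The double sum over ordered pairs of removed vertices changes sign when the pair is
  swapped, so it equals its own negative, which over the rationals forces it to be 0.\<close>

lemma boundary_face_boundary:
  assumes "finite S" shows "pm_extend face_boundary (face_boundary S) = 0"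
proof -
  \<comment> \<open>The value 0 on the diagonal lets both indices range over all of
    \<open>S\<close>, so that the sums can be exchanged.\<close>
  let ?g = "\<lambda>v w. if v \<noteq> w then Poly_Mapping.single (S - {v, w}) (face_sign S v * face_sign (S - {v}) w) else 0"
  have X: "pm_extend face_boundary (face_boundary S) = (\<Sum>v\<in>S. \<Sum>w\<in>S. ?g v w)" (is "_ = ?X")
  proof -
    have "pm_scale (face_sign S v) (face_boundary (S - {v})) = (\<Sum>w\<in>S. ?g v w)" if "v \<in> S" for v
    proof -
      have "pm_scale (face_sign S v) (face_boundary (S - {v})) = (\<Sum>w\<in>S - {v}. ?g v w)"
        unfolding face_boundary_def pm_scale_sum pm_scale_single
        by (intro sum.cong) (auto simp: Diff_insert2[symmetric] insert_commute)
      also have "\<dots> = (\<Sum>w\<in>S. ?g v w)" using assms by (intro sum.mono_neutral_left) auto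
      finally show ?thesis .
    qed
    then show ?thesis
      unfolding face_boundary_def[of S] by (simp add: pm_extend_sum pm_extend_single)
  qed
  have antisym: "?X = - ?X"
  proof -
    have g: "?g w v = - ?g v w" if "v \<in> S" "w \<in> S" for v w
      using face_sign_swap[OF assms that] by (auto simp: insert_commute single_uminus)
    have "(\<Sum>v\<in>S. \<Sum>w\<in>S. ?g w v) = (\<Sum>v\<in>S. \<Sum>w\<in>S. - ?g v w)"
      by (intro sum.cong refl g)
    also have "\<dots> = - ?X" by (simp add: sum_negf)
    finally show ?thesis by (subst sum.swap) simp
  qed
  have zero: "X = 0" if "X = - X" for X :: "'a set \<Rightarrow>\<^sub>0 rat"
  proof (rule poly_mapping_eqI)
    fix k have "Poly_Mapping.lookup X k = - Poly_Mapping.lookup X k" using that lookup_uminus by metis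
    then show "Poly_Mapping.lookup X k = Poly_Mapping.lookup 0 k" by simp
  qed
  show ?thesis unfolding X by (rule zero[OF antisym])
qed

definition face_cone :: "'v \<Rightarrow> 'v set \<Rightarrow> ('v set \<Rightarrow>\<^sub>0 rat)" where
  "face_cone a S = (if a \<in> S then 0 else Poly_Mapping.single (insert a S) 1)"

text \<open>As least vertex, \<open>a\<close> is removed with sign 1 and moves every other vertex up
  by one position, which reverses its sign.\<close>

lemma face_boundary_insert:
  assumes "finite S" "a \<notin> S" "\<And>v. v \<in> S \<Longrightarrow> a \<le> v"
  shows "face_boundary (insert a S) + (\<Sum>v\<in>S. Poly_Mapping.single (insert a (S - {v})) (face_sign S v))
    = Poly_Mapping.single S 1"
proof -
  have less: "a < v" if "v \<in> S" for v using assms(2,3) that by (metis order.not_eq_order_implies_strict)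
  have "face_boundary (insert a S) = Poly_Mapping.single S (face_sign (insert a S) a)
      + (\<Sum>v\<in>S. Poly_Mapping.single (insert a S - {v}) (face_sign (insert a S) v))"
    unfolding face_boundary_def using assms by (subst sum.insert) auto
  also have "face_sign (insert a S) a = 1"
  proof -
    have "{u \<in> insert a S. u < a} = {}" using less by fastforce
    then show ?thesis unfolding face_sign_def by (simp only: card.empty power_0)
  qed
  also have "(\<Sum>v\<in>S. Poly_Mapping.single (insert a S - {v}) (face_sign (insert a S) v))
      = (\<Sum>v\<in>S. - Poly_Mapping.single (insert a (S - {v})) (face_sign S v))"
  proof (rule sum.cong[OF refl])
    fix v assume v: "v \<in> S"
    have "{u \<in> insert a S. u < v} = insert a {u \<in> S. u < v}" using less[OF v] by auto
    then have "face_sign (insert a S) v = - face_sign S v" using assms by (simp add: face_sign_def)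
    moreover have "insert a S - {v} = insert a (S - {v})" using v assms(2) by auto
    ultimately show "Poly_Mapping.single (insert a S - {v}) (face_sign (insert a S) v)
        = - Poly_Mapping.single (insert a (S - {v})) (face_sign S v)" by (simp add: single_uminus)
  qed
  finally show ?thesis by (simp add: sum_negf)
qed

text \<open>The cone operator is a contracting chain homotopy, in the augmented complex also at the
  empty face. If \<open>a\<close> already belongs to \<open>S\<close>, the cone of \<open>S\<close>
  is 0 and only the boundary term without \<open>a\<close> survives coning.\<close>

lemma face_cone_homotopy:
  assumes "finite S" "\<And>v. v \<in> S \<Longrightarrow> a \<le> v"
  shows "pm_extend face_boundary (face_cone a S) + pm_extend (face_cone a) (face_boundary S) = Poly_Mapping.single S 1"
proof (cases "a \<in> S")
  case False
  have "pm_extend (face_cone a) (face_boundary S) = (\<Sum>v\<in>S. Poly_Mapping.single (insert a (S - {v})) (face_sign S v))"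
    unfolding face_boundary_def using False
    by (simp add: pm_extend_sum pm_extend_single face_cone_def pm_scale_single)
  then show ?thesis
    using face_boundary_insert[OF assms(1) False assms(2)] False
    by (simp add: face_cone_def pm_extend_single pm_scale_simps)
next
  case True
  have "pm_extend (face_cone a) (face_boundary S) = (\<Sum>v\<in>S. pm_scale (face_sign S v) (face_cone a (S - {v})))"
    unfolding face_boundary_def by (simp add: pm_extend_sum pm_extend_single)
  also have "\<dots> = (\<Sum>v\<in>S. if v = a then Poly_Mapping.single S (face_sign S a) else 0)"
    using True by (intro sum.cong) (auto simp: face_cone_def pm_scale_simps pm_scale_single insert_absorb)
  also have "\<dots> = Poly_Mapping.single S (face_sign S a)" using True assms(1) by simp
  also have "face_sign S a = 1"
  proof -
    have "{u \<in> S. u < a} = {}" using assms(2) by fastforce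
    then show ?thesis unfolding face_sign_def by (simp only: card.empty power_0)
  qed
  finally show ?thesis using True by (simp add: face_cone_def[of a S])
qed

section \<open>Reduced homology of coned complexes\<close>

lemma pm_subspace_cycles: "pm_subspace (cycles K r)"
proof -
  have "Poly_Mapping.keys (pm_scale t x) \<subseteq> Poly_Mapping.keys x" for t and x :: "'a set \<Rightarrow>\<^sub>0 rat"
    by (auto simp: in_keys_iff)
  then show ?thesis
    unfolding pm_subspace_def cycles_def chains_def boundary_eq_extend
    using keys_add by (fastforce simp: pm_extend_add pm_extend_scale pm_scale_simps)
qed

text \<open>A cell never occurs in a boundary, because it is maximal; conversely a cycle that avoids
  the cells is the boundary of its cone. So the boundaries are the common kernel of the coefficients
  at the cells. Dual to these are the boundaries of the simplices \<open>insert a S\<close>, which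
  are cycles of \<open>K\<close> although \<open>insert a S\<close> is not a face: all their terms
  except \<open>S\<close> contain \<open>a\<close> and hence are not cells.\<close>

lemma dim_reduced_homology:
  fixes K :: "'v::linorder set set"
  assumes "coned_complex K a F" and least: "\<And>v. v \<in> \<Union>K \<Longrightarrow> a \<le> v"
  shows "vectorspace.dim class_ring (reduced_homology K j) = card {S \<in> F. card S = j + 1}"
proof -
  interpret coned_complex K a F by (rule assms(1))
  let ?Z = "cycles K (j + 1)" and ?I = "{S \<in> F. card S = j + 1}"
  have fin: "finite S" if "S \<in> insert {} K" for S using that face_finite by auto
  have bb: "boundary (boundary c) = 0" if "c \<in> chains K r" for c r
  proof -
    have "boundary (boundary c) = pm_extend (\<lambda>S. 0) c"
      unfolding boundary_eq_extend pm_extend_extend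
      by (rule pm_extend_cong, rule boundary_face_boundary) (use that fin in \<open>auto simp: chains_def\<close>)
    then show ?thesis by (simp add: pm_extend_def pm_scale_simps)
  qed
  have keys_b: "\<exists>S v. S \<in> Poly_Mapping.keys c \<and> v \<in> S \<and> T = S - {v}" if "T \<in> Poly_Mapping.keys (boundary c)" for T :: "'v set" and c
    using that keys_pm_extend[of face_boundary c] keys_face_boundary unfolding boundary_eq_extend by fastforce
  have B: "boundaries K (j + 1) = {c \<in> ?Z. \<forall>S\<in>?I. Poly_Mapping.lookup c S = 0}"
  proof (intro equalityI subsetI)
    fix c assume "c \<in> boundaries K (j + 1)"
    then obtain d where d: "d \<in> chains K (Suc (j + 1))" "c = boundary d" by (auto simp: boundaries_def)
    have keys_c: "\<exists>S v. S \<in> K \<and> card S = Suc (j + 1) \<and> v \<in> S \<and> T = S - {v}" if T: "T \<in> Poly_Mapping.keys c" for T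
    proof -
      obtain S v where "S \<in> Poly_Mapping.keys d" "v \<in> S" "T = S - {v}" using keys_b T d(2) by blast
      then show ?thesis using d(1) by (force simp: chains_def)
    qed
    have "c \<in> chains K (j + 1)"
      unfolding chains_def
    proof (intro CollectI subsetI)
      fix T assume "T \<in> Poly_Mapping.keys c"
      then obtain S v where S: "S \<in> K" "card S = Suc (j + 1)" "v \<in> S" "T = S - {v}" using keys_c by blast
      then show "T \<in> insert {} K \<and> card T = j + 1"
        using subface[of S T] face_finite[OF S(1)] by auto
    qed
    moreover have "Poly_Mapping.lookup c T = 0" if "T \<in> ?I" for T
    proof (rule ccontr)
      assume "Poly_Mapping.lookup c T \<noteq> 0"
      then have "T \<in> Poly_Mapping.keys c" by (simp add: in_keys_iff)
      from keys_c[OF this] obtain S v where "S \<in> K" "v \<in> S" "T = S - {v}" by blast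
      then show False using cell_maximal[of T S] that by auto
    qed
    ultimately show "c \<in> {c \<in> ?Z. \<forall>S\<in>?I. Poly_Mapping.lookup c S = 0}"
      using bb[OF d(1)] d(2) by (simp add: cycles_def)
  next
    fix c assume "c \<in> {c \<in> ?Z. \<forall>S\<in>?I. Poly_Mapping.lookup c S = 0}"
    then have c: "c \<in> chains K (j + 1)" "boundary c = 0" "\<And>S. S \<in> ?I \<Longrightarrow> Poly_Mapping.lookup c S = 0"
      by (auto simp: cycles_def)
    have keys: "S \<in> K \<and> card S = j + 1 \<and> S \<notin> F" if "S \<in> Poly_Mapping.keys c" for S
      using c(1,3) that by (force simp: chains_def in_keys_iff)
    define d where "d = pm_extend (face_cone a) c"
    have "boundary d + pm_extend (face_cone a) (boundary c) = pm_extend (\<lambda>S. Poly_Mapping.single S 1) c"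
      unfolding boundary_eq_extend d_def pm_extend_extend pm_extend_plus_fun
      by (rule pm_extend_cong, rule face_cone_homotopy) (use keys least face_finite in blast)+
    then have "c = boundary d" by (simp add: c(2) pm_extend_identity)
    moreover have "d \<in> chains K (Suc (j + 1))"
      unfolding chains_def
    proof (intro CollectI subsetI)
      fix T assume "T \<in> Poly_Mapping.keys d"
      then obtain S where S: "S \<in> Poly_Mapping.keys c" "T \<in> Poly_Mapping.keys (face_cone a S)"
        using keys_pm_extend[of "face_cone a" c] by (auto simp: d_def)
      then have "a \<notin> S" "T = insert a S" by (auto simp: face_cone_def split: if_splits)
      then show "T \<in> insert {} K \<and> card T = Suc (j + 1)"
        using keys[OF S(1)] cone[of S] face_finite[of S] by simp
    qed
    ultimately show "c \<in> boundaries K (j + 1)" by (auto simp: boundaries_def)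
  qed
  show ?thesis
    unfolding reduced_homology_def
  proof (rule dim_quotient_space[OF pm_subspace_cycles _ B, where z = "\<lambda>S. face_boundary (insert a S)"])
    show "finite ?I" using finite_cells by simp
    fix S assume S: "S \<in> ?I"
    then have SF: "S \<in> F" and cS: "card S = j + 1" by auto
    note fS = cell_finite[OF SF] and aS = apex_notin_cell[OF SF]
    have keys: "T = S \<or> (\<exists>v\<in>S. T = insert a (S - {v}))" if T: "T \<in> Poly_Mapping.keys (face_boundary (insert a S))" for T
    proof -
      obtain v where v: "v \<in> insert a S" "T = insert a S - {v}" using subsetD[OF keys_face_boundary T] by blast
      then show ?thesis using aS by (cases "v = a") auto
    qed
    have "face_boundary (insert a S) \<in> chains K (j + 1)"
      unfolding chains_def
    proof (intro CollectI subsetI)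
      fix T assume "T \<in> Poly_Mapping.keys (face_boundary (insert a S))"
      then consider "T = S" | v where "v \<in> S" "T = insert a (S - {v})" using keys by blast
      then show "T \<in> insert {} K \<and> card T = j + 1"
      proof cases
        case 1
        then show ?thesis using SF cS cells by auto
      next
        case 2
        then show ?thesis using proper_subface_cone[OF SF, of "S - {v}"] fS aS cS by auto
      qed
    qed
    moreover have "boundary (face_boundary (insert a S)) = 0"
      unfolding boundary_eq_extend by (rule boundary_face_boundary) (use fS in simp)
    ultimately show "face_boundary (insert a S) \<in> ?Z" by (simp add: cycles_def)
    fix T assume T: "T \<in> ?I"
    have "a \<le> v" if "v \<in> S" for v using least that SF cells by blast
    from arg_cong[OF face_boundary_insert[OF fS(1) aS this], of "\<lambda>X. Poly_Mapping.lookup X T"]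
    have "Poly_Mapping.lookup (face_boundary (insert a S)) T
        + (\<Sum>v\<in>S. Poly_Mapping.lookup (Poly_Mapping.single (insert a (S - {v})) (face_sign S v)) T)
        = Poly_Mapping.lookup (Poly_Mapping.single S 1) T"
      by (simp only: lookup_add lookup_sum)
    moreover have "(\<Sum>v\<in>S. Poly_Mapping.lookup (Poly_Mapping.single (insert a (S - {v})) (face_sign S v)) T) = 0"
      using apex_notin_cell[of T] T by (intro sum.neutral) (auto simp: lookup_single when_def)
    ultimately show "Poly_Mapping.lookup (face_boundary (insert a S)) T = (if S = T then 1 else 0)"
      by (simp add: lookup_single when_def)
  qed
qed

section \<open>The prime complexes\<close>

definition top_faces :: "nat \<Rightarrow> nat set set" where
  "top_faces q = {S. finite S \<and> (\<forall>p\<in>S. prime p \<and> odd p) \<and> (\<Sum>S = q - 1 \<or> \<Sum>S = q - 2)}"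

lemma top_facesD:
  assumes "S \<in> top_faces q"
  shows "finite S" "p \<in> S \<Longrightarrow> prime p" "p \<in> S \<Longrightarrow> odd p" "\<Sum>S = q - 1 \<or> \<Sum>S = q - 2"
  using assms unfolding top_faces_def by blast+

lemma finite_prime_complex: "finite (prime_complex q)"
proof -
  have "prime_complex q \<subseteq> Pow {..<q}"
  proof
    fix S assume S: "S \<in> prime_complex q"
    have "p < q" if "p \<in> S" for p
      using S member_le_sum[of p S id] that by (auto simp: prime_complex_def)
    then show "S \<in> Pow {..<q}" by auto
  qed
  then show ?thesis by (rule finite_subset) simp
qed

text \<open>A member of \<open>top_faces q\<close> has sum at least \<open>q - 2\<close>, and a
  further prime would add at least 2, so it is maximal. Any other face without 2 consists of odd
  primes and has sum below \<open>q - 2\<close>, which leaves room for 2.\<close>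

lemma coned_complex_prime_complex:
  assumes q: "q = 2 * k" "q \<ge> 4"
  shows "coned_complex (prime_complex q) 2 (top_faces q)"
proof
  \<comment> \<open>The empty set has sum 0, which differs from \<open>q - 1\<close> and
    \<open>q - 2\<close> since \<open>q \<ge> 4\<close>.\<close>
  have sum_pos: "S \<noteq> {}" if "S \<in> top_faces q" for S
    using top_facesD(4)[OF that] q(2) by (cases "S = {}") simp_all
  show sub: "top_faces q \<subseteq> prime_complex q"
  proof
    fix S assume S: "S \<in> top_faces q"
    have "\<Sum>S < q" using top_facesD(4)[OF S] q(2) by linarith
    then show "S \<in> prime_complex q"
      using top_facesD(1,2)[OF S] sum_pos[OF S] unfolding prime_complex_def by blast
  qed
  show "finite (top_faces q)"
    by (rule finite_subset[OF sub finite_prime_complex])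
  show "T \<in> prime_complex q" if "S \<in> prime_complex q" "T \<subseteq> S" "T \<noteq> {}" for S T
  proof -
    have "\<Sum>T \<le> \<Sum>S" using that by (intro sum_mono2) (auto simp: prime_complex_def)
    then show ?thesis using that finite_subset[of T S] by (auto simp: prime_complex_def)
  qed
  show "{2} \<in> prime_complex q" using q by (simp add: prime_complex_def)
  show "2 \<notin> S" if "S \<in> top_faces q" for S
    using top_facesD(3)[OF that, of 2] by auto
  show "T = S" if S: "S \<in> top_faces q" and T: "T \<in> prime_complex q" and "S \<subseteq> T" for S T
  proof (rule ccontr)
    assume "T \<noteq> S"
    then obtain p where p: "p \<in> T" "p \<notin> S" using \<open>S \<subseteq> T\<close> by blast
    have "\<Sum>(insert p S) \<le> \<Sum>T"
      using T \<open>S \<subseteq> T\<close> p by (intro sum_mono2) (auto simp: prime_complex_def)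
    moreover have "\<Sum>(insert p S) = p + \<Sum>S" using S p by (simp add: top_faces_def)
    moreover have "2 \<le> p" using T p prime_ge_2_nat by (auto simp: prime_complex_def)
    ultimately show False using S T q by (auto simp: top_faces_def prime_complex_def)
  qed
  show "insert 2 S \<in> prime_complex q" if S: "S \<in> prime_complex q" "S \<notin> top_faces q" for S
  proof (cases "2 \<in> S")
    case True
    then show ?thesis using S by (simp add: insert_absorb)
  next
    case False
    have odd: "\<forall>p\<in>S. odd p"
    proof
      fix p assume "p \<in> S"
      then have "prime p" "p \<noteq> 2" using S False by (auto simp: prime_complex_def)
      then show "odd p" using prime_odd_nat[of p] prime_ge_2_nat[of p] by (metis le_neq_implies_less)
    qed
    have "\<Sum>S < q" "\<Sum>S \<noteq> q - 1" "\<Sum>S \<noteq> q - 2"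
      using S odd by (auto simp: top_faces_def prime_complex_def)
    then have "\<Sum>S < q - 2" by linarith
    then have "\<Sum>(insert 2 S) < q" using S False by (auto simp: prime_complex_def)
    then show ?thesis using S by (auto simp: prime_complex_def)
  qed
qed (auto simp: prime_complex_def)

lemma top_faces_card:
  assumes "Od = q - 1" "Ev = q - 2"
  shows "{S \<in> top_faces q. card S = r} = odd_prime_sums r Od \<union> odd_prime_sums r Ev"
  using assms by (auto simp: top_faces_def odd_prime_sums_def)

text \<open>A one-vertex cell is an odd prime, so of the two admissible sums only the odd one,
  \<open>q - 1\<close>, can occur.\<close>

lemma prime_complex_disconnected_iff:
  assumes q: "even q" "q \<ge> 6"
  shows "\<not> connected (geom_realization (prime_complex q)) \<longleftrightarrow> prime (q - 1)"
proof -
  obtain k where k: "q = 2 * k" using q by blast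
  have "\<not> connected (geom_realization (prime_complex q)) \<longleftrightarrow> (\<exists>S\<in>top_faces q. card S = 1)"
    using coned_complex.connected_iff[OF coned_complex_prime_complex[OF k]] q by auto
  also have "\<dots> \<longleftrightarrow> (\<exists>p. {p} \<in> top_faces q)"
    by (metis card_1_singletonE is_singletonI is_singleton_altdef)
  also have "\<dots> \<longleftrightarrow> prime (q - 1)"
    using q by (auto simp: top_faces_def)
  finally show ?thesis .
qed

text \<open>Two odd primes have an even sum, so an edge cell can only have sum
  \<open>q - 2\<close>.\<close>

lemma prime_complex_non_simply_connected_iff:
  assumes q: "even q" "q \<ge> 6"
  shows "has_non_simply_connected_component (prime_complex q) \<longleftrightarrow>
    (\<exists>p r. prime p \<and> odd p \<and> prime r \<and> odd r \<and> p \<noteq> r \<and> q - 2 = p + r)"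
proof -
  obtain k where k: "q = 2 * k" using q by blast
  interpret coned_complex "prime_complex q" 2 "top_faces q"
    using coned_complex_prime_complex[OF k] q by simp
  have "finite (\<Union>(prime_complex q))"
    using finite_prime_complex face_finite by blast
  then have "has_non_simply_connected_component (prime_complex q) \<longleftrightarrow> (\<exists>S\<in>top_faces q. card S = 2)"
    unfolding has_non_simply_connected_component_def
    using simply_connected_components non_simply_connected_component by blast
  also have "\<dots> \<longleftrightarrow> (\<exists>p r. p \<noteq> r \<and> {p, r} \<in> top_faces q)"
    by (metis card_2_iff)
  also have "\<dots> \<longleftrightarrow> (\<exists>p r. prime p \<and> odd p \<and> prime r \<and> odd r \<and> p \<noteq> r \<and> q - 2 = p + r)"
  proof -
    have "{p, r} \<in> top_faces q \<longleftrightarrow> prime p \<and> odd p \<and> prime r \<and> odd r \<and> q - 2 = p + r" if "p \<noteq> r" for p r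
    proof -
      have "p + r \<noteq> q - 1" if "odd p" "odd r"
      proof
        assume "p + r = q - 1"
        then have "p + r + 1 = q" using q by simp
        then show False using that q(1) by (metis even_add odd_one)
      qed
      then show ?thesis using \<open>p \<noteq> r\<close> by (auto simp: top_faces_def)
    qed
    then show ?thesis by blast
  qed
  finally show ?thesis .
qed

lemma twin_prime_iff:
  "twin_prime_conjecture \<longleftrightarrow>
     infinite {m. even m \<and> m \<ge> 4 \<and> \<not> connected (geom_realization (prime_complex m)) \<and>
                    \<not> connected (geom_realization (prime_complex (m + 2)))}" (is "_ \<longleftrightarrow> infinite ?M")
proof -
  let ?T = "{p::nat. prime p \<and> prime (p + 2)}"
  \<comment> \<open>Disconnectedness at \<open>m\<close> and \<open>m + 2\<close> means that
    \<open>m - 1\<close> and \<open>m + 1\<close> are prime. The criterion is available from 6 on,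
    so 4 is set aside together with its predecessor 3, and 2 is excluded to make \<open>p\<close>
    odd; finitely many exceptions do not matter.\<close>
  have eq: "?M - {4} = Suc ` (?T - {2, 3})"
  proof (intro equalityI subsetI)
    fix m assume "m \<in> ?M - {4}"
    then have m: "even m" "m \<ge> 4" "m \<noteq> 4" and d: "\<not> connected (geom_realization (prime_complex m))"
      "\<not> connected (geom_realization (prime_complex (m + 2)))" by auto
    have m6: "m \<ge> 6" using m by presburger
    have "prime (m - 1)" "prime (m + 2 - 1)"
      using prime_complex_disconnected_iff[OF m(1) m6] prime_complex_disconnected_iff[of "m + 2"] m(1) m6 d by auto
    moreover have "m = Suc (m - 1)" "m + 2 - 1 = m - 1 + 2" "m - 1 \<notin> {2, 3}" using m6 by auto
    ultimately have "m - 1 \<in> ?T - {2, 3}" by simp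
    then show "m \<in> Suc ` (?T - {2, 3})" using \<open>m = Suc (m - 1)\<close> by blast
  next
    fix m assume "m \<in> Suc ` (?T - {2, 3})"
    then obtain p where "m = Suc p" "p \<in> ?T - {2, 3}" by blast
    then have p: "m = Suc p" "prime p" "prime (p + 2)" "p \<noteq> 2" "p \<noteq> 3" by blast+
    have "p > 2" using prime_ge_2_nat[OF p(2)] p(4) by simp
    then have odd: "odd p" using p(2) prime_odd_nat by blast
    then have m: "even m" "m \<ge> 6" using p \<open>p > 2\<close> by (auto, presburger)
    then show "m \<in> ?M - {4}"
      using prime_complex_disconnected_iff[OF m] prime_complex_disconnected_iff[of "m + 2"] p by auto
  qed
  have "infinite ?M \<longleftrightarrow> infinite (?M - {4})" by simp
  also have "\<dots> \<longleftrightarrow> infinite (?T - {2, 3})"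
    unfolding eq by (simp add: finite_image_iff)
  also have "\<dots> \<longleftrightarrow> infinite ?T" by simp
  finally show ?thesis by (simp add: twin_prime_conjecture_def)
qed

text \<open>For even \<open>m \<ge> 6\<close> both primes in a representation are odd, since an even
  one would force \<open>m = 2 + 2\<close>, and they are distinct unless \<open>m\<close> is twice
  an odd prime. The values left over are 4 and the doubles of odd primes, which are sums of two
  primes anyway.\<close>

lemma goldbach_iff:
  "goldbach_conjecture \<longleftrightarrow>
     (\<forall>m. even m \<and> m \<ge> 6 \<and> \<not> (\<exists>p. prime p \<and> odd p \<and> m = 2 * p) \<longrightarrow>
          has_non_simply_connected_component (prime_complex (m + 2)))"
proof -
  let ?H = "\<lambda>m. has_non_simply_connected_component (prime_complex (m + 2))"
  let ?G = "\<lambda>m::nat. \<exists>p r. prime p \<and> prime r \<and> m = p + r"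
  let ?D = "\<lambda>m::nat. \<exists>p. prime p \<and> odd p \<and> m = 2 * p"
  have H: "?H m \<longleftrightarrow> ?G m" if m: "even m" "m \<ge> 6" "\<not> ?D m" for m
  proof -
    have odd: "odd p \<and> odd r \<and> p \<noteq> r" if "prime p" "prime r" "m = p + r" for p r
    proof -
      have "odd p"
      proof
        assume "even p"
        then have "even r" using m(1) that(3) by simp
        have "p = 2" "r = 2" 
          using primes_dvd_imp_eq[OF two_is_prime_nat that(1) \<open>even p\<close>]
            primes_dvd_imp_eq[OF two_is_prime_nat that(2) \<open>even r\<close>] by simp_all
        then show False using m(2) that(3) by simp
      qed
      moreover from this have "odd r" using m(1) that(3) by simp
      moreover have "p \<noteq> r" using m(3) that \<open>odd p\<close> mult_2 by metis
      ultimately show ?thesis by blast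
    qed
    have "?H m \<longleftrightarrow> (\<exists>p r. prime p \<and> odd p \<and> prime r \<and> odd r \<and> p \<noteq> r \<and> m + 2 - 2 = p + r)"
      by (rule prime_complex_non_simply_connected_iff) (use m in auto)
    also have "\<dots> \<longleftrightarrow> ?G m" using odd unfolding add_diff_cancel_right' by blast
    finally show ?thesis .
  qed
  have four: "?G 4" by (intro exI[of _ 2]) simp
  have double: "?G m" if "?D m" for m using that by (metis mult_2)
  show ?thesis
  proof
    assume "goldbach_conjecture"
    then show "\<forall>m. even m \<and> m \<ge> 6 \<and> \<not> ?D m \<longrightarrow> ?H m"
      using H unfolding goldbach_conjecture_def by simp
  next
    assume *: "\<forall>m. even m \<and> m \<ge> 6 \<and> \<not> ?D m \<longrightarrow> ?H m"
    show "goldbach_conjecture"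
      unfolding goldbach_conjecture_def
    proof (intro allI impI)
      fix n :: nat assume n: "even n \<and> n \<ge> 4"
      then have "n = 4 \<or> n \<ge> 6" by presburger
      then consider "n = 4" | "?D n" | "even n" "n \<ge> 6" "\<not> ?D n" using n by blast
      then show "?G n"
      proof cases
        case 3
        then show ?thesis using * H[OF 3] by blast
      qed (use four double in blast)+
    qed
  qed
qed

theorem theorem1p4:
  fixes q k Od Ev :: nat
  assumes "q = 2 * k" and "q \<ge> 4"
    and "Od = 2 * k - 1" and "Ev = 2 * k - 2"
  shows
   "{int q - 2..<int q} = {int Od, int Ev} \<and>
    {n \<in> {int q - 2..<int q}. odd n} = {int Od} \<and>
    {n \<in> {int q - 2..<int q}. even n} = {int Ev} \<and>
    top_of_set (geom_realization (prime_complex q)) homotopy_equivalent_space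
      bouquet_of_spheres fst
        {(j, S). S \<in> odd_prime_sums (j + 1) Od \<union> odd_prime_sums (j + 1) Ev} \<and>
    (\<forall>j. vectorspace.dim class_ring (reduced_homology (prime_complex q) j) =
           card (odd_prime_sums (j + 1) Od \<union> odd_prime_sums (j + 1) Ev)) \<and>
    (q \<ge> 6 \<longrightarrow> (\<not> connected (geom_realization (prime_complex q)) \<longleftrightarrow> prime Od)) \<and>
    (q \<ge> 6 \<longrightarrow>
       (has_non_simply_connected_component (prime_complex q) \<longleftrightarrow>
        (\<exists>p r. prime p \<and> odd p \<and> prime r \<and> odd r \<and> p \<noteq> r \<and> Ev = p + r))) \<and>
    (twin_prime_conjecture \<longleftrightarrow>
       infinite {m. even m \<and> m \<ge> 4 \<and>
                    \<not> connected (geom_realization (prime_complex m)) \<and>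
                    \<not> connected (geom_realization (prime_complex (m + 2)))}) \<and>
    (goldbach_conjecture \<longleftrightarrow>
       (\<forall>m. even m \<and> m \<ge> 6 \<and> \<not> (\<exists>p. prime p \<and> odd p \<and> m = 2 * p) \<longrightarrow>
            has_non_simply_connected_component (prime_complex (m + 2))))"
proof (intro conjI)
  have Od: "Od = q - 1" "int Od = int q - 1" and Ev: "Ev = q - 2" "int Ev = int q - 2" using assms by auto
  show int: "{int q - 2..<int q} = {int Od, int Ev}" unfolding Od(2) Ev(2) by auto
  have par: "odd Od" "even Ev" using assms by auto
  show "{n \<in> {int q - 2..<int q}. odd n} = {int Od}" unfolding int using par by auto
  show "{n \<in> {int q - 2..<int q}. even n} = {int Ev}" unfolding int using par by auto
  note cc = coned_complex_prime_complex[OF assms(1,2)]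
  note cells = top_faces_card[OF Od(1) Ev(1)]
  have "{(j, S). S \<in> top_faces q \<and> card S = j + 1}
      = {(j, S). S \<in> odd_prime_sums (j + 1) Od \<union> odd_prime_sums (j + 1) Ev}"
    using cells by blast
  then show "top_of_set (geom_realization (prime_complex q)) homotopy_equivalent_space
      bouquet_of_spheres fst {(j, S). S \<in> odd_prime_sums (j + 1) Od \<union> odd_prime_sums (j + 1) Ev}"
    using coned_complex.homotopy_equivalent_bouquet[OF cc] by simp
  \<comment> \<open>The homology computation orients faces by the order of their vertices and takes
    the apex to be the least one.\<close>
  have "2 \<le> p" if "p \<in> \<Union>(prime_complex q)" for p
    using that prime_ge_2_nat by (auto simp: prime_complex_def)
  then show "\<forall>j. vectorspace.dim class_ring (reduced_homology (prime_complex q) j) =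
      card (odd_prime_sums (j + 1) Od \<union> odd_prime_sums (j + 1) Ev)"
    using dim_reduced_homology[OF cc] by (simp add: cells)
  have "even q" using assms(1) by simp
  show "q \<ge> 6 \<longrightarrow> (\<not> connected (geom_realization (prime_complex q)) \<longleftrightarrow> prime Od)"
    unfolding Od(1) by (rule impI, rule prime_complex_disconnected_iff[OF \<open>even q\<close>])
  show "q \<ge> 6 \<longrightarrow> (has_non_simply_connected_component (prime_complex q) \<longleftrightarrow>
        (\<exists>p r. prime p \<and> odd p \<and> prime r \<and> odd r \<and> p \<noteq> r \<and> Ev = p + r))"
    unfolding Ev(1) by (rule impI, rule prime_complex_non_simply_connected_iff[OF \<open>even q\<close>])
qed (rule twin_prime_iff goldbach_iff)+

end
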